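(* Let $\{B(t)\}_{t\ge 0}$ be a standard Brownian motion, $S(t):=\max_{0\le u\le t}B(u)$, and $\mathcal A:=\int_0^1 S(t)\,\mathrm dt$. Let $\mathcal M$ be a positive random variable with distribution given by $\mathbb P(\mathcal M>x)=\mathbb E\,e^{-x^{3/2}\mathcal A}$, $x>0$, and let $f_{\mathcal M}$ be its continuous density function. As $x\to\infty$, $$f_{\mathcal M}(x)=\frac{3}{\sqrt{2\pi}}\,x^{-5/2}+O(x^{-7/2}).$$ More precisely, $f_{\mathcal M}(x)$ has as $x\to\infty$ an asymptotic expansion $$f_{\mathcal M}(x)\sim\frac{3}{\sqrt{2\pi}}\,x^{-5/2}\;{}_3F_1\Bigl(\tfrac32,\tfrac56,1;\tfrac23;-\tfrac6{x^3}\Bigr)+\frac{5\,\Gamma(1/3)}{2^{1/2}3^{2/3}\pi^{1/2}}\,x^{-7/2}\;{}_2F_0\Bigl(\tfrac{11}6,\tfrac76;;-\tfrac6{x^3}\Bigr).$$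
   Context: ${}_pF_q(\alpha_1,\dots,\alpha_p;\beta_1,\dots,\beta_q;z)$ denotes the formal generalized hypergeometric series $\sum_{n\ge0}\frac{(\alpha_1)_n\cdots(\alpha_p)_n}{(\beta_1)_n\cdots(\beta_q)_n}\frac{z^n}{n!}$, where $(\alpha)_n=\alpha(\alpha+1)\cdots(\alpha+n-1)$. The series here are divergent and the expansion is interpreted in the usual asymptotic sense: combining the two series into one formal series of terms with powers $x^{-5/2},x^{-7/2},x^{-11/2},x^{-13/2},\dots$, if the series is truncated after any fixed number of terms, the error is, as $x\to\infty$, of the order of the first omitted term. The variable $\mathcal M$ has a density continuous on $(0,\infty)$, and $f_{\mathcal M}$ is this version. *)

theory Defs
  imports
    "HOL-Probability.Probability"
    "HOL-Computational_Algebra.Formal_Power_Series"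
    "HOL-Library.Landau_Symbols"
begin

text \<open>
  The values \<open>B t\<close> are only constrained for \<open>t \<ge> 0\<close>. Continuity is required of every path,
  so that the functionals of the path below are measurable on a possibly incomplete space.
\<close>

locale standard_brownian_motion = prob_space M
  for M :: "'a measure" and B :: "real \<Rightarrow> 'a \<Rightarrow> real" +
  assumes measurable_B: "\<And>t. 0 \<le> t \<Longrightarrow> B t \<in> borel_measurable M"
    and starts_at_0: "AE \<omega> in M. B 0 \<omega> = 0"
    and continuous_paths: "\<And>\<omega>. \<omega> \<in> space M \<Longrightarrow> continuous_on {0..} (\<lambda>t. B t \<omega>)"
    and gaussian_increments: "\<And>s t. 0 \<le> s \<Longrightarrow> s < t \<Longrightarrow>
      distributed M lborel (\<lambda>\<omega>. B t \<omega> - B s \<omega>) (\<lambda>x. ennreal (normal_density 0 (sqrt (t - s)) x))"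
    and indep_increments: "\<And>(n::nat) (t :: nat \<Rightarrow> real). 0 \<le> t 0 \<Longrightarrow> (\<And>i. i < n \<Longrightarrow> t i \<le> t (Suc i)) \<Longrightarrow>
      indep_vars (\<lambda>_. borel) (\<lambda>i \<omega>. B (t (Suc i)) \<omega> - B (t i) \<omega>) {..<n}"

text \<open>For continuous paths the supremum is attained, i.e. it is the maximum.\<close>

definition running_max :: "(real \<Rightarrow> 'a \<Rightarrow> real) \<Rightarrow> real \<Rightarrow> 'a \<Rightarrow> real" where
  "running_max B t \<omega> = (SUP u\<in>{0..t}. B u \<omega>)"

definition max_area :: "(real \<Rightarrow> 'a \<Rightarrow> real) \<Rightarrow> 'a \<Rightarrow> real" where
  "max_area B \<omega> = (LINT t:{0..1}|lborel. running_max B t \<omega>)"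

text \<open>
  The terms \<open>\<phi> 0, \<phi> 1, \<dots>\<close> of the formal series are functions, and \<open>\<Sum>k<N. \<phi> k\<close> is the truncation
  whose first omitted term is \<open>\<phi> N\<close>.
\<close>

definition has_asymp_expansion :: "(real \<Rightarrow> real) \<Rightarrow> (nat \<Rightarrow> real \<Rightarrow> real) \<Rightarrow> bool" where
  "has_asymp_expansion f \<phi> \<longleftrightarrow> (\<forall>N. (\<lambda>x. f x - (\<Sum>k<N. \<phi> k x)) \<in> O[at_top](\<phi> N))"

text \<open>The formal sum of two series, merged as \<open>\<phi> 0, \<psi> 0, \<phi> 1, \<psi> 1, \<dots>\<close>.\<close>

definition interleave :: "(nat \<Rightarrow> 'b) \<Rightarrow> (nat \<Rightarrow> 'b) \<Rightarrow> nat \<Rightarrow> 'b" where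
  "interleave \<phi> \<psi> k = (if even k then \<phi> (k div 2) else \<psi> (k div 2))"

text \<open>The \<open>n\<close>-th term of the formal generalized hypergeometric series with argument \<open>z\<close>.\<close>

definition hypergeo_term :: "real list \<Rightarrow> real list \<Rightarrow> real \<Rightarrow> nat \<Rightarrow> real" where
  "hypergeo_term as bs z n = fps_nth (fps_hypergeo as bs 1) n * z ^ n"

end

(*
  For a Brownian path at b with running maximum s, killed at rate lam + s, the expected lifetime F(s, b)
  solves F_bb / 2 = (lam + s) F - 1 for b < s, with F_s = 0 at b = s. Solving in b leaves
  G(mu) = F at b = s, mu = lam + s, with G' = sqrt(2 mu) (G - 1/mu), a linear equation whose bounded
  solution is explicit. Hence the Laplace transform of phi(t) = E exp(- t^(3/2) A) is G. This is proved by
  discretization: F plus or minus a small barrier is a super- or subsolution for the Gaussian random walk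
  with step variance h, and the walk of n steps with n h near t samples exp(- t^(3/2) A) without any
  appeal to Brownian scaling.

  In the variable s = sqrt mu the function G is entire and grows at most linearly on Re s >= 0, so Cauchy's
  formula there gives a Stieltjes representation of G by its jump H(r) at mu = - r^2. By uniqueness of
  Laplace transforms phi(t) is the integral of 2 r exp(- r^2 t) H(r) over r > 0, and the density
  - phi'(t) is the integral of 2 r^3 exp(- r^2 t) H(r). Integrating the Taylor expansion
  of H at 0 termwise (Watson's lemma) gives the two hypergeometric series, one from the power series part
  of H and one from its sine part.
*)

theory Submission
  imports Defs "HOL-Complex_Analysis.Complex_Analysis" "HOL-Real_Asymp.Real_Asymp"
begin

section \<open>The decaying solution of a linear differential equation\<close>

text \<open>The substitution mu = z^2 turns the equation for G into y' = \<open>rate\<close> * z^2 *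
  y - \<open>rate\<close> with \<open>rate\<close> = 2 * sqrt 2. The integrating factor is the
  exponential of a cubic; this is why the functions below are built from power series in z^3 and why
  the final series run in powers of x^(-3). Two obstacles shape the proof. On the imaginary axis
  \<open>ode_sol\<close> is only bounded linearly, which does not show that the Stieltjes integral
  of the jump converges. The identities are therefore stated for differences between two points l
  and m, whose kernel decays like |s|^(-3), and the comparison of Laplace transforms carries the
  weight exp (- t) - exp (- 2 * t). Secondly, the walk is not uniformly consistent with the
  differential equation: a step of variance h that passes the running maximum has an error bounded
  only by a multiple of h, the size of the main term itself. Such steps are rare away from the
  maximum, and a barrier of size h^(1/4) that loses the expected overshoot in every step pays for
  all of them.\<close>

definition rate :: real where "rate = 2 * sqrt 2"

text \<open>\<open>connect\<close> is \<open>rate\<close> times the integral of \<open>exp (- rate / 3 * u ^ 3)\<close> over \<open>u > 0\<close>.\<close>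

definition connect :: real where "connect = 2 / 3 * 3 powr (1/3) * Gamma (1/3)"

text \<open>The coefficients are (rate/3)^j / (4/3)_j with the rising factorial in the denominator,
  so \<open>ode_series w\<close> is the confluent hypergeometric function 1F1(1; 4/3; rate * w /
  3).\<close>

fun ode_coeff :: "nat \<Rightarrow> real" where
  "ode_coeff 0 = 1"
| "ode_coeff (Suc j) = ode_coeff j * rate / (3 * real j + 4)"

definition ode_series :: "'a \<Rightarrow> 'a::{real_normed_field,banach}" where
  "ode_series w = (\<Sum>j. of_real (ode_coeff j) * w ^ j)"

text \<open>The primitive of exp (- (rate/3) * u^3) vanishing at 0. Splitting off the exponential
  (Kummer's transformation) lets it cancel in \<open>ode_sol\<close>, which leaves a plain power
  series. The generic type lets real and complex arguments share one definition.\<close>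

definition kernel_integral :: "'a \<Rightarrow> 'a::{real_normed_field,banach}" where
  "kernel_integral z = exp (- (of_real (rate / 3) * z ^ 3)) * (z * ode_series (z ^ 3))"

text \<open>\<open>ode_sol\<close> is the solution of \<open>y' = rate * z\<^sup>2 * y - rate\<close> that decays at \<open>+\<infinity>\<close>.\<close>

definition ode_sol :: "'a \<Rightarrow> 'a::{real_normed_field,banach}" where
  "ode_sol z = exp (of_real (rate / 3) * z ^ 3) * (of_real connect - of_real rate * kernel_integral z)"

lemma rate_pos: "rate > 0" and rate_sq: "rate ^ 2 = 8"
  by (auto simp: rate_def power_mult_distrib)

lemma connect_pos: "connect > 0"
  by (auto simp: connect_def intro!: mult_pos_pos Gamma_real_pos)

lemma ode_coeff_pos: "ode_coeff j > 0"
  by (induction j) (auto simp: rate_pos add_nonneg_pos)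

lemma ode_coeff_le: "ode_coeff j \<le> rate ^ j / fact j"
proof (induction j)
  case (Suc j)
  have "ode_coeff (Suc j) \<le> (rate ^ j / fact j) * rate / (3 * real j + 4)"
    unfolding ode_coeff.simps using Suc rate_pos by (intro divide_right_mono mult_right_mono) auto
  also have "\<dots> \<le> (rate ^ j / fact j) * rate / (real j + 1)"
    using rate_pos by (intro divide_left_mono) auto
  also have "\<dots> = rate ^ Suc j / fact (Suc j)"
    by (simp add: field_simps)
  finally show ?case .
qed auto

lemma summable_ode_series:
  fixes w :: "'a::{real_normed_field,banach}"
  shows "summable (\<lambda>j. of_real (ode_coeff j) * w ^ j)"
proof (rule summable_comparison_test')
  show "summable (\<lambda>j. (rate * norm w) ^ j / fact j)"
    using summable_exp[of "rate * norm w"] by (simp add: field_simps)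
  show "norm (of_real (ode_coeff j) * w ^ j) \<le> (rate * norm w) ^ j / fact j" if "j \<ge> 0" for j
    using ode_coeff_le[of j] ode_coeff_pos[of j] mult_right_mono[OF ode_coeff_le[of j], of "norm w ^ j"]
    by (simp add: norm_mult norm_power power_mult_distrib)
qed

lemma ode_series_of_real [simp]:
  "ode_series (of_real x :: 'a::{real_normed_field,banach}) = of_real (ode_series x)"
  using suminf_of_real [OF summable_ode_series[of x], where 'a='a] by (simp add: ode_series_def)

lemma kernel_integral_of_real [simp]:
  "kernel_integral (of_real x :: 'a::{real_normed_field,banach}) = of_real (kernel_integral x)"
  using ode_series_of_real[of "x ^ 3", where 'a='a]
  by (simp add: kernel_integral_def del: ode_series_of_real flip: exp_of_real)

lemma ode_sol_of_real [simp]: "ode_sol (of_real x :: 'a::{real_normed_field,banach}) = of_real (ode_sol x)"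
  by (simp add: ode_sol_def flip: exp_of_real)

text \<open>The recursion of \<open>ode_coeff\<close> as a differential equation. It is exactly what
  makes the derivative of the product in \<open>kernel_integral\<close> collapse to a pure
  exponential.\<close>

lemma ode_series_deriv:
  fixes w :: "'a::{real_normed_field,banach}"
  obtains d where "(ode_series has_field_derivative d) (at w)"
    "ode_series w + 3 * w * d = 1 + of_real rate * w * ode_series w"
proof -
  define c :: "nat \<Rightarrow> 'a" where "c = (\<lambda>j. of_real (ode_coeff j))"
  have sm: "\<And>w::'a. summable (\<lambda>j. c j * w ^ j)"
    unfolding c_def by (rule summable_ode_series)
  define d where "d = (\<Sum>n. diffs c n * w ^ n)"
  have 1: "(ode_series has_field_derivative d) (at w)"
    using termdiffs_strong_converges_everywhere[OF sm]
    unfolding d_def ode_series_def c_def by (simp add: fun_eq_iff)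
  have smd: "summable (\<lambda>n. diffs c n * w ^ n)"
    using termdiff_converges_all[OF sm] by simp
  have "(\<lambda>n. diffs c n * w ^ n) sums d"
    using smd by (simp add: d_def summable_sums)
  then have s1: "(\<lambda>n. 3 * w * (diffs c n * w ^ n)) sums (3 * w * d)"
    by (rule sums_mult)
  have s2: "(\<lambda>n. c n * w ^ n) sums ode_series w"
    using sm by (simp add: summable_sums ode_series_def c_def)
  have s3: "(\<lambda>n. c (Suc n) * w ^ (Suc n)) sums (ode_series w - 1)"
    using sums_Suc_iff[of "\<lambda>n. c n * w ^ n" "ode_series w - 1"] s2 by (simp add: c_def)
  have "(\<lambda>n. c (Suc n) * w ^ Suc n + 3 * w * (diffs c n * w ^ n)) sums (ode_series w - 1 + 3 * w * d)"
    using s3 s1 by (rule sums_add)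
  also have "(\<lambda>n. c (Suc n) * w ^ Suc n + 3 * w * (diffs c n * w ^ n)) = (\<lambda>n. of_real rate * w * (c n * w ^ n))"
  proof
    fix n
    have "c (Suc n) * (3 * of_nat n + 4) = c n * of_real rate"
    proof -
      have "ode_coeff (Suc n) * (3 * real n + 4) = ode_coeff n * rate"
        by (simp add: add_nonneg_eq_0_iff)
      then have "of_real (ode_coeff (Suc n) * (3 * real n + 4)) = (of_real (ode_coeff n * rate) :: 'a)"
        by (rule arg_cong)
      then show ?thesis by (simp add: c_def del: ode_coeff.simps)
    qed
    moreover have "c (Suc n) * w ^ Suc n + 3 * w * (diffs c n * w ^ n)
        = c (Suc n) * (3 * of_nat n + 4) * w ^ Suc n"
      by (simp add: diffs_def algebra_simps)
    ultimately show "c (Suc n) * w ^ Suc n + 3 * w * (diffs c n * w ^ n) = of_real rate * w * (c n * w ^ n)"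
      by (simp add: algebra_simps)
  qed
  finally have "(\<lambda>n. of_real rate * w * (c n * w ^ n)) sums (ode_series w - 1 + 3 * w * d)" .
  moreover have "(\<lambda>n. of_real rate * w * (c n * w ^ n)) sums (of_real rate * w * ode_series w)"
    using s2 by (rule sums_mult)
  ultimately have "ode_series w - 1 + 3 * w * d = of_real rate * w * ode_series w"
    by (rule sums_unique2)
  then have "ode_series w + 3 * w * d = 1 + of_real rate * w * ode_series w"
    by (simp add: algebra_simps)
  with 1 show ?thesis using that by blast
qed

lemma has_field_derivative_kernel_integral:
  fixes z :: "'a::{real_normed_field,banach}"
  shows "(kernel_integral has_field_derivative exp (- (of_real (rate / 3) * z ^ 3))) (at z)"
proof -
  obtain d where d: "(ode_series has_field_derivative d) (at (z ^ 3))"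
    and eq: "ode_series (z ^ 3) + 3 * z ^ 3 * d = 1 + of_real rate * z ^ 3 * ode_series (z ^ 3)"
    by (rule ode_series_deriv)
  have d': "((\<lambda>z. ode_series (z ^ 3)) has_field_derivative d * (3 * z ^ 2)) (at z)"
    by (rule DERIV_chain2[where g = "\<lambda>z. z ^ 3", OF d]) (auto intro!: derivative_eq_intros)
  have "(kernel_integral has_field_derivative
      exp (- (of_real (rate / 3) * z ^ 3)) * (- (of_real (rate / 3) * (3 * z ^ 2))) * (z * ode_series (z ^ 3))
      + exp (- (of_real (rate / 3) * z ^ 3)) * (ode_series (z ^ 3) + z * (d * (3 * z ^ 2)))) (at z)"
    unfolding kernel_integral_def [abs_def]
    by (rule derivative_eq_intros d' refl | simp add: field_simps)+
  moreover have "exp (- (of_real (rate / 3) * z ^ 3)) * (- (of_real (rate / 3) * (3 * z ^ 2))) * (z * ode_series (z ^ 3))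
      + exp (- (of_real (rate / 3) * z ^ 3)) * (ode_series (z ^ 3) + z * (d * (3 * z ^ 2)))
    = exp (- (of_real (rate / 3) * z ^ 3)) * (ode_series (z ^ 3) + 3 * z ^ 3 * d - of_real rate * z ^ 3 * ode_series (z ^ 3))"
    by (simp add: algebra_simps power2_eq_square power3_eq_cube)
  ultimately show ?thesis
    using eq by simp
qed

lemma has_field_derivative_ode_sol:
  fixes z :: "'a::{real_normed_field,banach}"
  shows "(ode_sol has_field_derivative (of_real rate * z ^ 2 * ode_sol z - of_real rate)) (at z)"
proof -
  have "exp (of_real (rate / 3) * z ^ 3) * exp (- (of_real (rate / 3) * z ^ 3)) = (1::'a)"
    by (simp flip: exp_add)
  note e = this
  have "(ode_sol has_field_derivative
      exp (of_real (rate / 3) * z ^ 3) * (of_real (rate / 3) * (3 * z ^ 2)) * (of_real connect - of_real rate * kernel_integral z)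
      + exp (of_real (rate / 3) * z ^ 3) * (- (of_real rate * exp (- (of_real (rate / 3) * z ^ 3))))) (at z)"
    unfolding ode_sol_def [abs_def]
    by (rule derivative_eq_intros has_field_derivative_kernel_integral refl | simp add: field_simps)+
  moreover have "exp (of_real (rate / 3) * z ^ 3) * (of_real (rate / 3) * (3 * z ^ 2)) * (of_real connect - of_real rate * kernel_integral z)
      + exp (of_real (rate / 3) * z ^ 3) * (- (of_real rate * exp (- (of_real (rate / 3) * z ^ 3))))
      = of_real rate * z ^ 2 * ode_sol z - of_real rate * (exp (of_real (rate / 3) * z ^ 3) * exp (- (of_real (rate / 3) * z ^ 3)))"
    by (simp add: ode_sol_def algebra_simps)
  ultimately show ?thesis
    unfolding e by simp
qed

section \<open>Limits at infinity and growth in the right half-plane\<close>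

lemma continuous_on_kernel_integral:
  "continuous_on S (kernel_integral :: 'a \<Rightarrow> 'a::{real_normed_field,banach})"
  using has_field_derivative_kernel_integral
  by (intro continuous_at_imp_continuous_on ballI) (blast intro: DERIV_isCont)

text \<open>The substitution t = (rate/3) * x^3 leads to the Gamma integral at 1/3. It is carried
  out by comparing derivatives of the two primitives.\<close>

lemma kernel_integral_tendsto: "(kernel_integral \<longlongrightarrow> connect / rate) at_top"
proof -
  define f where "f = (\<lambda>t::real. t powr (1/3 - 1) / exp t)"
  define c where "c = rate / 3"
  have c: "c > 0" using rate_pos by (simp add: c_def)
  have hi: "(f has_integral Gamma (1/3)) {0..}"
    unfolding f_def by (rule Gamma_integral_real) simp
  have int: "f integrable_on {0..b}" for b
    using integrable_on_subinterval[OF has_integral_integrable[OF hi], of 0 b] by auto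
  have abs: "f absolutely_integrable_on {0..}"
    using has_integral_integrable[OF hi] by (rule nonnegative_absolutely_integrable_1) (auto simp: f_def)
  have "((\<lambda>b. set_lebesgue_integral lebesgue {0..b} f) \<longlongrightarrow> set_lebesgue_integral lebesgue {0..} f) at_top"
    by (rule tendsto_set_lebesgue_integral_at_top) (use abs in auto)
  also have "(\<lambda>b. set_lebesgue_integral lebesgue {0..b} f) = (\<lambda>b. integral {0..b} f)"
    by (intro ext set_lebesgue_integral_eq_integral(2) set_integrable_subset[OF abs]) auto
  also have "set_lebesgue_integral lebesgue {0..} f = Gamma (1/3)"
    using set_lebesgue_integral_eq_integral(2)[OF abs] hi by (simp add: integral_unique)
  finally have lim: "((\<lambda>b. integral {0..b} f) \<longlongrightarrow> Gamma (1/3)) at_top" .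
  \<comment> \<open>The Gamma integrand is singular at 0, so differentiation is restricted to t > 0;
    at 0 only continuity of the indefinite integral is used.\<close>
  have ftc: "((\<lambda>u. integral {0..u} f) has_real_derivative f t) (at t)" if "t > 0" for t
  proof -
    have "isCont f t"
      using that by (auto simp: f_def intro!: isCont_divide continuous_at_within_powr)
    then have "continuous (at t within {0..t+1} - {}) f"
      by (rule continuous_at_imp_continuous_at_within)
    from integral_has_vector_derivative_continuous_at[OF int _ finite.emptyI this]
    have "((\<lambda>u. integral {0..u} f) has_vector_derivative f t) (at t within {0..t+1} - {})"
      using that by simp
    then show ?thesis
      using that by (simp add: at_within_Icc_at has_real_derivative_iff_has_vector_derivative)
  qed
  define h where "h = (\<lambda>x. integral {0..c * x ^ 3} f - 3 * c powr (1/3) * kernel_integral x)"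
  have h0: "h x = 0" if x: "x > 0" for x
  proof -
    have "h x = h 0"
    proof (rule DERIV_isconst2[of 0 x])
      show "continuous_on {0..x} h"
      proof -
        have "continuous_on {0..c * x ^ 3} (\<lambda>u. integral {0..u} f)"
          by (rule indefinite_integral_continuous_1[OF int])
        then have "continuous_on {0..x} (\<lambda>x. integral {0..c * x ^ 3} f)"
          by (rule continuous_on_compose2)
            (use c in \<open>auto intro!: continuous_intros mult_left_mono power_mono\<close>)
        then show ?thesis
          unfolding h_def by (intro continuous_intros continuous_on_kernel_integral)
      qed
      show "DERIV h y :> 0" if y: "0 < y" "y < x" for y
      proof -
        have 1: "((\<lambda>x. integral {0..c * x ^ 3} f) has_real_derivative f (c * y ^ 3) * (3 * c * y ^ 2)) (at y)"
          by (rule DERIV_chain2[where g = "\<lambda>x. c * x ^ 3", OF ftc])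
            (use c y in \<open>auto intro!: derivative_eq_intros\<close>)
        have "(c * y ^ 3) powr (-2/3) = c powr (-2/3) * y powr (-2)"
          using c y by (simp add: powr_mult powr_powr flip: powr_numeral)
        then have "f (c * y ^ 3) * (3 * c * y ^ 2) = 3 * (c powr (-2/3) * c) * (y powr (-2) * y ^ 2) * exp (- (c * y ^ 3))"
          using c y by (simp add: f_def exp_minus field_simps)
        also have "c powr (-2/3) * c = c powr (1/3)"
          using c powr_add[of c "-2/3" 1] by simp
        also have "y powr (-2) * y ^ 2 = 1"
          using y by (simp add: powr_minus)
        finally have eq: "f (c * y ^ 3) * (3 * c * y ^ 2) = 3 * c powr (1/3) * exp (- (c * y ^ 3))" by simp
        have 2: "(kernel_integral has_real_derivative exp (- (c * y ^ 3))) (at y)"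
          using has_field_derivative_kernel_integral[of y] by (simp add: c_def)
        show ?thesis
          unfolding h_def by (rule derivative_eq_intros 1 2 refl)+ (simp add: eq)
      qed
    qed (use x in auto)
    also have "h 0 = 0"
      by (simp add: h_def kernel_integral_def)
    finally show ?thesis .
  qed
  have "filterlim (\<lambda>x::real. c * x ^ 3) at_top at_top"
    using c by real_asymp
  from filterlim_compose[OF lim this]
  have "((\<lambda>x. integral {0..c * x ^ 3} f / (3 * c powr (1/3))) \<longlongrightarrow> Gamma (1/3) / (3 * c powr (1/3))) at_top"
    by (rule tendsto_divide) (use c in auto)
  moreover have "eventually (\<lambda>x. integral {0..c * x ^ 3} f / (3 * c powr (1/3)) = kernel_integral x) at_top"
    using eventually_gt_at_top[of 0]
  proof eventually_elim
    case (elim x)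
    with h0[of x] c show ?case by (simp add: h_def field_simps)
  qed
  ultimately have "(kernel_integral \<longlongrightarrow> Gamma (1/3) / (3 * c powr (1/3))) at_top"
    by (rule Lim_transform_eventually)
  also have "Gamma (1/3) / (3 * c powr (1/3)) = connect / rate"
  proof -
    \<comment> \<open>The point is rate^(2/3) = (rate^2)^(1/3) = 8^(1/3) = 2, which produces the
      factor 2 in \<open>connect\<close>.\<close>
    have "rate = rate powr (1/3) * rate powr (2/3)"
      using rate_pos by (simp flip: powr_add)
    also have "rate powr (2/3) = (rate ^ 2) powr (1/3)"
      using rate_pos by (simp add: powr_powr flip: powr_numeral)
    also have "\<dots> = (2 powr 3) powr (1/3)"
      by (simp add: rate_sq)
    also have "\<dots> = 2"
      unfolding powr_powr by simp
    finally have r: "rate = 2 * rate powr (1/3)" by simp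
    have "connect * (3 * c powr (1/3)) = 2 * rate powr (1/3) * Gamma (1/3)"
      using rate_pos by (simp add: c_def connect_def powr_divide)
    with r have "connect * (3 * c powr (1/3)) = rate * Gamma (1/3)" by simp
    then show ?thesis
      using rate_pos c by (simp add: field_simps)
  qed
  finally show ?thesis .
qed

lemma kernel_integral_mono:
  assumes "x \<le> y" shows "kernel_integral x \<le> (kernel_integral y :: real)"
  using assms has_field_derivative_kernel_integral[where 'a=real]
  by (intro DERIV_nonneg_imp_nondecreasing[of x y kernel_integral]) (auto, fastforce)

lemma kernel_integral_0 [simp]: "kernel_integral 0 = 0"
  by (simp add: kernel_integral_def)

lemma kernel_integral_le: "rate * kernel_integral x \<le> (connect::real)"
proof -
  have "eventually (\<lambda>y. kernel_integral x \<le> (kernel_integral y :: real)) at_top"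
    using eventually_ge_at_top[of x] by eventually_elim (rule kernel_integral_mono)
  from tendsto_lowerbound[OF kernel_integral_tendsto this]
  have "kernel_integral x \<le> connect / rate" by simp
  then show ?thesis using rate_pos by (simp add: field_simps)
qed

text \<open>The vertical segment from the real axis contributes a vanishing amount, since the
  integrand is exponentially small on it.\<close>

lemma kernel_integral_tendsto_horizontal:
  "((\<lambda>v. kernel_integral (Complex v y)) \<longlongrightarrow> of_real (connect / rate)) at_top"
proof -
  define c where "c = rate / 3"
  have c: "c > 0" using rate_pos by (simp add: c_def)
  \<comment> \<open>The threshold ensures v^2 >= v >= 1 + 3 * y^2, hence Re (z^3) >= v on the whole
    segment.\<close>
  have bound: "norm (kernel_integral (Complex v y) - of_real (kernel_integral v)) \<le> exp (- (c * v)) * \<bar>y\<bar>"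
    if v: "v \<ge> 1 + 3 * y\<^sup>2" for v
  proof -
    have "norm (kernel_integral (Complex v y) - kernel_integral (of_real v)) \<le> exp (- (c * v)) * norm (Complex v y - of_real v)"
    proof (rule field_differentiable_bound[where S = "closed_segment (of_real v) (Complex v y)"])
      fix z assume "z \<in> closed_segment (of_real v) (Complex v y)"
      then obtain u where u: "0 \<le> u" "u \<le> 1" "z = (1 - u) *\<^sub>R of_real v + u *\<^sub>R Complex v y"
        by (auto simp: in_segment)
      have z: "z = Complex v (u * y)"
        using u by (simp add: complex_eq_iff algebra_simps)
      have "Re (z ^ 3) = v ^ 3 - 3 * v * (u * y)\<^sup>2"
        by (simp add: z power3_eq_cube power2_eq_square algebra_simps)
      moreover have "(u * y)\<^sup>2 \<le> y\<^sup>2"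
        using u by (simp add: power_mult_distrib mult_left_le_one_le power_le_one)
      moreover have "v \<ge> 1" using v zero_le_power2[of y] by linarith
      moreover have "v ^ 3 - 3 * v * y\<^sup>2 - v = v * (v\<^sup>2 - 3 * y\<^sup>2 - 1)"
        by (simp add: power3_eq_cube power2_eq_square algebra_simps)
      moreover have "v\<^sup>2 \<ge> v" using \<open>v \<ge> 1\<close> by (simp add: power2_eq_square)
      moreover have "v * (v\<^sup>2 - 3 * y\<^sup>2 - 1) \<ge> 0"
        using v \<open>v \<ge> 1\<close> \<open>v\<^sup>2 \<ge> v\<close> by (intro mult_nonneg_nonneg) linarith+
      moreover have "3 * v * (u * y)\<^sup>2 \<le> 3 * v * y\<^sup>2"
        using \<open>v \<ge> 1\<close> \<open>(u * y)\<^sup>2 \<le> y\<^sup>2\<close> by (intro mult_left_mono) auto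
      ultimately have "Re (z ^ 3) \<ge> v"
        by linarith
      then show "norm (exp (- (of_real (rate / 3) * z ^ 3))) \<le> exp (- (c * v))"
        unfolding c_def[symmetric] norm_exp_eq_Re using c by (simp add: mult_left_mono)
    next
      show "(kernel_integral has_field_derivative exp (- (of_real (rate / 3) * z ^ 3)))
          (at z within closed_segment (of_real v) (Complex v y))" for z
        using has_field_derivative_kernel_integral by (rule has_field_derivative_at_within)
    qed auto
    also have "Complex v y - of_real v = \<i> * of_real y"
      by (simp add: complex_eq_iff)
    finally show ?thesis
      by (simp add: norm_mult)
  qed
  have "((\<lambda>v. kernel_integral (Complex v y) - of_real (kernel_integral v)) \<longlongrightarrow> 0) at_top"
  proof (rule Lim_null_comparison)
    show "eventually (\<lambda>v. norm (kernel_integral (Complex v y) - of_real (kernel_integral v)) \<le> exp (- (c * v)) * \<bar>y\<bar>) at_top"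
      using eventually_ge_at_top[of "1 + 3 * y\<^sup>2"] by eventually_elim (rule bound)
    show "((\<lambda>v. exp (- (c * v)) * \<bar>y\<bar>) \<longlongrightarrow> 0) at_top"
      using c by real_asymp
  qed
  from tendsto_add[OF this tendsto_of_real[OF kernel_integral_tendsto]]
  show ?thesis by simp
qed

text \<open>
  If \<open>Re (s ^ 3) \<le> 0\<close>, the solution is estimated along the segment from 0 to \<open>s\<close>; otherwise along the
  horizontal ray from \<open>s\<close>, where it decays.
\<close>

lemma norm_ode_sol_le:
  fixes s :: complex
  assumes "Re s \<ge> 0"
  shows "norm (ode_sol s) \<le> connect + rate * norm s"
proof -
  define c where "c = rate / 3"
  have c: "c > 0" using rate_pos by (simp add: c_def)
  show ?thesis
  proof (cases "Re (s ^ 3) \<le> 0")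
    case True
    have e: "norm (exp (of_real c * s ^ 3)) \<le> 1"
      using True c by (simp add: norm_exp_eq_Re mult_nonneg_nonpos)
    have "norm (exp (of_real c * s ^ 3) * kernel_integral s - exp (of_real c * s ^ 3) * kernel_integral 0) \<le> 1 * norm (s - 0)"
    proof (rule field_differentiable_bound[where S = "closed_segment 0 s"])
      fix z assume "z \<in> closed_segment 0 s"
      then obtain u where u: "0 \<le> u" "u \<le> 1" "z = of_real u * s"
        by (auto simp: in_segment scaleR_conv_of_real)
      have "Re (z ^ 3) = u ^ 3 * Re (s ^ 3)"
        by (simp add: u(3) power_mult_distrib flip: of_real_power)
      moreover have "u ^ 3 * Re (s ^ 3) \<ge> Re (s ^ 3)"
        using mult_right_mono_neg[OF power_le_one[of u 3] True] u by simp
      ultimately have "Re (s ^ 3) \<le> Re (z ^ 3)" by simp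
      then show "norm (exp (of_real c * s ^ 3) * exp (- (of_real c * z ^ 3))) \<le> 1"
        unfolding exp_add[symmetric] norm_exp_eq_Re using c by (simp add: mult_left_mono)
    next
      show "((\<lambda>z. exp (of_real c * s ^ 3) * kernel_integral z) has_field_derivative
          exp (of_real c * s ^ 3) * exp (- (of_real c * z ^ 3))) (at z within closed_segment 0 s)" for z
        using DERIV_cmult[OF has_field_derivative_kernel_integral[of z], of "exp (of_real c * s ^ 3)"]
        by (simp add: c_def has_field_derivative_at_within)
    qed auto
    then have k: "norm (exp (of_real c * s ^ 3) * kernel_integral s) \<le> norm s"
      by simp
    have "ode_sol s = of_real connect * exp (of_real c * s ^ 3) - of_real rate * (exp (of_real c * s ^ 3) * kernel_integral s)"
      by (simp add: ode_sol_def c_def algebra_simps)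
    also have "norm \<dots> \<le> norm (of_real connect * exp (of_real c * s ^ 3)) + norm (of_real rate * (exp (of_real c * s ^ 3) * kernel_integral s))"
      by (rule norm_triangle_ineq4)
    also have "\<dots> \<le> connect * 1 + rate * norm s"
      unfolding norm_mult[of "of_real connect"] norm_mult[of "of_real rate"]
      using e k connect_pos rate_pos by (intro add_mono mult_mono) auto
    finally show ?thesis by simp
  next
    case False
    define a b where "a = Re s" and "b = Im s"
    have s: "s = Complex a b" by (simp add: a_def b_def)
    have a: "a \<ge> 0" using assms by (simp add: a_def)
    have "Re (s ^ 3) = a * (a\<^sup>2 - 3 * b\<^sup>2)"
      by (simp add: s power3_eq_cube power2_eq_square algebra_simps)
    with False a have "a\<^sup>2 - 3 * b\<^sup>2 > 0"
      using mult_nonneg_nonpos[of a "a\<^sup>2 - 3 * b\<^sup>2"] by fastforce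
    then have ab: "a\<^sup>2 - b\<^sup>2 \<ge> 0" using zero_le_power2[of b] by linarith
    \<comment> \<open>Positivity of Re (s^3) confines s to the sector |arg s| < pi/6, where moving
      right by v raises the real part of the cube by at least v^3.\<close>
    have mono: "Re (s ^ 3 - (s + of_real v) ^ 3) \<le> - (v ^ 3)" if v: "v \<ge> 0" for v
    proof -
      have "Re (s ^ 3 - (s + of_real v) ^ 3) = - (v ^ 3) - 3 * v * (a\<^sup>2 - b\<^sup>2) - 3 * v\<^sup>2 * a"
        by (simp add: s power3_eq_cube power2_eq_square algebra_simps)
      moreover have "3 * v * (a\<^sup>2 - b\<^sup>2) \<ge> 0" and "3 * v\<^sup>2 * a \<ge> 0"
        using v ab a by (auto intro!: mult_nonneg_nonneg simp del: diff_ge_0_iff_ge)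
      ultimately show ?thesis by linarith
    qed
    \<comment> \<open>The exponential stays frozen at s while the kernel integral moves along the
      ray. The variation of \<open>f\<close> is then dominated by that of
      \<open>rate * kernel_integral\<close> on the real axis, which is at most
      \<open>connect\<close>.\<close>
    define f where "f = (\<lambda>v. exp (of_real c * s ^ 3) * (of_real connect - of_real rate * kernel_integral (s + of_real v)))"
    have f0: "f 0 = ode_sol s" by (simp add: f_def ode_sol_def c_def)
    have bd: "norm (ode_sol s) \<le> norm (f V) + connect" if V: "V > 0" for V
    proof -
      have "norm (f V - f 0) \<le> rate * kernel_integral V - rate * kernel_integral 0"
      proof (rule differentiable_bound_general[OF V])
        have "continuous_on {0..V} (\<lambda>x. kernel_integral (s + of_real x))"
          by (rule continuous_on_compose2[OF continuous_on_kernel_integral[of UNIV]]) (auto intro!: continuous_intros)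
        then show "continuous_on {0..V} f"
          unfolding f_def by (intro continuous_intros)
        show "continuous_on {0..V} (\<lambda>x. rate * kernel_integral x)"
          by (intro continuous_intros continuous_on_kernel_integral)
        fix x assume x: "0 < x" "x < V"
        have "((\<lambda>x. s + complex_of_real x) has_vector_derivative 1) (at x)"
          by (auto intro!: derivative_eq_intros)
        then have "(kernel_integral \<circ> (\<lambda>x. s + of_real x) has_vector_derivative 
            1 * exp (- (of_real (rate / 3) * (s + of_real x) ^ 3))) (at x)"
          by (rule field_vector_diff_chain_at) (rule has_field_derivative_kernel_integral)
        then have d: "((\<lambda>x. kernel_integral (s + of_real x)) has_vector_derivative exp (- (of_real c * (s + of_real x) ^ 3))) (at x)"
          by (simp add: o_def c_def)
        show "(f has_vector_derivative exp (of_real c * s ^ 3) * (- (of_real rate * exp (- (of_real c * (s + of_real x) ^ 3))))) (at x)"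
          unfolding f_def
          by (rule derivative_eq_intros d refl | simp)+
        show "((\<lambda>x. rate * kernel_integral x) has_vector_derivative rate * exp (- (c * x ^ 3))) (at x)"
          using DERIV_cmult[OF has_field_derivative_kernel_integral[of x], of rate]
          by (simp add: c_def has_real_derivative_iff_has_vector_derivative)
        have "norm (exp (of_real c * s ^ 3) * exp (- (of_real c * (s + of_real x) ^ 3))) 
            = exp (c * Re (s ^ 3 - (s + of_real x) ^ 3))"
          unfolding exp_add[symmetric] norm_exp_eq_Re by (simp add: algebra_simps)
        also have "\<dots> \<le> exp (- (c * x ^ 3))"
          using c mult_left_mono[OF mono[of x], of c] x by simp
        finally show "norm (exp (of_real c * s ^ 3) * (- (of_real rate * exp (- (of_real c * (s + of_real x) ^ 3))))) \<le> rate * exp (- (c * x ^ 3))"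
          using rate_pos by (simp add: norm_mult)
      qed
      then have "norm (f V - f 0) \<le> connect"
        using kernel_integral_le[of V] by simp
      then show ?thesis
        using norm_triangle_sub[of "f 0" "f V"] by (simp add: f0 norm_minus_commute)
    qed
    have "((\<lambda>v. kernel_integral (Complex (v + a) b)) \<longlongrightarrow> of_real (connect / rate)) at_top"
      by (rule filterlim_compose[OF kernel_integral_tendsto_horizontal]) real_asymp
    moreover have "Complex (v + a) b = s + of_real v" for v
      by (simp add: s complex_eq_iff)
    ultimately have "((\<lambda>v. kernel_integral (s + of_real v)) \<longlongrightarrow> of_real (connect / rate)) at_top"
      by simp
    then have "((\<lambda>v. norm (f v) + connect) \<longlongrightarrow> 
        norm (exp (of_real c * s ^ 3) * (of_real connect - of_real rate * of_real (connect / rate))) + connect) at_top"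
      unfolding f_def by (intro tendsto_intros)
    then have "((\<lambda>v. norm (f v) + connect) \<longlongrightarrow> connect) at_top"
      using rate_pos by simp
    then have "norm (ode_sol s) \<le> connect"
      by (rule tendsto_lowerbound) (auto intro!: eventually_mono[OF eventually_gt_at_top[of 0] bd])
    then show ?thesis using rate_pos by (simp add: add_increasing2)
  qed
qed

section \<open>Two-sided bounds on the positive real axis\<close>

lemma exp_mult_ode_sol: "exp (- (rate / 3 * x ^ 3)) * ode_sol x = connect - rate * kernel_integral (x::real)"
  by (simp add: ode_sol_def flip: mult.assoc exp_add)

lemma DERIV_kernel_integral_real [derivative_intros]:
  assumes "(g has_field_derivative g') (at x within S)"
  shows "((\<lambda>x. kernel_integral (g x :: real)) has_field_derivative exp (- (rate / 3 * g x ^ 3)) * g') (at x within S)"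
  using DERIV_chain2[OF has_field_derivative_kernel_integral[of "g x"] assms] by simp

text \<open>Multiplied by exp (- c * x^3), the difference of the two sides is monotone and tends to
  0 at infinity. The bound is what makes \<open>laplace_defect\<close> nonnegative.\<close>

lemma ode_sol_le:
  assumes x: "x > (0::real)"
  shows "ode_sol x \<le> 1 / x ^ 2"
proof -
  define c where "c = rate / 3"
  have c: "c > 0" "rate = 3 * c" using rate_pos by (simp_all add: c_def)
  define L where "L = (\<lambda>x::real. connect - rate * kernel_integral x - exp (- (c * x ^ 3)) / x ^ 2)"
  have mono: "L x \<le> L y" if "x \<le> y" for y
  proof (rule DERIV_nonneg_imp_nondecreasing[OF that])
    fix u assume u: "x \<le> u" "u \<le> y"
    have "(L has_real_derivative 2 * exp (- (c * u ^ 3)) / u ^ 3) (at u)"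
      unfolding L_def using u x
      by (auto intro!: derivative_eq_intros simp: c_def field_simps power2_eq_square power3_eq_cube)
    then show "\<exists>D. (L has_real_derivative D) (at u) \<and> 0 \<le> D"
      using u x by (intro exI[of _ "2 * exp (- (c * u ^ 3)) / u ^ 3"]) auto
  qed
  have "((\<lambda>x::real. exp (- (c * x ^ 3)) / x ^ 2) \<longlongrightarrow> 0) at_top"
    using c(1) by real_asymp
  then have "(L \<longlongrightarrow> connect - rate * (connect / rate) - 0) at_top"
    unfolding L_def by (intro tendsto_diff tendsto_mult tendsto_const kernel_integral_tendsto)
  then have "(L \<longlongrightarrow> 0) at_top" using rate_pos by simp
  then have "L x \<le> 0"
    by (rule tendsto_lowerbound) (auto intro!: eventually_mono[OF eventually_ge_at_top[of x]] mono)
  then have "exp (- (c * x ^ 3)) * ode_sol x \<le> exp (- (c * x ^ 3)) * (1 / x ^ 2)"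
    using exp_mult_ode_sol[of x] by (simp add: L_def c_def)
  then show ?thesis
    using exp_gt_zero[of "- (c * x ^ 3)"] by (simp only: mult_le_cancel_left_pos)
qed

text \<open>The subtracted term is the second one of the expansion of the solution at infinity,
  found by inserting inverse powers into the equation. The comparison is as in
  \<open>ode_sol_le\<close>, with the opposite monotonicity.\<close>

lemma ode_sol_ge:
  assumes x: "x > (0::real)"
  shows "ode_sol x \<ge> 1 / x ^ 2 - 2 / rate / x ^ 5"
proof -
  define c where "c = rate / 3"
  have c: "c > 0" "rate = 3 * c" using rate_pos by (simp_all add: c_def)
  define L where "L = (\<lambda>x::real. connect - rate * kernel_integral x - exp (- (c * x ^ 3)) * (1 / x ^ 2 - 2 / rate / x ^ 5))"
  have mono: "L y \<le> L x" if "x \<le> y" for y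
  proof (rule DERIV_nonpos_imp_nonincreasing[OF that])
    fix u assume u: "x \<le> u" "u \<le> y"
    have "((\<lambda>x. 1 / x ^ 2 - 2 / rate / x ^ 5) has_real_derivative - 2 / u ^ 3 + 10 / rate / u ^ 6) (at u)"
      using u x rate_pos
      by (auto intro!: derivative_eq_intros) (simp add: divide_simps eval_nat_numeral)
    then have "(L has_real_derivative - (10 / rate * exp (- (c * u ^ 3)) / u ^ 6)) (at u)"
      unfolding L_def using u x rate_pos
      by (auto intro!: derivative_eq_intros simp: c_def) (simp add: field_simps eval_nat_numeral)
    then show "\<exists>D. (L has_real_derivative D) (at u) \<and> D \<le> 0"
      using u x c by (intro exI[of _ "- (10 / rate * exp (- (c * u ^ 3)) / u ^ 6)"]) auto
  qed
  have "((\<lambda>x::real. exp (- (c * x ^ 3)) * (1 / x ^ 2 - 2 / rate / x ^ 5)) \<longlongrightarrow> 0) at_top"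
    using c(1) rate_pos by real_asymp
  then have "(L \<longlongrightarrow> connect - rate * (connect / rate) - 0) at_top"
    unfolding L_def by (intro tendsto_diff tendsto_mult tendsto_const kernel_integral_tendsto)
  then have "(L \<longlongrightarrow> 0) at_top" using rate_pos by simp
  then have "L x \<ge> 0"
    by (rule tendsto_upperbound) (auto intro!: eventually_mono[OF eventually_ge_at_top[of x]] mono)
  then have "exp (- (c * x ^ 3)) * (1 / x ^ 2 - 2 / rate / x ^ 5) \<le> exp (- (c * x ^ 3)) * ode_sol x"
    using exp_mult_ode_sol[of x] by (simp add: L_def c_def)
  then show ?thesis
    using exp_gt_zero[of "- (c * x ^ 3)"] by (simp only: mult_le_cancel_left_pos)
qed

lemma ode_sol_nonneg: "ode_sol (x::real) \<ge> 0"
  using kernel_integral_le[of x] by (auto simp: ode_sol_def intro!: mult_nonneg_nonneg)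

section \<open>The jump function and its power series\<close>

text \<open>\<open>spectral r\<close> is the jump of \<open>\<mu> \<mapsto> ode_sol (sqrt \<mu>)\<close> across the cut at \<open>\<mu> = - r\<^sup>2\<close>, up to a constant.\<close>

definition spectral :: "real \<Rightarrow> real" where
  "spectral r = - Im (ode_sol (\<i> * of_real r)) / pi"

text \<open>The exponents are 1, 3, 7, 9, 13, ...: even indices belong to r times the real part of
  \<open>ode_series\<close> at - i * r^3, odd ones to the sine of (rate/3) * r^3. Interleaving puts
  them in increasing order, so each term leads the remainder that starts with it.\<close>

definition spectral_exponent :: "nat \<Rightarrow> nat" where
  "spectral_exponent k = 3 * k + (if even k then 1 else 0)"

definition spectral_coeff :: "nat \<Rightarrow> real" where
  "spectral_coeff k = (-1) ^ (k div 2) / pi *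
     (if even k then rate * ode_coeff k else connect * (rate / 3) ^ k / fact k)"

text \<open>The k-th terms of both parts carry (-i)^k, and the second part an additional factor i.
  Hence taking imaginary parts keeps exactly one of them, the exponential for odd k and the kernel
  part for even k.\<close>

lemma spectral_sums: "(\<lambda>k. spectral_coeff k * r ^ spectral_exponent k) sums spectral r"
proof -
  define c where "c = rate / 3"
  define z where "z = \<i> * complex_of_real r"
  have z3: "z ^ 3 = - \<i> * of_real (r ^ 3)"
  proof -
    have "\<i> ^ 3 = - \<i>" by (simp add: power3_eq_cube)
    then show ?thesis by (simp add: z_def power_mult_distrib)
  qed
  have "(\<lambda>k. of_real connect * ((of_real c * z ^ 3) ^ k /\<^sub>R fact k) - of_real rate * (z * (of_real (ode_coeff k) * (z ^ 3) ^ k)))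
     sums (of_real connect * exp (of_real c * z ^ 3) - of_real rate * (z * ode_series (z ^ 3)))"
    unfolding ode_series_def
    by (intro sums_diff sums_mult exp_converges summable_sums summable_ode_series)
  also have "of_real connect * exp (of_real c * z ^ 3) - of_real rate * (z * ode_series (z ^ 3)) = ode_sol z"
    by (simp add: ode_sol_def kernel_integral_def c_def algebra_simps flip: mult.assoc exp_add)
  finally have "(\<lambda>k. - Im (of_real connect * ((of_real c * z ^ 3) ^ k /\<^sub>R fact k) - of_real rate * (z * (of_real (ode_coeff k) * (z ^ 3) ^ k))) / pi)
     sums (- Im (ode_sol z) / pi)"
    by (intro sums_divide sums_minus sums_Im)
  moreover have "- Im (of_real connect * ((of_real c * z ^ 3) ^ k /\<^sub>R fact k) - of_real rate * (z * (of_real (ode_coeff k) * (z ^ 3) ^ k))) / pi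
      = spectral_coeff k * r ^ spectral_exponent k" for k
  proof -
    have p: "(z ^ 3) ^ k = (- \<i>) ^ k * of_real (r ^ (3 * k))" 
      unfolding z3 power_mult_distrib by (simp add: power_mult)
    have p': "(of_real c * z ^ 3) ^ k = (- \<i>) ^ k * of_real (c ^ k * r ^ (3 * k))"
      by (simp add: power_mult_distrib p)
    show ?thesis
    proof (cases "even k")
      case True
      then obtain n where n: "k = 2 * n" by blast
      have "(- \<i>) ^ k = of_real ((-1) ^ n)" by (simp add: n power_mult)
      then show ?thesis unfolding p p'
        by (simp add: z_def spectral_coeff_def spectral_exponent_def n)
    next
      case False
      then obtain n where n: "k = 2 * n + 1" by (auto elim: oddE)
      have "(- \<i>) ^ k = - \<i> * of_real ((-1) ^ n)" by (simp add: n power_mult)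
      then show ?thesis unfolding p p'
        by (simp add: z_def spectral_coeff_def spectral_exponent_def n c_def field_simps)
    qed
  qed
  ultimately show ?thesis
    by (simp add: spectral_def z_def)
qed

lemma abs_spectral_le:
  assumes "r \<ge> 0" shows "\<bar>spectral r\<bar> \<le> connect + rate * r"
proof -
  have "\<bar>spectral r\<bar> \<le> norm (ode_sol (\<i> * complex_of_real r)) / pi"
    unfolding spectral_def by (simp add: abs_Im_le_cmod divide_right_mono)
  also have "\<dots> \<le> (connect + rate * r) / pi"
    using norm_ode_sol_le[of "\<i> * complex_of_real r"] assms by (intro divide_right_mono) (auto simp: norm_mult)
  also have "\<dots> \<le> (connect + rate * r) / 1"
    using connect_pos rate_pos assms pi_gt3 by (intro divide_left_mono) auto
  finally show ?thesis by simp
qed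

lemma strict_mono_spectral_exponent: "strict_mono spectral_exponent"
  by (rule strict_mono_Suc_iff[THEN iffD2]) (auto simp: spectral_exponent_def)

text \<open>Near 0 this is the tail of the series; beyond 1 both the function and its partial sum
  are crudely dominated. Having one bound on the whole half-line spares any splitting when it is
  integrated later.\<close>

lemma spectral_asymp:
  obtains K where "\<And>r. r \<ge> 0 \<Longrightarrow> 
    \<bar>spectral r - (\<Sum>k<N. spectral_coeff k * r ^ spectral_exponent k)\<bar> \<le> K * r ^ spectral_exponent N"
proof -
  note pm = strict_mono_less_eq[OF strict_mono_spectral_exponent]
  have bd: "norm (spectral_coeff k) \<le> (rate + connect) * (rate ^ k / fact k)" for k
  proof -
    have "(rate / 3) ^ k / fact k \<le> rate ^ k / fact k"
      using rate_pos by (intro divide_right_mono power_mono) auto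
    then have 1: "connect * ((rate / 3) ^ k / fact k) \<le> (rate + connect) * (rate ^ k / fact k)"
      using connect_pos rate_pos by (intro mult_mono) auto
    have 2: "rate * ode_coeff k \<le> (rate + connect) * (rate ^ k / fact k)"
      using connect_pos rate_pos ode_coeff_le[of k] ode_coeff_pos[of k] by (intro mult_mono) (auto intro: less_imp_le)
    define e where "e = (if even k then rate * ode_coeff k else connect * (rate / 3) ^ k / fact k)"
    have e: "0 \<le> e" "e \<le> (rate + connect) * (rate ^ k / fact k)"
      using 1 2 connect_pos rate_pos ode_coeff_pos[of k] by (auto simp: e_def)
    have "norm (spectral_coeff k) = e / pi"
      using e(1) by (simp add: spectral_coeff_def e_def[symmetric] abs_mult power_abs del: of_nat_Suc)
    also have "\<dots> \<le> e / 1"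
      using e(1) pi_gt3 by (intro divide_left_mono) auto
    finally show ?thesis using e(2) by simp
  qed
  have sa: "summable (\<lambda>k. \<bar>spectral_coeff k\<bar>)"
  proof (rule summable_comparison_test')
    show "summable (\<lambda>k. (rate + connect) * (rate ^ k / fact k))"
      using summable_exp[of rate] by (intro summable_mult) (simp add: field_simps)
  qed (use bd in auto)
  define A where "A = (\<Sum>k. \<bar>spectral_coeff k\<bar>)"
  define K where "K = A + connect + rate"
  have A0: "A \<ge> 0" unfolding A_def by (intro suminf_nonneg sa) auto
  show ?thesis
  proof (rule that[of K])
    fix r :: real assume r: "r \<ge> 0"
    define S where "S = (\<Sum>k<N. spectral_coeff k * r ^ spectral_exponent k)"
    show "\<bar>spectral r - S\<bar> \<le> K * r ^ spectral_exponent N"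
    proof (cases "r \<le> 1")
      case True
      have sums: "(\<lambda>k. spectral_coeff (k + N) * r ^ spectral_exponent (k + N)) sums (spectral r - S)"
        unfolding S_def by (rule sums_split_initial_segment) (rule spectral_sums)
      have sN: "summable (\<lambda>k. \<bar>spectral_coeff (k + N)\<bar>)"
        using sa by (rule summable_ignore_initial_segment)
      have "norm (spectral r - S) \<le> (\<Sum>k. \<bar>spectral_coeff (k + N)\<bar> * r ^ spectral_exponent N)"
        unfolding sums_unique[OF sums]
      proof (rule norm_suminf_le)
        show "summable (\<lambda>k. \<bar>spectral_coeff (k + N)\<bar> * r ^ spectral_exponent N)"
          using sN by (rule summable_mult2)
        show "norm (spectral_coeff (k + N) * r ^ spectral_exponent (k + N)) \<le> \<bar>spectral_coeff (k + N)\<bar> * r ^ spectral_exponent N" for k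
          using True r by (auto simp: abs_mult intro!: mult_left_mono power_decreasing pm[THEN iffD2])
      qed
      also have "\<dots> = (\<Sum>k. \<bar>spectral_coeff (k + N)\<bar>) * r ^ spectral_exponent N"
        using suminf_mult2[OF sN] by simp
      also have "\<dots> \<le> A * r ^ spectral_exponent N"
        using suminf_minus_initial_segment[OF sa, of N] r
        by (intro mult_right_mono) (simp_all add: A_def sum_nonneg)
      finally have "\<bar>spectral r - S\<bar> \<le> A * r ^ spectral_exponent N"
        by simp
      also have "\<dots> \<le> K * r ^ spectral_exponent N"
        using r connect_pos rate_pos by (intro mult_right_mono) (auto simp: K_def)
      finally show ?thesis .
    next
      case False
      then have r1: "r \<ge> 1" by simp
      have "\<bar>S\<bar> \<le> (\<Sum>k<N. \<bar>spectral_coeff k\<bar> * r ^ spectral_exponent N)"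
        unfolding S_def
        by (rule order_trans[OF sum_abs sum_mono])
          (use r1 in \<open>auto simp: abs_mult intro!: mult_left_mono power_increasing pm[THEN iffD2]\<close>)
      also have "\<dots> = (\<Sum>k<N. \<bar>spectral_coeff k\<bar>) * r ^ spectral_exponent N"
        by (simp add: sum_distrib_right)
      also have "\<dots> \<le> A * r ^ spectral_exponent N"
        unfolding A_def using r by (intro mult_right_mono sum_le_suminf sa) auto
      finally have 1: "\<bar>S\<bar> \<le> A * r ^ spectral_exponent N" .
      \<comment> \<open>The smallest exponent is 1, just enough to dominate the linear growth of
        \<open>spectral\<close>.\<close>
      have e1: "spectral_exponent N \<ge> 1" by (cases N) (auto simp: spectral_exponent_def)
      have "r ^ 1 \<le> r ^ spectral_exponent N" 
        using r1 e1 by (intro power_increasing) auto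
      then have "r \<le> r ^ spectral_exponent N" by simp
      moreover from this have "1 \<le> r ^ spectral_exponent N" using r1 by simp
      ultimately have "connect * 1 + rate * r \<le> connect * r ^ spectral_exponent N + rate * r ^ spectral_exponent N"
        using connect_pos rate_pos by (intro add_mono mult_left_mono) auto
      then have "\<bar>spectral r\<bar> \<le> connect * r ^ spectral_exponent N + rate * r ^ spectral_exponent N"
        using abs_spectral_le[OF r] by simp
      with 1 have "\<bar>spectral r - S\<bar> \<le> A * r ^ spectral_exponent N + (connect * r ^ spectral_exponent N + rate * r ^ spectral_exponent N)"
        by linarith
      then show ?thesis by (simp add: K_def algebra_simps)
    qed
  qed
qed

section \<open>Stieltjes representation\<close>

text \<open>All exponents are odd. Together with the odd Stieltjes weight this folds the integral
  along the imaginary axis onto the half-line.\<close>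

lemma spectral_minus: "spectral (- r) = - spectral r"
proof -
  have "odd (spectral_exponent k)" for k
    by (simp add: spectral_exponent_def)
  then have "(\<lambda>k. - (spectral_coeff k * r ^ spectral_exponent k)) sums spectral (- r)"
    using spectral_sums[of "- r"] by simp
  from sums_unique2[OF this sums_minus[OF spectral_sums[of r]]] show ?thesis .
qed

lemma continuous_on_ode_sol:
  "continuous_on S (ode_sol :: 'a \<Rightarrow> 'a::{real_normed_field,banach})"
  using has_field_derivative_ode_sol
  by (intro continuous_at_imp_continuous_on ballI) (blast intro: DERIV_isCont)

lemma continuous_on_spectral: "continuous_on S spectral"
proof -
  have "continuous_on UNIV spectral"
    unfolding spectral_def
    by (intro continuous_intros continuous_on_compose2[OF continuous_on_ode_sol[of UNIV]]) auto
  then show ?thesis by (rule continuous_on_subset) auto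
qed

lemma ode_sol_holomorphic: "(ode_sol :: complex \<Rightarrow> complex) holomorphic_on S"
  using has_field_derivative_ode_sol has_field_derivative_at_within holomorphic_onI field_differentiable_def
  by metis

context
  fixes l m :: real
  assumes l: "l > 0" and m: "m > 0"
begin

text \<open>The Cauchy kernel d mu / (mu - l), minus the one at m, pulled back by mu = s^2. Taking
  the difference improves the decay from 1/|s| to |s|^(-3), enough against a linearly growing
  function.\<close>

definition stieltjes_kernel :: "complex \<Rightarrow> complex" where
  "stieltjes_kernel s = 2 * s / (s\<^sup>2 - of_real l) - 2 * s / (s\<^sup>2 - of_real m)"

text \<open>In partial fractions 2s / (s^2 - l) is 1 / (s - sqrt l) + 1 / (s + sqrt l). The
  rectangle has its left edge on the imaginary axis, so it encloses only the positive roots.\<close>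

lemma stieltjes_contour:
  assumes R: "R > sqrt l" "R > sqrt m"
  shows "((\<lambda>s. ode_sol s * stieltjes_kernel s) has_contour_integral
     2 * pi * \<i> * (ode_sol (of_real (sqrt l)) - ode_sol (of_real (sqrt m)))) (rectpath (Complex 0 (-R)) (Complex R R))"
proof -
  let ?g = "rectpath (Complex 0 (-R)) (Complex R R)"
  have R0: "R > 0" using R(1) l by (meson order_less_trans real_sqrt_gt_zero)
  have pole: "((\<lambda>s. ode_sol s / (s - of_real a) + ode_sol s / (s - of_real (- a))) has_contour_integral 2 * pi * \<i> * ode_sol (of_real a)) ?g"
    if a: "0 < a" "a < R" for a :: real
  proof -
    have w: "winding_number ?g (of_real a) = 1"
      by (rule winding_number_rectpath) (use a in \<open>auto simp: in_box_complex_iff\<close>)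
    have pi: "path_image ?g = cbox (Complex 0 (-R)) (Complex R R) - box (Complex 0 (-R)) (Complex R R)"
      by (rule path_image_rectpath_cbox_minus_box) (use R0 in auto)
    have 1: "((\<lambda>s. ode_sol s / (s - of_real a)) has_contour_integral (2 * pi * \<i> * winding_number ?g (of_real a) * ode_sol (of_real a))) ?g"
      by (rule Cauchy_integral_formula_convex_simple[of UNIV])
        (use a in \<open>auto simp: ode_sol_holomorphic pi in_box_complex_iff\<close>)
    have 2: "((\<lambda>s. ode_sol s / (s - of_real (- a))) has_contour_integral 0) ?g"
    proof (rule Cauchy_theorem_convex_simple[of _ "{s. Re s > - a}"])
      show "(\<lambda>s. ode_sol s / (s - of_real (- a))) holomorphic_on {s. - a < Re s}"
        by (intro holomorphic_intros ode_sol_holomorphic) (auto simp: complex_eq_iff)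
      show "convex {s. - a < Re s}" by (rule convex_halfspace_Re_gt)
      show "path_image ?g \<subseteq> {s. - a < Re s}"
        using a by (auto simp: pi in_cbox_complex_iff)
    qed auto
    from has_contour_integral_add[OF 1 2] show ?thesis by (simp add: w)
  qed
  have "((\<lambda>s. (ode_sol s / (s - of_real (sqrt l)) + ode_sol s / (s - of_real (- sqrt l))) 
        - (ode_sol s / (s - of_real (sqrt m)) + ode_sol s / (s - of_real (- sqrt m)))) has_contour_integral
     2 * pi * \<i> * ode_sol (of_real (sqrt l)) - 2 * pi * \<i> * ode_sol (of_real (sqrt m))) ?g"
    by (intro has_contour_integral_diff pole) (use l m R in auto)
  moreover have "(ode_sol s / (s - of_real (sqrt l)) + ode_sol s / (s - of_real (- sqrt l))) 
        - (ode_sol s / (s - of_real (sqrt m)) + ode_sol s / (s - of_real (- sqrt m))) = ode_sol s * stieltjes_kernel s"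
    if "s \<in> path_image ?g" for s
  proof -
    have pi: "path_image ?g = cbox (Complex 0 (-R)) (Complex R R) - box (Complex 0 (-R)) (Complex R R)"
      by (rule path_image_rectpath_cbox_minus_box) (use R0 in auto)
    have ne: "s \<noteq> of_real a" "s \<noteq> of_real (- a)" if "0 < a" "a < R" for a :: real
      using \<open>s \<in> path_image ?g\<close> that unfolding pi 
      by (auto simp: in_cbox_complex_iff in_box_complex_iff)
    have fr: "1 / (s - of_real (sqrt x)) + 1 / (s - of_real (- sqrt x)) = 2 * s / (s\<^sup>2 - of_real x)" if x: "x > 0" "sqrt x < R" for x
    proof -
      have "s - of_real (sqrt x) \<noteq> 0" "s - of_real (- sqrt x) \<noteq> 0"
        using ne[of "sqrt x"] x by (auto simp: eq_neg_iff_add_eq_0)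
      moreover have "(of_real (sqrt x))\<^sup>2 = complex_of_real x"
        using x by (simp flip: of_real_power)
      then have "s\<^sup>2 - of_real x = (s - of_real (sqrt x)) * (s - of_real (- sqrt x))"
        by (simp add: algebra_simps power2_eq_square)
      ultimately show ?thesis
        by (simp add: divide_simps)
    qed
    show ?thesis
      unfolding stieltjes_kernel_def fr[OF l R(1), symmetric] fr[OF m R(2), symmetric]
      by (simp add: algebra_simps)
  qed
  ultimately have "((\<lambda>s. ode_sol s * stieltjes_kernel s) has_contour_integral
     2 * pi * \<i> * ode_sol (of_real (sqrt l)) - 2 * pi * \<i> * ode_sol (of_real (sqrt m))) ?g"
    by (rule has_contour_integral_eq)
  then show ?thesis by (simp only: right_diff_distrib)
qed

lemma norm_stieltjes_kernel_le:
  assumes s: "norm s \<ge> R" and R: "R > 0" "2 * l \<le> R\<^sup>2" "2 * m \<le> R\<^sup>2"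
  shows "norm (stieltjes_kernel s) \<le> 8 * \<bar>l - m\<bar> / R ^ 3"
proof -
  have ns: "norm s > 0" using s R by linarith
  have sq: "R\<^sup>2 \<le> (norm s)\<^sup>2" using s R by (intro power_mono) auto
  have low: "norm (s\<^sup>2 - of_real x) \<ge> (norm s)\<^sup>2 / 2" if "2 * x \<le> R\<^sup>2" "x > 0" for x
  proof -
    have "norm (s\<^sup>2) - norm (complex_of_real x) \<le> norm (s\<^sup>2 - of_real x)"
      by (rule norm_triangle_ineq2)
    then show ?thesis using that sq by (simp add: norm_power)
  qed
  have pos: "(norm s)\<^sup>2 / 2 > 0" using ns by simp
  have n0: "s\<^sup>2 - of_real l \<noteq> 0" "s\<^sup>2 - of_real m \<noteq> 0"
    using low[OF R(2) l] low[OF R(3) m] pos by (auto simp del: right_minus_eq)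
  have "stieltjes_kernel s = 2 * s * of_real (l - m) / ((s\<^sup>2 - of_real l) * (s\<^sup>2 - of_real m))"
    using n0 unfolding stieltjes_kernel_def by (simp add: divide_simps) (simp add: algebra_simps)
  then have "norm (stieltjes_kernel s) = 2 * norm s * \<bar>l - m\<bar> / (norm (s\<^sup>2 - of_real l) * norm (s\<^sup>2 - of_real m))"
    by (simp only: norm_mult norm_divide norm_of_real norm_numeral)
  also have "\<dots> \<le> 2 * norm s * \<bar>l - m\<bar> / (((norm s)\<^sup>2 / 2) * ((norm s)\<^sup>2 / 2))"
    using low[OF R(2) l] low[OF R(3) m] pos ns
    by (intro divide_left_mono mult_mono mult_pos_pos) (auto simp: zero_less_mult_iff n0)
  also have "\<dots> = 8 * \<bar>l - m\<bar> / norm s ^ 3"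
    using ns by (simp add: field_simps eval_nat_numeral)
  also have "\<dots> \<le> 8 * \<bar>l - m\<bar> / R ^ 3"
    using s R ns by (intro divide_left_mono power_mono) auto
  finally show ?thesis .
qed

text \<open>Cauchy's formula on growing rectangles: the three edges off the imaginary axis
  contribute O(1/R), and the left edge yields the jump.\<close>

lemma spectral_stieltjes:
  "((\<lambda>R. integral {0..R} (\<lambda>r. 2 * r * spectral r * (1 / (l + r\<^sup>2) - 1 / (m + r\<^sup>2)))) \<longlongrightarrow> ode_sol (sqrt l) - ode_sol (sqrt m)) at_top"
proof -
  define w where "w = (\<lambda>r::real. 2 * r * (1 / (l + r\<^sup>2) - 1 / (m + r\<^sup>2)))"
  have cont_w: "continuous_on S w" for S
  proof -
    have "l + r\<^sup>2 \<noteq> 0" "m + r\<^sup>2 \<noteq> 0" for r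
      using l m by (auto simp: add_nonneg_eq_0_iff)
    then show ?thesis unfolding w_def by (intro continuous_intros) auto
  qed
  have w_minus: "w (- r) = - w r" for r by (simp add: w_def)
  have bound: "\<bar>integral {0..R} (\<lambda>r. w r * spectral r) - (ode_sol (sqrt l) - ode_sol (sqrt m))\<bar>
      \<le> 32 * \<bar>l - m\<bar> * (connect + rate * (2 * R)) / R\<^sup>2"
    if R: "R > 0" "2 * l \<le> R\<^sup>2" "2 * m \<le> R\<^sup>2" for R
  proof -
    have Rsq: "R > sqrt l" "R > sqrt m"
      using R l m by (auto intro!: real_less_lsqrt)
    define f where "f = (\<lambda>s. ode_sol s * stieltjes_kernel s)"
    define a1 a2 a3 a4 where "a1 = Complex 0 (-R)" and "a2 = Complex R (-R)" and "a3 = Complex R R" and "a4 = Complex 0 R"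
    note a_def = a1_def a2_def a3_def a4_def
    have hc: "(f has_contour_integral 2 * pi * \<i> * (ode_sol (of_real (sqrt l)) - ode_sol (of_real (sqrt m)))) 
      (linepath a1 a2 +++ linepath a2 a3 +++ linepath a3 a4 +++ linepath a4 a1)"
      using stieltjes_contour[OF Rsq] by (simp add: rectpath_def Let_def a_def f_def)
    then have ci: "f contour_integrable_on linepath a1 a2" "f contour_integrable_on linepath a2 a3"
      "f contour_integrable_on linepath a3 a4" "f contour_integrable_on linepath a4 a1"
      by (auto dest!: has_contour_integral_integrable)
    have sum: "contour_integral (linepath a1 a2) f + contour_integral (linepath a2 a3) f + contour_integral (linepath a3 a4) f + contour_integral (linepath a4 a1) f
       = 2 * pi * \<i> * (ode_sol (of_real (sqrt l)) - ode_sol (of_real (sqrt m)))"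
      using contour_integral_unique[OF hc] ci by (simp add: add.assoc)
    \<comment> \<open>On the three outer edges |s| lies between R and 2R; their total length is 4R,
      whence the constant 32 = 4 * 8.\<close>
    define B where "B = (connect + rate * (2 * R)) * (8 * \<bar>l - m\<bar> / R ^ 3)"
    have B0: "B \<ge> 0" using R connect_pos rate_pos by (auto simp: B_def intro!: mult_nonneg_nonneg)
    have fb: "norm (f s) \<le> B" if s: "0 \<le> Re s" "Re s \<le> R" "\<bar>Im s\<bar> \<le> R" "Re s = R \<or> \<bar>Im s\<bar> = R" for s
    proof -
      have "norm s \<le> 2 * R" using cmod_le[of s] s by linarith
      moreover have "norm s \<ge> R" using abs_Re_le_cmod[of s] abs_Im_le_cmod[of s] s by linarith
      then have "norm (stieltjes_kernel s) \<le> 8 * \<bar>l - m\<bar> / R ^ 3"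
        using R by (rule norm_stieltjes_kernel_le)
      moreover have "rate * norm s \<le> rate * (2 * R)"
        using \<open>norm s \<le> 2 * R\<close> rate_pos by simp
      then have "norm (ode_sol s) \<le> connect + rate * (2 * R)"
        using norm_ode_sol_le[OF s(1)] by linarith
      ultimately show ?thesis
        unfolding f_def B_def norm_mult using R connect_pos rate_pos by (intro mult_mono) auto
    qed
    have seg: "norm (contour_integral (linepath a b) f) \<le> B * norm (b - a)"
      if "f contour_integrable_on linepath a b" "\<And>u. 0 \<le> u \<Longrightarrow> u \<le> 1 \<Longrightarrow> norm (f ((1 - u) *\<^sub>R a + u *\<^sub>R b)) \<le> B" for a b
      using that B0 by (intro contour_integral_bound_linepath) (auto simp: in_segment)
    have i1: "norm (contour_integral (linepath a1 a2) f) \<le> B * R"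
    proof -
      have "norm (f ((1 - u) *\<^sub>R a1 + u *\<^sub>R a2)) \<le> B" if u: "0 \<le> u" "u \<le> 1" for u
      proof -
        have "u * R \<le> R" "u * R \<ge> 0" using u R by (auto simp: mult_left_le_one_le)
        then show ?thesis
          using R by (intro fb) (auto simp: a_def algebra_simps)
      qed
      moreover have "norm (a2 - a1) = R" using R by (simp add: a_def cmod_def)
      ultimately show ?thesis using seg[OF ci(1)] by simp
    qed
    have i2: "norm (contour_integral (linepath a2 a3) f) \<le> B * (2 * R)"
    proof -
      have "norm (f ((1 - u) *\<^sub>R a2 + u *\<^sub>R a3)) \<le> B" if u: "0 \<le> u" "u \<le> 1" for u
      proof (rule fb)
        have "u * R \<le> R" "u * R \<ge> 0" using u R by (auto simp: mult_left_le_one_le)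
        then show "\<bar>Im ((1 - u) *\<^sub>R a2 + u *\<^sub>R a3)\<bar> \<le> R" by (simp add: a_def algebra_simps)
      qed (use R in \<open>auto simp: a_def algebra_simps\<close>)
      moreover have "norm (a3 - a2) = 2 * R" using R by (simp add: a_def cmod_def real_sqrt_mult)
      ultimately show ?thesis using seg[OF ci(2)] by simp
    qed
    have i3: "norm (contour_integral (linepath a3 a4) f) \<le> B * R"
    proof -
      have "norm (f ((1 - u) *\<^sub>R a3 + u *\<^sub>R a4)) \<le> B" if u: "0 \<le> u" "u \<le> 1" for u
      proof -
        have "u * R \<le> R" "u * R \<ge> 0" using u R by (auto simp: mult_left_le_one_le)
        then show ?thesis
          using R by (intro fb) (auto simp: a_def algebra_simps)
      qed
      moreover have "norm (a4 - a3) = R" using R by (simp add: a_def cmod_def)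
      ultimately show ?thesis using seg[OF ci(3)] by simp
    qed
    \<comment> \<open>On the imaginary axis the kernel is - i times a real odd function, so the real
      part of the integrand involves only the imaginary part of \<open>ode_sol\<close>.\<close>
    have k: "stieltjes_kernel (Complex 0 t) = - \<i> * of_real (w t)" for t
    proof -
      have "(Complex 0 t)\<^sup>2 = - of_real (t\<^sup>2)" by (simp add: complex_eq_iff power2_eq_square)
      then have sq: "(Complex 0 t)\<^sup>2 - of_real x = of_real (- (x + t\<^sup>2))" for x by simp
      have q: "2 * Complex 0 t / ((Complex 0 t)\<^sup>2 - of_real x) = - \<i> * of_real (2 * t / (x + t\<^sup>2))" for x
        unfolding sq using minus_divide_right[of "2 * t" "x + t\<^sup>2"]
        by (simp add: complex_eq_iff del: of_real_minus of_real_add)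
      show ?thesis
        unfolding stieltjes_kernel_def q by (simp add: w_def algebra_simps)
    qed
    define h where "h = (\<lambda>t. f (Complex 0 t))"
    have h: "h t = - \<i> * of_real (w t) * ode_sol (\<i> * of_real t)" for t
    proof -
      have "Complex 0 t = \<i> * of_real t" by (simp add: complex_eq_iff)
      then show ?thesis by (simp add: h_def f_def k)
    qed
    have hi: "h integrable_on {-R..R}"
      unfolding h using cont_w
      by (intro integrable_continuous_real continuous_intros continuous_on_compose2[OF continuous_on_ode_sol[of UNIV]]) auto
    have "contour_integral (linepath a1 a4) f = \<i> * integral {-R..R} h"
      using R by (subst contour_integral_linepath_same_Re) (auto simp: a_def h_def)
    then have i4: "contour_integral (linepath a4 a1) f = - \<i> * integral {-R..R} h"
      using contour_integral_reversepath[of "linepath a1 a4" f] by simp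
    have int_s: "(\<lambda>t. w t * spectral t) integrable_on {a..b}" for a b
      by (intro integrable_continuous_real continuous_intros cont_w continuous_on_spectral)
    have "Re (integral {-R..R} h) = integral {-R..R} (\<lambda>t. Re (h t))"
      using integral_linear[OF hi bounded_linear_Re] by (simp add: o_def)
    also have "(\<lambda>t. Re (h t)) = (\<lambda>t. - pi * (w t * spectral t))"
      by (simp add: h spectral_def fun_eq_iff)
    also have "integral {-R..R} (\<lambda>t. - pi * (w t * spectral t)) = - pi * integral {-R..R} (\<lambda>t. w t * spectral t)"
      by (rule integral_mult_right)
    also have "integral {-R..R} (\<lambda>t. w t * spectral t) = integral {-R..0} (\<lambda>t. w t * spectral t) + integral {0..R} (\<lambda>t. w t * spectral t)"
      by (rule Henstock_Kurzweil_Integration.integral_combine[symmetric]) (use R int_s in auto)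
    also have "integral {-R..0} (\<lambda>t. w t * spectral t) = integral {0..R} (\<lambda>t. w t * spectral t)"
      using Henstock_Kurzweil_Integration.integral_reflect_real[of R 0 "\<lambda>t. w t * spectral t"] by (simp add: w_minus spectral_minus)
    finally have Re_h: "Re (integral {-R..R} h) = - 2 * pi * integral {0..R} (\<lambda>t. w t * spectral t)" by simp
    define D where "D = contour_integral (linepath a1 a2) f + contour_integral (linepath a2 a3) f + contour_integral (linepath a3 a4) f"
    have "D - \<i> * integral {-R..R} h = 2 * pi * \<i> * (of_real (ode_sol (sqrt l) - ode_sol (sqrt m)))"
      using sum unfolding D_def i4 by simp
    then have "Im D - Re (integral {-R..R} h) = 2 * pi * (ode_sol (sqrt l) - ode_sol (sqrt m))"
      by (simp add: complex_eq_iff)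
    then have e: "2 * pi * (integral {0..R} (\<lambda>t. w t * spectral t) - (ode_sol (sqrt l) - ode_sol (sqrt m))) = - Im D"
      unfolding Re_h by (simp add: algebra_simps)
    have "\<bar>Im D\<bar> \<le> norm D" by (rule abs_Im_le_cmod)
    also have "\<dots> \<le> B * R + B * (2 * R) + B * R"
      unfolding D_def by (intro order_trans[OF norm_triangle_ineq] add_mono i1 i2 i3)
    finally have D: "\<bar>Im D\<bar> \<le> 4 * B * R" by simp
    define X where "X = \<bar>integral {0..R} (\<lambda>t. w t * spectral t) - (ode_sol (sqrt l) - ode_sol (sqrt m))\<bar>"
    have "X = 1 * X" by simp
    also have "\<dots> \<le> 2 * pi * X"
      using pi_gt3 by (intro mult_right_mono) (auto simp: X_def)
    also have "2 * pi * X = \<bar>Im D\<bar>"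
      using arg_cong[OF e, of abs] by (simp add: X_def abs_mult)
    also note D
    also have "4 * B * R = 32 * \<bar>l - m\<bar> * (connect + rate * (2 * R)) / R\<^sup>2"
      using R by (simp add: B_def power2_eq_square power3_eq_cube)
    finally show ?thesis by (simp only: X_def)
  qed
  have "((\<lambda>R. integral {0..R} (\<lambda>r. w r * spectral r) - (ode_sol (sqrt l) - ode_sol (sqrt m))) \<longlongrightarrow> 0) at_top"
  proof (rule Lim_null_comparison)
    have "eventually (\<lambda>R. 2 * l \<le> R\<^sup>2) at_top" "eventually (\<lambda>R. 2 * m \<le> R\<^sup>2) at_top"
      by real_asymp+
    then show "eventually (\<lambda>R. norm (integral {0..R} (\<lambda>r. w r * spectral r) - (ode_sol (sqrt l) - ode_sol (sqrt m)))
      \<le> 32 * \<bar>l - m\<bar> * (connect + rate * (2 * R)) / R\<^sup>2) at_top"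
      using eventually_gt_at_top[of 0] by eventually_elim (use bound in auto)
    show "((\<lambda>R. 32 * \<bar>l - m\<bar> * (connect + rate * (2 * R)) / R\<^sup>2) \<longlongrightarrow> 0) at_top"
      by real_asymp
  qed
  moreover have "w r * spectral r = 2 * r * spectral r * (1 / (l + r\<^sup>2) - 1 / (m + r\<^sup>2))" for r
    by (simp add: w_def)
  ultimately show ?thesis
    by (simp add: LIM_zero_iff)
qed

end

section \<open>Gaussian moments of the spectral function\<close>

lemma has_bochner_integral_gaussian_moment:
  assumes t: "t > (0::real)"
  shows "has_bochner_integral lborel (\<lambda>r. indicator {0..} r * (exp (- (r\<^sup>2 * t)) * r ^ (2 * k)))
    (sqrt pi / 2 * (fact (2 * k) / (2 ^ (2 * k) * fact k)) / (t ^ k * sqrt t))"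
proof -
  define I where "I = sqrt pi / 2 * (fact (2 * k) / (2 ^ (2 * k) * fact k))"
  have "has_bochner_integral lborel (\<lambda>x::real. indicator {0..} x *\<^sub>R (exp (- x\<^sup>2) * x ^ (2 * k))) I"
    unfolding I_def by (rule gaussian_moment_even_pos)
  then have "has_bochner_integral lborel (\<lambda>x. indicator {0..} (0 + sqrt t * x) *\<^sub>R (exp (- (0 + sqrt t * x)\<^sup>2) * (0 + sqrt t * x) ^ (2 * k))) (I /\<^sub>R \<bar>sqrt t\<bar>)"
    using t by (subst (asm) lborel_has_bochner_integral_real_affine_iff[where c = "sqrt t" and t = 0]) auto
  then have "has_bochner_integral lborel (\<lambda>x. indicator {0..} (0 + sqrt t * x) *\<^sub>R (exp (- (0 + sqrt t * x)\<^sup>2) * (0 + sqrt t * x) ^ (2 * k)) / t ^ k) (I /\<^sub>R \<bar>sqrt t\<bar> / t ^ k)"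
    by (rule has_bochner_integral_divide_zero)
  moreover have "indicator {0..} (0 + sqrt t * x) *\<^sub>R (exp (- (0 + sqrt t * x)\<^sup>2) * (0 + sqrt t * x) ^ (2 * k)) / t ^ k
      = indicator {0..} x * (exp (- (x\<^sup>2 * t)) * x ^ (2 * k))" for x
  proof -
    have "sqrt t ^ (2 * k) = t ^ k" using t by (simp add: power_mult)
    then show ?thesis
      using t by (auto simp: indicator_def zero_le_mult_iff power_mult_distrib mult.commute)
  qed
  ultimately have "has_bochner_integral lborel (\<lambda>x. indicator {0..} x * (exp (- (x\<^sup>2 * t)) * x ^ (2 * k))) (I /\<^sub>R \<bar>sqrt t\<bar> / t ^ k)"
    by (simp only:)
  also have "I /\<^sub>R \<bar>sqrt t\<bar> / t ^ k = I / (t ^ k * sqrt t)"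
    using t by (simp add: divide_inverse)
  finally show ?thesis by (simp only: I_def)
qed

lemma integrable_of_bound:
  fixes f g :: "'a \<Rightarrow> real"
  assumes g: "integrable M g" and f: "f \<in> borel_measurable M" and le: "\<And>x. \<bar>f x\<bar> \<le> g x"
  shows "integrable M f"
proof (rule Bochner_Integration.integrable_bound[OF g f AE_I2])
  show "norm (f x) \<le> norm (g x)" for x using le[of x] by simp
qed

lemma integrable_gaussian_moment:
  assumes t: "t > (0::real)"
  shows "integrable lborel (\<lambda>r. indicator {0..} r * (exp (- (r\<^sup>2 * t)) * r ^ k))"
proof -
  let ?f = "\<lambda>k r. indicator {0..} r * (exp (- (r\<^sup>2 * t)) * r ^ k) :: real"
  have "integrable lborel (?f (2 * k))" for k
    using has_bochner_integral_gaussian_moment[OF t, of k] by (auto simp: has_bochner_integral_iff)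
  \<comment> \<open>Library moments cover even powers; other powers are dominated through r^k <= 1 +
    r^(2k).\<close>
  then have "integrable lborel (\<lambda>r. ?f (2 * 0) r + ?f (2 * k) r)"
    by (intro Bochner_Integration.integrable_add)
  then show ?thesis
  proof (rule integrable_of_bound)
    fix r :: real
    show "\<bar>?f k r\<bar> \<le> ?f (2 * 0) r + ?f (2 * k) r"
    proof (cases "r \<ge> 0")
      case True
      have "r ^ k \<le> 1 + r ^ (2 * k)"
      proof (cases "r ^ k \<le> 1")
        case True
        with \<open>r \<ge> 0\<close> show ?thesis by (simp add: add_increasing2)
      next
        case False
        then have "r ^ k * 1 \<le> r ^ k * r ^ k" using \<open>r \<ge> 0\<close> by (intro mult_left_mono) auto
        then show ?thesis by (simp add: mult_2 power_add)
      qed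
      then have "exp (- (r\<^sup>2 * t)) * r ^ k \<le> exp (- (r\<^sup>2 * t)) * (1 + r ^ (2 * k))"
        by (intro mult_left_mono) auto
      then show ?thesis using True by (simp add: algebra_simps)
    qed auto
  qed auto
qed

lemma borel_measurable_spectral [measurable]: "spectral \<in> borel_measurable borel"
  by (rule borel_measurable_continuous_onI) (rule continuous_on_spectral)

text \<open>A derivative in t brings down - r^2. Index 1 will be the tail probability at t and index
  3 the density.\<close>

definition spectral_moment :: "nat \<Rightarrow> real \<Rightarrow> real" where
  "spectral_moment k t = (LINT r|lborel. indicator {0..} r * (2 * r ^ k * exp (- (r\<^sup>2 * t)) * spectral r))"

lemma integrable_spectral_moment:
  assumes t: "t > (0::real)"
  shows "integrable lborel (\<lambda>r. indicator {0..} r * (2 * r ^ k * exp (- (r\<^sup>2 * t)) * spectral r))"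
proof -
  let ?g = "\<lambda>k r. indicator {0..} r * (exp (- (r\<^sup>2 * t)) * r ^ k) :: real"
  have "integrable lborel (\<lambda>r. 2 * connect * ?g k r + 2 * rate * ?g (k + 1) r)"
    by (intro Bochner_Integration.integrable_add integrable_mult_right integrable_gaussian_moment t)
  then show ?thesis
  proof (rule integrable_of_bound)
    fix r :: real
    show "\<bar>indicator {0..} r * (2 * r ^ k * exp (- (r\<^sup>2 * t)) * spectral r)\<bar> \<le> 2 * connect * ?g k r + 2 * rate * ?g (k + 1) r"
    proof (cases "r \<ge> 0")
      case True
      have "\<bar>2 * r ^ k * exp (- (r\<^sup>2 * t)) * spectral r\<bar> \<le> 2 * r ^ k * exp (- (r\<^sup>2 * t)) * (connect + rate * r)"
        using abs_spectral_le[OF True] True by (simp add: abs_mult mult_left_mono)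
      also have "\<dots> = 2 * connect * (exp (- (r\<^sup>2 * t)) * r ^ k) + 2 * rate * (exp (- (r\<^sup>2 * t)) * r ^ (k + 1))"
        by (simp add: algebra_simps)
      finally show ?thesis using True by simp
    qed auto
  qed auto
qed

lemma abs_exp_remainder_le: "\<bar>exp (x::real) - 1 - x\<bar> \<le> x\<^sup>2 * exp \<bar>x\<bar>"
proof -
  obtain t where t: "\<bar>t\<bar> \<le> \<bar>x\<bar>" "exp x = (\<Sum>m<2. (x ^ m) / fact m) + (exp t / fact 2) * x ^ 2"
    using Maclaurin_exp_le[of x 2] by blast
  then have eq: "exp x - 1 - x = exp t / 2 * x\<^sup>2" by (simp add: lessThan_Suc eval_nat_numeral)
  have "exp t / 2 * x\<^sup>2 \<le> exp \<bar>x\<bar> * x\<^sup>2"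
  proof (rule mult_right_mono)
    have "exp t \<le> exp \<bar>x\<bar>" using t(1) by simp
    then show "exp t / 2 \<le> exp \<bar>x\<bar>" using exp_gt_zero[of "\<bar>x\<bar>"] by linarith
  qed simp
  moreover have "exp t / 2 * x\<^sup>2 \<ge> 0" by simp
  ultimately show ?thesis unfolding eq by (simp only: abs_of_nonneg mult.commute[of "x\<^sup>2"])
qed

text \<open>Differentiation under the integral by a second-order remainder. Increments up to t/2
  leave half of the Gaussian weight as an integrable majorant, and the remainder brings the factor
  r^4.\<close>

lemma DERIV_spectral_moment:
  assumes t: "t > 0"
  shows "(spectral_moment k has_real_derivative - spectral_moment (k + 2) t) (at t)"
proof -
  define K where "K = (LINT r|lborel. \<bar>indicator {0..} r * (2 * r ^ (k + 4) * exp (- (r\<^sup>2 * (t / 2))) * spectral r)\<bar>)"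
  have bound: "\<bar>spectral_moment k (t + h) - spectral_moment k t + h * spectral_moment (k + 2) t\<bar> \<le> K * h\<^sup>2"
    if h: "\<bar>h\<bar> \<le> t / 2" for h
  proof -
    have th: "t + h > 0" using h t by linarith
    let ?f = "\<lambda>k t r. indicator {0..} r * (2 * r ^ k * exp (- (r\<^sup>2 * t)) * spectral r) :: real"
    note int = integrable_spectral_moment[OF th] integrable_spectral_moment[OF t]
    have eq: "spectral_moment k (t + h) - spectral_moment k t + h * spectral_moment (k + 2) t
        = (LINT r|lborel. ?f k (t + h) r - ?f k t r + h * ?f (k + 2) t r)"
      unfolding spectral_moment_def using int(1)[of k] int(2)[of k] int(2)[of "k + 2"] by simp
    have "\<bar>spectral_moment k (t + h) - spectral_moment k t + h * spectral_moment (k + 2) t\<bar>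
        \<le> (LINT r|lborel. \<bar>?f k (t + h) r - ?f k t r + h * ?f (k + 2) t r\<bar>)"
      unfolding eq by (rule integral_abs_bound)
    also have "\<dots> \<le> (LINT r|lborel. \<bar>?f (k + 4) (t / 2) r\<bar> * h\<^sup>2)"
    proof (rule integral_mono)
      show "integrable lborel (\<lambda>r. \<bar>?f k (t + h) r - ?f k t r + h * ?f (k + 2) t r\<bar>)"
        by (intro integrable_abs Bochner_Integration.integrable_add Bochner_Integration.integrable_diff integrable_mult_right int)
      show "integrable lborel (\<lambda>r. \<bar>?f (k + 4) (t / 2) r\<bar> * h\<^sup>2)"
        using t by (intro integrable_mult_left integrable_abs integrable_spectral_moment) auto
      fix r :: real
      show "\<bar>?f k (t + h) r - ?f k t r + h * ?f (k + 2) t r\<bar> \<le> \<bar>?f (k + 4) (t / 2) r\<bar> * h\<^sup>2"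
      proof (cases "r \<ge> 0")
        case True
        have "?f k (t + h) r - ?f k t r + h * ?f (k + 2) t r
            = 2 * r ^ k * exp (- (r\<^sup>2 * t)) * spectral r * (exp (- (r\<^sup>2 * h)) - 1 - (- (r\<^sup>2 * h)))"
          using True by (simp add: algebra_simps power_add exp_diff exp_minus power2_eq_square exp_add divide_inverse)
        then have "\<bar>?f k (t + h) r - ?f k t r + h * ?f (k + 2) t r\<bar> 
            = 2 * r ^ k * exp (- (r\<^sup>2 * t)) * \<bar>spectral r\<bar> * \<bar>exp (- (r\<^sup>2 * h)) - 1 - (- (r\<^sup>2 * h))\<bar>"
          using True by (simp add: abs_mult)
        also have "\<dots> \<le> 2 * r ^ k * exp (- (r\<^sup>2 * t)) * \<bar>spectral r\<bar> * ((- (r\<^sup>2 * h))\<^sup>2 * exp (r\<^sup>2 * (t / 2)))"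
        proof (rule mult_left_mono)
          have "\<bar>- (r\<^sup>2 * h)\<bar> \<le> r\<^sup>2 * (t / 2)"
            using mult_left_mono[OF h, of "r\<^sup>2"] by (simp add: abs_mult)
          then have "(- (r\<^sup>2 * h))\<^sup>2 * exp \<bar>- (r\<^sup>2 * h)\<bar> \<le> (- (r\<^sup>2 * h))\<^sup>2 * exp (r\<^sup>2 * (t / 2))"
            by (simp add: mult_left_mono)
          then show "\<bar>exp (- (r\<^sup>2 * h)) - 1 - (- (r\<^sup>2 * h))\<bar> \<le> (- (r\<^sup>2 * h))\<^sup>2 * exp (r\<^sup>2 * (t / 2))"
            by (rule order_trans[OF abs_exp_remainder_le])
        qed (use True in simp)
        also have "\<dots> = 2 * r ^ k * \<bar>spectral r\<bar> * (r ^ 4 * h\<^sup>2) * (exp (- (r\<^sup>2 * t)) * exp (r\<^sup>2 * (t / 2)))"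
          by (simp add: power_mult_distrib flip: power_mult)
        also have "exp (- (r\<^sup>2 * t)) * exp (r\<^sup>2 * (t / 2)) = exp (- (r\<^sup>2 * (t / 2)))"
          by (simp flip: exp_add)
        also have "2 * r ^ k * \<bar>spectral r\<bar> * (r ^ 4 * h\<^sup>2) * exp (- (r\<^sup>2 * (t / 2))) = \<bar>?f (k + 4) (t / 2) r\<bar> * h\<^sup>2"
          using True by (simp add: abs_mult power_add)
        finally show ?thesis .
      qed auto
    qed
    also have "\<dots> = K * h\<^sup>2" by (simp add: K_def)
    finally show ?thesis .
  qed
  let ?q = "\<lambda>h. (spectral_moment k (t + h) - spectral_moment k t) / h - (- spectral_moment (k + 2) t)"
  have "(?q \<longlongrightarrow> 0) (at 0)"
  proof (rule Lim_null_comparison)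
    show "eventually (\<lambda>h. norm (?q h) \<le> K * \<bar>h\<bar>) (at 0)"
      unfolding eventually_at
    proof (intro exI[of _ "t / 2"] conjI ballI impI)
      fix h :: real assume "h \<noteq> 0 \<and> dist h 0 < t / 2"
      then have h: "h \<noteq> 0" "\<bar>h\<bar> \<le> t / 2" by (auto simp: dist_real_def)
      have eq: "?q h = (spectral_moment k (t + h) - spectral_moment k t + h * spectral_moment (k + 2) t) / h"
        using h by (simp add: field_simps)
      have "norm (?q h) \<le> K * h\<^sup>2 / \<bar>h\<bar>"
        unfolding eq using bound[OF h(2)] h(1) by (simp add: divide_right_mono)
      also have "\<dots> = K * \<bar>h\<bar>" using h by (simp add: power2_eq_square abs_if)
      finally show "norm (?q h) \<le> K * \<bar>h\<bar>" .
    qed (use t in auto)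
    show "((\<lambda>h. K * \<bar>h\<bar>) \<longlongrightarrow> 0) (at 0)"
      by (rule tendsto_eq_intros refl | simp)+
  qed
  then show ?thesis
    unfolding DERIV_def by (rule LIM_zero_cancel)
qed

text \<open>Watson's lemma. Since \<open>spectral_asymp\<close> holds on the whole half-line, it can
  be integrated directly against the weight, without a separate tail estimate.\<close>

lemma spectral_moment_asymp:
  assumes j: "odd j"
  obtains K where "\<And>t. t > 0 \<Longrightarrow> \<bar>spectral_moment j t - (\<Sum>k<N. spectral_coeff k * 
      (2 * (LINT r|lborel. indicator {0..} r * (exp (- (r\<^sup>2 * t)) * r ^ (spectral_exponent k + j)))))\<bar>
     \<le> K * (LINT r|lborel. indicator {0..} r * (exp (- (r\<^sup>2 * t)) * r ^ (spectral_exponent N + j)))"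
proof -
  obtain K where K: "\<And>r. r \<ge> 0 \<Longrightarrow> 
    \<bar>spectral r - (\<Sum>k<N. spectral_coeff k * r ^ spectral_exponent k)\<bar> \<le> K * r ^ spectral_exponent N"
    using spectral_asymp[of N] by blast
  show ?thesis
  proof (rule that[of "2 * K"])
    fix t :: real assume t: "t > 0"
    let ?m = "\<lambda>k r. indicator {0..} r * (exp (- (r\<^sup>2 * t)) * r ^ k) :: real"
    let ?f = "\<lambda>r. indicator {0..} r * (2 * r ^ j * exp (- (r\<^sup>2 * t)) * spectral r)"
    have eq: "spectral_moment j t - (\<Sum>k<N. spectral_coeff k * (2 * (LINT r|lborel. ?m (spectral_exponent k + j) r)))
        = (LINT r|lborel. ?f r - (\<Sum>k<N. spectral_coeff k * (2 * ?m (spectral_exponent k + j) r)))"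
      unfolding spectral_moment_def
      using integrable_spectral_moment[OF t] integrable_gaussian_moment[OF t]
      by (subst Bochner_Integration.integral_diff) (auto intro!: integrable_mult_right Bochner_Integration.integrable_sum)
    have "\<bar>spectral_moment j t - (\<Sum>k<N. spectral_coeff k * (2 * (LINT r|lborel. ?m (spectral_exponent k + j) r)))\<bar>
        \<le> (LINT r|lborel. \<bar>?f r - (\<Sum>k<N. spectral_coeff k * (2 * ?m (spectral_exponent k + j) r))\<bar>)"
      unfolding eq by (rule integral_abs_bound)
    also have "\<dots> \<le> (LINT r|lborel. 2 * K * ?m (spectral_exponent N + j) r)"
    proof (rule integral_mono)
      show "integrable lborel (\<lambda>r. \<bar>?f r - (\<Sum>k<N. spectral_coeff k * (2 * ?m (spectral_exponent k + j) r))\<bar>)"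
        by (intro integrable_abs Bochner_Integration.integrable_diff Bochner_Integration.integrable_sum
           integrable_spectral_moment[OF t] integrable_mult_right integrable_gaussian_moment[OF t])
      show "integrable lborel (\<lambda>r. 2 * K * ?m (spectral_exponent N + j) r)"
        by (intro integrable_mult_right integrable_gaussian_moment[OF t])
      fix r :: real
      show "\<bar>?f r - (\<Sum>k<N. spectral_coeff k * (2 * ?m (spectral_exponent k + j) r))\<bar> \<le> 2 * K * ?m (spectral_exponent N + j) r"
      proof (cases "r \<ge> 0")
        case True
        have eq: "?f r - (\<Sum>k<N. spectral_coeff k * (2 * ?m (spectral_exponent k + j) r))
           = (2 * r ^ j * exp (- (r\<^sup>2 * t))) * (spectral r - (\<Sum>k<N. spectral_coeff k * r ^ spectral_exponent k))"
          using True by (simp add: right_diff_distrib sum_distrib_left power_add mult_ac)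
        have "\<bar>?f r - (\<Sum>k<N. spectral_coeff k * (2 * ?m (spectral_exponent k + j) r))\<bar>
            \<le> (2 * r ^ j * exp (- (r\<^sup>2 * t))) * (K * r ^ spectral_exponent N)"
          unfolding eq abs_mult using True by (intro mult_mono K) auto
        also have "\<dots> = 2 * K * ?m (spectral_exponent N + j) r"
          using True by (simp add: power_add mult_ac)
        finally show ?thesis .
      qed auto
    qed
    also have "\<dots> = 2 * K * (LINT r|lborel. ?m (spectral_exponent N + j) r)"
      by simp
    finally show "\<bar>spectral_moment j t - (\<Sum>k<N. spectral_coeff k * (2 * (LINT r|lborel. ?m (spectral_exponent k + j) r)))\<bar>
       \<le> 2 * K * (LINT r|lborel. ?m (spectral_exponent N + j) r)" .
  qed
qed

section \<open>Laplace transforms\<close>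

lemma has_bochner_integral_exp_minus:
  assumes a: "a > (0::real)"
  shows "has_bochner_integral lborel (\<lambda>t. indicator {0..} t * exp (- (a * t))) (1 / a)"
proof -
  have hi: "((\<lambda>t. exp (- a * t)) has_integral 1 / a) {0..}"
    using has_integral_exp_minus_to_infinity[OF a, of 0] by simp
  then have "(\<lambda>t. exp (- a * t)) absolutely_integrable_on {0..}"
    by (intro nonnegative_absolutely_integrable_1) (auto simp: has_integral_integrable)
  moreover from this have "set_lebesgue_integral lebesgue {0..} (\<lambda>t. exp (- a * t)) = 1 / a"
    using hi by (simp add: set_lebesgue_integral_eq_integral integral_unique)
  ultimately have "has_bochner_integral lebesgue (\<lambda>t. indicator {0..} t * exp (- (a * t))) (1 / a)"
    by (simp add: has_bochner_integral_iff set_integrable_def set_lebesgue_integral_def)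
  then show ?thesis
    by (simp add: has_bochner_integral_iff integrable_completion integral_completion)
qed

lemma integrable_inverse_1_plus_square: "integrable lborel (\<lambda>x::real. inverse (1 + x\<^sup>2))"
  using Sinc_Integral.integrable_inverse_1_plus_square by (simp add: set_integrable_def)

text \<open>Fubini: integrating over t first produces the weights of
  \<open>spectral_stieltjes\<close>, whose conditional limit then becomes an absolutely convergent
  integral.\<close>

lemma spectral_moment_laplace:
  assumes lm: "1 \<le> l" "l < m"
  shows "has_bochner_integral lborel (\<lambda>t. indicator {0..} t * ((exp (- (l * t)) - exp (- (m * t))) * spectral_moment 1 t))
    (ode_sol (sqrt l) - ode_sol (sqrt m))"
proof -
  define w where "w = (\<lambda>r::real. 1 / (l + r\<^sup>2) - 1 / (m + r\<^sup>2))"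
  define f where "f = (\<lambda>r t. indicator {0..} r * (2 * r * spectral r) * (indicator {0..} t * (exp (- ((l + r\<^sup>2) * t)) - exp (- ((m + r\<^sup>2) * t)))) :: real)"
  have meas: "case_prod f \<in> borel_measurable (lborel \<Otimes>\<^sub>M lborel)"
    unfolding f_def by measurable
  have lpos: "l + r\<^sup>2 > 0" "m + r\<^sup>2 > 0" for r using lm by (auto intro: add_pos_nonneg)
  have inner: "has_bochner_integral lborel (\<lambda>t. indicator {0..} t * (exp (- ((l + r\<^sup>2) * t)) - exp (- ((m + r\<^sup>2) * t)))) (w r)" for r
    using has_bochner_integral_diff[OF has_bochner_integral_exp_minus[OF lpos(1)[of r]] has_bochner_integral_exp_minus[OF lpos(2)[of r]]]
    by (simp add: w_def algebra_simps)
  have nonneg: "indicator {0..} t * (exp (- ((l + r\<^sup>2) * t)) - exp (- ((m + r\<^sup>2) * t))) \<ge> 0" for r t :: real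
    using lm by (auto simp: indicator_def mult_right_mono)
  have f_int: "integrable lborel (f r)" "(LINT t|lborel. norm (f r t)) = \<bar>indicator {0..} r * (2 * r * spectral r)\<bar> * w r"
    "(LINT t|lborel. f r t) = indicator {0..} r * (2 * r * spectral r) * w r" for r
  proof -
    show "integrable lborel (f r)"
      unfolding f_def using inner by (intro integrable_mult_right) (auto simp: has_bochner_integral_iff)
    have "(LINT t|lborel. norm (f r t)) = (LINT t|lborel. \<bar>indicator {0..} r * (2 * r * spectral r)\<bar> * (indicator {0..} t * (exp (- ((l + r\<^sup>2) * t)) - exp (- ((m + r\<^sup>2) * t)))))"
      unfolding f_def real_norm_def abs_mult[of "indicator {0..} r * (2 * r * spectral r)"] using nonneg by (simp only: abs_of_nonneg)
    also have "\<dots> = \<bar>indicator {0..} r * (2 * r * spectral r)\<bar> * w r"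
      using inner[of r] by (simp only: integral_mult_right_zero has_bochner_integral_iff)
    finally show "(LINT t|lborel. norm (f r t)) = \<bar>indicator {0..} r * (2 * r * spectral r)\<bar> * w r" .
    show "(LINT t|lborel. f r t) = indicator {0..} r * (2 * r * spectral r) * w r"
      unfolding f_def using inner[of r] by (simp only: integral_mult_right_zero has_bochner_integral_iff)
  qed
  have w_nonneg: "w r \<ge> 0" for r
    using lm lpos[of r] by (simp add: w_def frac_le)
  \<comment> \<open>The factor 2 * r * spectral r is O(1 + r^2) and the difference of the two
    fractions is O((1 + r^2)^(-2)), so the product is integrable.\<close>
  have bound: "\<bar>indicator {0..} r * (2 * r * spectral r)\<bar> * w r \<le> (connect + 2 * rate) * (m - l) * inverse (1 + r\<^sup>2)" for r
  proof (cases "r \<ge> 0")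
    case True
    have r2: "2 * r \<le> 1 + r\<^sup>2" using sum_squares_bound[of r 1] by simp
    have "\<bar>2 * r * spectral r\<bar> \<le> 2 * r * (connect + rate * r)"
      using True abs_spectral_le[OF True] by (simp add: abs_mult mult_left_mono)
    also have "\<dots> = connect * (2 * r) + 2 * rate * r\<^sup>2" by (simp add: algebra_simps power2_eq_square)
    also have "\<dots> \<le> connect * (1 + r\<^sup>2) + 2 * rate * (1 + r\<^sup>2)"
      using r2 connect_pos rate_pos by (intro add_mono mult_left_mono) auto
    finally have 1: "\<bar>2 * r * spectral r\<bar> \<le> (connect + 2 * rate) * (1 + r\<^sup>2)" by (simp add: algebra_simps)
    have "w r = (m - l) / ((l + r\<^sup>2) * (m + r\<^sup>2))"
      using lpos[of r] by (simp add: w_def divide_simps)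
    also have "\<dots> \<le> (m - l) / ((1 + r\<^sup>2) * (1 + r\<^sup>2))"
      using lm lpos[of r] by (intro divide_left_mono mult_mono mult_pos_pos add_pos_nonneg) auto
    finally have 2: "w r \<le> (m - l) / ((1 + r\<^sup>2) * (1 + r\<^sup>2))" .
    have p: "1 + r\<^sup>2 > 0" by (simp add: add_pos_nonneg)
    have cancel: "(u * q) * (v / (q * q)) = u * v * inverse q" if "q > 0" for u v q :: real
      using that by (simp add: field_simps)
    have "\<bar>2 * r * spectral r\<bar> * w r \<le> ((connect + 2 * rate) * (1 + r\<^sup>2)) * ((m - l) / ((1 + r\<^sup>2) * (1 + r\<^sup>2)))"
      using 1 2 w_nonneg[of r] connect_pos rate_pos p by (intro mult_mono) auto
    also have "\<dots> = (connect + 2 * rate) * (m - l) * inverse (1 + r\<^sup>2)"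
      by (rule cancel[OF p])
    finally show ?thesis using True by simp
  next
    case False
    have "0 \<le> (connect + 2 * rate) * (m - l) * inverse (1 + r\<^sup>2)"
      using connect_pos rate_pos lm by (intro mult_nonneg_nonneg) (auto simp: add_nonneg_nonneg)
    then show ?thesis using False by simp
  qed
  have meas_w: "w \<in> borel_measurable borel" unfolding w_def by measurable
  have int1: "integrable lborel (\<lambda>r. \<bar>indicator {0..} r * (2 * r * spectral r)\<bar> * w r)"
  proof (rule integrable_of_bound)
    show "integrable lborel (\<lambda>r. (connect + 2 * rate) * (m - l) * inverse (1 + r\<^sup>2))"
      by (intro integrable_mult_right integrable_inverse_1_plus_square)
    show "\<bar>\<bar>indicator {0..} r * (2 * r * spectral r)\<bar> * w r\<bar> \<le> (connect + 2 * rate) * (m - l) * inverse (1 + r\<^sup>2)" for r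
      using bound[of r] w_nonneg[of r] unfolding abs_mult abs_idempotent by (simp add: abs_of_nonneg)
  qed (use meas_w in measurable)
  have int: "integrable (lborel \<Otimes>\<^sub>M lborel) (case_prod f)"
    by (rule lborel_pair.Fubini_integrable[OF meas]) (use int1 f_int in \<open>simp_all add: f_int(2)\<close>)
  have f_eq: "(LINT r|lborel. f r t) = indicator {0..} t * ((exp (- (l * t)) - exp (- (m * t))) * spectral_moment 1 t)" for t
  proof -
    have "f r t = indicator {0..} t * (exp (- (l * t)) - exp (- (m * t))) * (indicator {0..} r * (2 * r ^ 1 * exp (- (r\<^sup>2 * t)) * spectral r))" for r
    proof -
      have "exp (- ((x + r\<^sup>2) * t)) = exp (- (x * t)) * exp (- (r\<^sup>2 * t))" for x
        by (simp add: algebra_simps flip: exp_add)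
      then show ?thesis by (simp add: f_def algebra_simps)
    qed
    then show ?thesis by (simp add: spectral_moment_def)
  qed
  have "integrable lborel (\<lambda>t. LINT r|lborel. f r t)"
    using lborel_pair.integrable_snd[OF int] by simp
  moreover have "(LINT t|lborel. LINT r|lborel. f r t) = ode_sol (sqrt l) - ode_sol (sqrt m)"
  proof -
    have "(LINT t|lborel. LINT r|lborel. f r t) = (LINT r|lborel. LINT t|lborel. f r t)"
      by (rule lborel_pair.Fubini_integral[OF int])
    also have "\<dots> = (LINT r:{0..}|lborel. 2 * r * spectral r * w r)"
      unfolding f_int(3) set_lebesgue_integral_def by (simp only: mult.assoc real_scaleR_def)
    finally have eq: "(LINT t|lborel. LINT r|lborel. f r t) = (LINT r:{0..}|lborel. 2 * r * spectral r * w r)" .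
    have si: "set_integrable lborel {0..} (\<lambda>r. 2 * r * spectral r * w r)"
    proof -
      have "integrable lborel (\<lambda>r. LINT t|lborel. f r t)"
        using lborel_pair.integrable_fst[OF int] by simp
      then show ?thesis
        unfolding f_int(3) set_integrable_def by (simp only: mult.assoc real_scaleR_def)
    qed
    have "((\<lambda>R. LINT r:{0..R}|lborel. 2 * r * spectral r * w r) \<longlongrightarrow> (LINT r:{0..}|lborel. 2 * r * spectral r * w r)) at_top"
      by (rule tendsto_set_lebesgue_integral_at_top[OF _ si]) auto
    moreover have "(LINT r:{0..R}|lborel. 2 * r * spectral r * w r) = integral {0..R} (\<lambda>r. 2 * r * spectral r * (1 / (l + r\<^sup>2) - 1 / (m + r\<^sup>2)))" for R
      using set_borel_integral_eq_integral(2)[OF set_integrable_subset[OF si, of "{0..R}"]] by (auto simp: w_def)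
    ultimately have "((\<lambda>R. integral {0..R} (\<lambda>r. 2 * r * spectral r * (1 / (l + r\<^sup>2) - 1 / (m + r\<^sup>2)))) \<longlongrightarrow> (LINT r:{0..}|lborel. 2 * r * spectral r * w r)) at_top"
      by simp
    then show ?thesis
      unfolding eq using spectral_stieltjes[of l m] lm
      by (intro tendsto_unique[of at_top]) auto
  qed
  ultimately show ?thesis
    unfolding f_eq by (simp add: has_bochner_integral_iff)
qed

text \<open>By Weierstrass, \<open>w\<close> is orthogonal to all continuous functions of \<open>exp (- t)\<close>, in particular to bumps.\<close>

lemma laplace_transform_unique:
  fixes w :: "real \<Rightarrow> real"
  assumes int: "set_integrable lborel {0<..} w" and cont: "continuous_on {0<..} w"
    and zero: "\<And>n::nat. (LINT t:{0<..}|lborel. exp (- (real n * t)) * w t) = 0"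
    and t: "t > 0"
  shows "w t = 0"
proof (rule ccontr)
  assume neq: "w t \<noteq> 0"
  have intk: "set_integrable lborel {0<..} (\<lambda>t. k (exp (- t)) * w t)"
    if k: "continuous_on {0..1} k" for k :: "real \<Rightarrow> real"
  proof -
    have "bounded (k ` {0..1})" using compact_continuous_image[OF k] by (simp add: compact_imp_bounded)
    then obtain B where B: "\<And>x. x \<in> {0..1} \<Longrightarrow> \<bar>k x\<bar> \<le> B" by (force simp: bounded_iff)
    have m: "(\<lambda>t. indicator {0<..} t *\<^sub>R (k (exp (- t)))) \<in> borel_measurable borel"
      by (intro borel_measurable_continuous_on_indicator continuous_on_compose2[OF k]) (auto intro!: continuous_intros)
    have "(\<lambda>t. indicator {0<..} t *\<^sub>R k (exp (- t)) * (indicator {0<..} t *\<^sub>R w t)) \<in> borel_measurable lborel"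
      using int m by (intro borel_measurable_times) (auto simp: set_integrable_def)
    then have m': "(\<lambda>t. indicator {0<..} t *\<^sub>R (k (exp (- t)) * w t)) \<in> borel_measurable lborel"
      by (rule measurable_cong[THEN iffD1, rotated]) (auto simp: indicator_def)
    show ?thesis
      unfolding set_integrable_def
    proof (rule Bochner_Integration.integrable_bound[OF _ m'])
      show "integrable lborel (\<lambda>t. B * (indicator {0<..} t *\<^sub>R w t))"
        using int by (auto simp: set_integrable_def)
      show "AE t in lborel. norm (indicator {0<..} t *\<^sub>R (k (exp (- t)) * w t)) \<le> norm (B * (indicator {0<..} t *\<^sub>R w t))"
      proof (rule AE_I2)
        fix t :: real
        have "\<bar>k (exp (- t))\<bar> \<le> \<bar>B\<bar>" if "t > 0" using B[of "exp (- t)"] that by force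
        then show "norm (indicator {0<..} t *\<^sub>R (k (exp (- t)) * w t)) \<le> norm (B * (indicator {0<..} t *\<^sub>R w t))"
          by (auto simp: indicator_def abs_mult mult_right_mono)
      qed
    qed
  qed
  have poly: "(LINT t:{0<..}|lborel. p (exp (- t)) * w t) = 0" if pf: "real_polynomial_function p" for p
  proof -
    obtain a n where p: "p = (\<lambda>x. \<Sum>i\<le>n. a i * x ^ i)"
      using pf unfolding real_polynomial_function_iff_sum by blast
    have si: "set_integrable lborel {0<..} (\<lambda>t. a i * (exp (- t) ^ i * w t))" for i
      by (intro set_integrable_mult_right intk[of "\<lambda>x. x ^ i"] continuous_intros)
    have "(LINT t:{0<..}|lborel. p (exp (- t)) * w t) = (LINT t:{0<..}|lborel. (\<Sum>i\<le>n. a i * (exp (- t) ^ i * w t)))"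
      unfolding p by (simp add: sum_distrib_right mult.assoc)
    also have "\<dots> = (\<Sum>i\<le>n. LINT t:{0<..}|lborel. a i * (exp (- t) ^ i * w t))"
      using si unfolding set_lebesgue_integral_def scaleR_sum_right set_integrable_def
      by (rule Bochner_Integration.integral_sum)
    also have "\<dots> = 0"
      using zero by (intro sum.neutral) (simp flip: exp_of_nat_mult)
    finally show ?thesis .
  qed
  have kzero: "(LINT t:{0<..}|lborel. k (exp (- t)) * w t) = 0"
    if k: "continuous_on {0..1} k" for k :: "real \<Rightarrow> real"
  proof -
    define W where "W = (LINT t:{0<..}|lborel. \<bar>w t\<bar>)"
    have intabs: "set_integrable lborel {0<..} (\<lambda>t. \<bar>w t\<bar>)" using set_integrable_abs[OF int] .
    have W: "W \<ge> 0" unfolding W_def set_lebesgue_integral_def by (intro integral_nonneg_AE) auto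
    define X where "X = \<bar>LINT t:{0<..}|lborel. k (exp (- t)) * w t\<bar>"
    have bound: "X \<le> e * (W + 1)" if e: "e > 0" for e
    proof -
      obtain p where p: "real_polynomial_function p" "\<And>x. x \<in> {0..1} \<Longrightarrow> \<bar>k x - p x\<bar> < e"
        using Stone_Weierstrass_real_polynomial_function[OF _ k e] by auto
      have cp: "continuous_on {0..1} p"
        using p(1) by (intro continuous_at_imp_continuous_on ballI continuous_real_polymonial_function)
      note ik = intk[OF k] note ip = intk[OF cp]
      have eq: "(LINT t:{0<..}|lborel. k (exp (- t)) * w t) = (LINT t:{0<..}|lborel. (k (exp (- t)) * w t) - (p (exp (- t)) * w t))"
        using set_integral_diff(2)[OF ik ip] poly[OF p(1)] by simp
      have "\<bar>LINT t:{0<..}|lborel. (k (exp (- t)) * w t) - (p (exp (- t)) * w t)\<bar>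
          \<le> (LINT t:{0<..}|lborel. \<bar>(k (exp (- t)) * w t) - (p (exp (- t)) * w t)\<bar>)"
        unfolding set_lebesgue_integral_def
        by (rule order_trans[OF integral_abs_bound]) (simp add: abs_mult)
      then have "\<bar>LINT t:{0<..}|lborel. k (exp (- t)) * w t\<bar>
          \<le> (LINT t:{0<..}|lborel. \<bar>(k (exp (- t)) * w t) - (p (exp (- t)) * w t)\<bar>)"
        by (simp only: eq)
      also have "\<dots> \<le> (LINT t:{0<..}|lborel. e * \<bar>w t\<bar>)"
      proof (rule set_integral_mono)
        show "set_integrable lborel {0<..} (\<lambda>t. \<bar>(k (exp (- t)) * w t) - (p (exp (- t)) * w t)\<bar>)"
          using set_integral_diff(1)[OF ik ip] by (rule set_integrable_abs)
        show "set_integrable lborel {0<..} (\<lambda>t. e * \<bar>w t\<bar>)" using intabs by simp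
        fix t :: real assume "t \<in> {0<..}"
        then have "\<bar>k (exp (- t)) - p (exp (- t))\<bar> \<le> e" using p(2)[of "exp (- t)"] by force
        then show "\<bar>(k (exp (- t)) * w t) - (p (exp (- t)) * w t)\<bar> \<le> e * \<bar>w t\<bar>"
          unfolding left_diff_distrib[symmetric] abs_mult by (rule mult_right_mono) auto
      qed
      also have "\<dots> = e * W" by (simp add: W_def)
      also have "\<dots> \<le> e * (W + 1)" using e by simp
      finally show ?thesis unfolding X_def .
    qed
    have "X \<le> 0"
    proof (rule ccontr)
      assume "\<not> X \<le> 0"
      then have "X \<le> X / (2 * (W + 1)) * (W + 1)"
        using W by (intro bound) auto
      also have "\<dots> = X / 2" using W by (simp add: field_simps)
      finally show False using \<open>\<not> X \<le> 0\<close> by simp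
    qed
    then show ?thesis by (simp add: X_def)
  qed
  have "isCont w t" using cont t by (simp add: continuous_on_eq_continuous_at)
  then have "isCont (\<lambda>s. w s * w t) t" by simp
  moreover have "w t * w t > 0" using neq by (simp add: zero_less_mult_iff) linarith
  moreover have "((\<lambda>s. w s * w t) \<longlongrightarrow> w t * w t) (nhds t)"
    using tendsto_at_iff_tendsto_nhds[of "\<lambda>s. w s * w t" t] calculation(1) by (simp add: isCont_def)
  ultimately have "eventually (\<lambda>s. w s * w t > 0) (nhds t)"
    by (intro order_tendstoD(1)) auto
  then obtain d where d: "d > 0" "\<And>s. \<bar>s - t\<bar> < d \<Longrightarrow> w s * w t > 0"
    by (auto simp: eventually_nhds_metric dist_real_def)
  define a b where "a = exp (- (t + d))" and "b = exp (- (t - d))"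
  \<comment> \<open>A bump in the variable exp (- s), supported where |s - t| <= d. The factor
    \<open>w t\<close> gives it the sign of w there, so k * w is nonnegative everywhere and its
    vanishing integral is a contradiction.\<close>
  define k where "k = (\<lambda>x. max 0 ((x - a) * (b - x)) * w t)"
  have "continuous_on {0..1} k" unfolding k_def by (intro continuous_intros)
  note kz = kzero[OF this] and ki = intk[OF this]
  have pos: "k (exp (- s)) * w s > 0" if "\<bar>s - t\<bar> < d" for s
  proof -
    have "a < exp (- s)" "exp (- s) < b" using that by (auto simp: a_def b_def)
    then have "max 0 ((exp (- s) - a) * (b - exp (- s))) > 0" by (simp add: less_max_iff_disj)
    then have "max 0 ((exp (- s) - a) * (b - exp (- s))) * (w s * w t) > 0"
      using d(2)[OF that] by (rule mult_pos_pos)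
    then show ?thesis by (simp add: k_def mult_ac)
  qed
  have nn: "k (exp (- s)) * w s \<ge> 0" for s
  proof (cases "\<bar>s - t\<bar> < d")
    case False
    then have "exp (- s) \<le> a \<or> exp (- s) \<ge> b" by (auto simp: a_def b_def abs_if split: if_splits)
    moreover have "a \<le> b" using d by (simp add: a_def b_def)
    ultimately have "(exp (- s) - a) * (b - exp (- s)) \<le> 0" by (auto simp: mult_le_0_iff)
    then show ?thesis by (simp add: k_def)
  qed (use pos in \<open>auto intro: less_imp_le\<close>)
  have "AE s in lborel. indicator {0<..} s *\<^sub>R (k (exp (- s)) * w s) = 0"
    using kz ki nn unfolding set_lebesgue_integral_def set_integrable_def
    by (subst (asm) integral_nonneg_eq_0_iff_AE) auto
  then have "AE s in lborel. s \<notin> {max 0 (t - d)<..<t + d}"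
  proof eventually_elim
    case (elim s)
    show ?case
    proof
      assume "s \<in> {max 0 (t - d)<..<t + d}"
      then have "s > 0" "\<bar>s - t\<bar> < d" by (auto simp: abs_if)
      with pos[of s] elim show False by (simp only: scaleR_eq_0_iff indicator_eq_0_iff) auto
    qed
  qed
  then have "{max 0 (t - d)<..<t + d} \<in> null_sets lborel"
    by (subst (asm) AE_iff_null_sets[symmetric]) auto
  moreover have "max 0 (t - d) \<le> t + d" using d t by auto
  ultimately show False
    using d t by (auto simp: null_sets_def max_def split: if_splits)
qed

section \<open>The killed Gaussian random walk and its running maximum\<close>

definition laplace_value :: "real \<Rightarrow> real" where
  "laplace_value \<mu> = ode_sol (sqrt \<mu>)"

text \<open>With the killing rate frozen at mu the expected lifetime would be 1/mu. The defect is
  the loss caused by future increases of the maximum, for a path that sits at its maximum.\<close>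

definition laplace_defect :: "real \<Rightarrow> real" where
  "laplace_defect \<mu> = 1 / \<mu> - laplace_value \<mu>"

lemma laplace_defect_nonneg: "\<mu> > 0 \<Longrightarrow> laplace_defect \<mu> \<ge> 0"
  using ode_sol_le[of "sqrt \<mu>"] by (simp add: laplace_defect_def laplace_value_def)

lemma laplace_defect_le: "\<mu> > 0 \<Longrightarrow> laplace_defect \<mu> \<le> 1 / \<mu>"
  using ode_sol_nonneg[of "sqrt \<mu>"] by (simp add: laplace_defect_def laplace_value_def)

text \<open>By \<open>ode_sol_ge\<close> the defect is O(mu^(-5/2)), which beats the third power of
  sqrt (2 * mu). This makes the Taylor constants below uniform in the running maximum.\<close>

lemma laplace_defect_power:
  assumes m: "\<mu> \<ge> 1"
  shows "laplace_defect \<mu> * sqrt (2 * \<mu>) ^ 3 \<le> 2" "laplace_defect \<mu> * sqrt (2 * \<mu>) ^ 2 \<le> 2"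
    "laplace_defect \<mu> \<le> 1"
proof -
  define s where "s = sqrt \<mu>"
  have s: "s \<ge> 1" "\<mu> = s\<^sup>2" using m by (simp_all add: s_def)
  have d: "laplace_defect \<mu> \<le> 2 / rate / s ^ 5"
    using ode_sol_ge[of s] s(1) unfolding laplace_defect_def laplace_value_def s_def[symmetric]
    unfolding s(2) by simp
  have a: "sqrt (2 * \<mu>) = sqrt 2 * s" using s by (simp add: real_sqrt_mult)
  have d': "laplace_defect \<mu> * (sqrt 2 * s ^ 5) \<le> 1"
  proof -
    have "laplace_defect \<mu> * (sqrt 2 * s ^ 5) \<le> 2 / rate / s ^ 5 * (sqrt 2 * s ^ 5)"
      using d s by (intro mult_right_mono) auto
    also have "\<dots> = 1" using s by (simp add: rate_def)
    finally show ?thesis .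
  qed
  have n: "laplace_defect \<mu> \<ge> 0" using m by (simp add: laplace_defect_nonneg)
  have s3: "s ^ 3 \<le> s ^ 5" "s ^ 2 \<le> s ^ 5" "1 \<le> s ^ 5" using s by (auto intro!: power_increasing one_le_power)
  have q2: "sqrt 2 ^ 3 = 2 * sqrt (2::real)" by (simp add: power3_eq_cube)
  have "laplace_defect \<mu> * sqrt (2 * \<mu>) ^ 3 = 2 * (laplace_defect \<mu> * (sqrt 2 * s ^ 3))"
    by (simp add: a power_mult_distrib q2)
  also have "\<dots> \<le> 2 * (laplace_defect \<mu> * (sqrt 2 * s ^ 5))"
    using n s3 by (intro mult_left_mono) auto
  finally show "laplace_defect \<mu> * sqrt (2 * \<mu>) ^ 3 \<le> 2" using d' by linarith
  have "laplace_defect \<mu> * sqrt (2 * \<mu>) ^ 2 = laplace_defect \<mu> * (2 * s ^ 2)"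
    by (simp add: a power_mult_distrib)
  also have "\<dots> \<le> laplace_defect \<mu> * (2 * sqrt 2 * s ^ 5)"
  proof (intro mult_left_mono n)
    have "1 * s ^ 2 \<le> sqrt 2 * s ^ 5" using s3 by (intro mult_mono) auto
    then show "2 * s ^ 2 \<le> 2 * sqrt 2 * s ^ 5" by simp
  qed
  finally show "laplace_defect \<mu> * sqrt (2 * \<mu>) ^ 2 \<le> 2" using d' by (simp add: algebra_simps)
  show "laplace_defect \<mu> \<le> 1"
    using laplace_defect_le[of \<mu>] m by (smt (verit) divide_le_eq_1)
qed

text \<open>The differential equation in the variable mu. The slope along the diagonal b = s equals
  the slope of \<open>excursion_value\<close> in b from below; this is the boundary condition F_s =
  0, and it makes first-order terms match across the maximum.\<close>

lemma DERIV_laplace_value: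
  assumes m: "\<mu> > 0"
  shows "(laplace_value has_real_derivative - (sqrt (2 * \<mu>) * laplace_defect \<mu>)) (at \<mu>)"
proof -
  have "(ode_sol has_real_derivative (rate * (sqrt \<mu>)\<^sup>2 * ode_sol (sqrt \<mu>) - rate)) (at (sqrt \<mu>))"
    using has_field_derivative_ode_sol[of "sqrt \<mu>"] by simp
  from DERIV_chain2[OF this DERIV_real_sqrt[OF m]]
  have "(laplace_value has_real_derivative (rate * (sqrt \<mu>)\<^sup>2 * ode_sol (sqrt \<mu>) - rate) * (inverse (sqrt \<mu>) / 2)) (at \<mu>)"
    unfolding laplace_value_def [abs_def] .
  moreover have "(rate * (sqrt \<mu>)\<^sup>2 * ode_sol (sqrt \<mu>) - rate) * (inverse (sqrt \<mu>) / 2) = - (sqrt (2 * \<mu>) * laplace_defect \<mu>)"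
  proof -
    define s where "s = sqrt \<mu>"
    have s: "s > 0" "\<mu> = s\<^sup>2" using m by (simp_all add: s_def)
    have "sqrt (2 * \<mu>) = sqrt 2 * s" using s by (simp add: real_sqrt_mult)
    then show ?thesis
      unfolding laplace_defect_def laplace_value_def s_def[symmetric] unfolding s(2)
      using s(1) by (simp add: rate_def field_simps power2_eq_square)
  qed
  ultimately show ?thesis by simp
qed

lemma laplace_value_taylor:
  assumes m: "\<mu> \<ge> 1" and x: "x \<ge> 0"
  shows "\<bar>laplace_value (\<mu> + x) - laplace_value \<mu> + sqrt (2 * \<mu>) * laplace_defect \<mu> * x\<bar> \<le> 5 * x\<^sup>2"
proof -
  define g where "g = (\<lambda>u. - (sqrt (2 * u) * laplace_defect u))"
  define g' where "g' = (\<lambda>u. - (inverse (sqrt (2 * u)) * laplace_defect u + sqrt (2 * u) * (- 1 / u\<^sup>2 + sqrt (2 * u) * laplace_defect u)))"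
  have dg: "(g has_real_derivative g' u) (at u)" if u: "u \<ge> 1" for u
  proof -
    have d1: "(laplace_defect has_real_derivative (- 1 / u\<^sup>2 + sqrt (2 * u) * laplace_defect u)) (at u)"
      unfolding laplace_defect_def [abs_def] using u
      by (auto intro!: derivative_eq_intros DERIV_laplace_value simp: laplace_defect_def power2_eq_square)
    have d2: "((\<lambda>u. sqrt (2 * u)) has_real_derivative inverse (sqrt (2 * u))) (at u)"
      using u by (auto intro!: derivative_eq_intros simp: field_simps)
    show ?thesis
      unfolding g_def g'_def using DERIV_minus[OF DERIV_mult[OF d2 d1]] by (simp add: algebra_simps)
  qed
  have g'_le: "norm (g' u) \<le> 5" if u: "u \<ge> 1" for u
  proof -
    have n: "laplace_defect u \<ge> 0" "laplace_defect u \<le> 1" and n2: "laplace_defect u * sqrt (2 * u) ^ 2 \<le> 2"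
      using laplace_defect_power[OF u] laplace_defect_nonneg[of u] u by auto
    have s1: "sqrt (2 * u) \<ge> 1" using u by simp
    have i: "inverse (sqrt (2 * u)) * laplace_defect u \<le> 1 * 1"
      using n s1 by (intro mult_mono) (auto simp: inverse_le_1_iff)
    have i0: "0 \<le> inverse (sqrt (2 * u)) * laplace_defect u" using n s1 by simp
    have k0: "0 \<le> sqrt (2 * u) * (sqrt (2 * u) * laplace_defect u)" using n s1 by simp
    have k: "sqrt (2 * u) * (sqrt (2 * u) * laplace_defect u) \<le> 2" using n2 by (simp add: power2_eq_square mult_ac)
    have j: "sqrt (2 * u) * (1 / u\<^sup>2) \<le> 2"
    proof -
      have "sqrt (2 * u) \<le> 2 * u" 
        by (rule real_le_lsqrt) (use u in \<open>auto simp: power2_eq_square\<close>)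
      also have "\<dots> \<le> 2 * u\<^sup>2" using u by (simp add: power2_eq_square)
      finally show ?thesis using u by (simp add: field_simps)
    qed
    have j0: "0 \<le> sqrt (2 * u) * (1 / u\<^sup>2)" using u by simp
    have "g' u = - (inverse (sqrt (2 * u)) * laplace_defect u) + sqrt (2 * u) * (1 / u\<^sup>2) - sqrt (2 * u) * (sqrt (2 * u) * laplace_defect u)"
      by (simp add: g'_def algebra_simps)
    \<comment> \<open>The three terms of g' are bounded by 1, 2 and 2, whence the constant
      5.\<close>
    then show ?thesis using i i0 j j0 k k0 unfolding real_norm_def by linarith
  qed
  have g_lip: "norm (g u - g \<mu>) \<le> 5 * norm (u - \<mu>)" if "u \<in> {\<mu>..\<mu> + x}" for u
    by (rule field_differentiable_bound[of "{\<mu>..\<mu> + x}" g g'])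
      (use that m x g'_le dg in \<open>auto intro: has_field_derivative_at_within\<close>)
  have "norm ((laplace_value (\<mu> + x) - g \<mu> * (\<mu> + x)) - (laplace_value \<mu> - g \<mu> * \<mu>)) \<le> (5 * x) * norm (\<mu> + x - \<mu>)"
  proof (rule field_differentiable_bound[of "{\<mu>..\<mu> + x}" "\<lambda>u. laplace_value u - g \<mu> * u" "\<lambda>u. g u - g \<mu>"])
    show "((\<lambda>u. laplace_value u - g \<mu> * u) has_real_derivative g u - g \<mu>) (at u within {\<mu>..\<mu> + x})" if "u \<in> {\<mu>..\<mu> + x}" for u
    proof -
      have "((\<lambda>u. laplace_value u - g \<mu> * u) has_real_derivative g u - g \<mu>) (at u)"
        unfolding g_def using that m by (auto intro!: derivative_eq_intros DERIV_laplace_value)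
      then show ?thesis by (rule has_field_derivative_at_within)
    qed
    show "norm (g u - g \<mu>) \<le> 5 * x" if "u \<in> {\<mu>..\<mu> + x}" for u
      using g_lip[OF that] that by (auto simp: abs_of_nonneg)
  qed (use x in auto)
  then show ?thesis
    using x by (simp add: g_def algebra_simps power2_eq_square)
qed

text \<open>The weight max 1 (exp x), in place of exp |x|, is what a factor exp (- a * y) can absorb
  for all x <= a * y, even for large steps downwards.\<close>

lemma exp_taylor3:
  fixes x :: real
  shows "\<bar>exp x - 1 - x - x\<^sup>2 / 2\<bar> \<le> 4 * \<bar>x\<bar> ^ 3 * max 1 (exp x)"
proof (cases "x \<ge> - 1")
  case True
  obtain t where t: "\<bar>t\<bar> \<le> \<bar>x\<bar>" "exp x = (\<Sum>m<3. (x ^ m) / fact m) + (exp t / fact 3) * x ^ 3"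
    using Maclaurin_exp_le[of x 3] by blast
  then have eq: "exp x - 1 - x - x\<^sup>2 / 2 = exp t / 6 * x ^ 3" by (simp add: lessThan_Suc eval_nat_numeral)
  have "exp t \<le> 3 * max 1 (exp x)"
  proof (cases "x \<ge> 0")
    case True
    then have "exp t \<le> exp x" using t(1) by simp
    then show ?thesis using exp_gt_zero[of x] by linarith
  next
    case False
    then have "exp t \<le> exp 1" using t(1) \<open>x \<ge> -1\<close> by simp
    then show ?thesis using exp_le by linarith
  qed
  then have "\<bar>exp t / 6\<bar> \<le> 4 * max 1 (exp x)" by auto
  then have "\<bar>exp t / 6\<bar> * \<bar>x\<bar> ^ 3 \<le> 4 * max 1 (exp x) * \<bar>x\<bar> ^ 3"
    by (rule mult_right_mono) auto
  then show ?thesis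
    unfolding eq by (simp only: abs_mult power_abs mult_ac)
next
  case False
  define y where "y = - x"
  have y: "y > 1" "x = - y" using False by (auto simp: y_def)
  have p: "y \<le> y ^ 3" "y ^ 2 \<le> y ^ 3" "1 \<le> y ^ 3"
    using y power_increasing[of 1 3 y] power_increasing[of 2 3 y] by auto
  have "0 < exp x" "exp x \<le> 1" using y by auto
  moreover have "exp x - 1 - x - x\<^sup>2 / 2 = exp x - 1 + y - y\<^sup>2 / 2" by (simp add: y(2))
  ultimately have "\<bar>exp x - 1 - x - x\<^sup>2 / 2\<bar> \<le> 4 * y ^ 3"
    using p y(1) zero_le_power2[of y] by (intro abs_leI) linarith+
  also have "\<dots> = 4 * \<bar>x\<bar> ^ 3 * max 1 (exp x)" using y \<open>exp x \<le> 1\<close> by (simp add: max_absorb1)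
  finally show ?thesis .
qed

section \<open>Second-order expansion of the expected lifetime\<close>

text \<open>
  For a Brownian path at \<open>b\<close> with running maximum \<open>s\<close>, killed at rate \<open>lam + s\<close>, this is the expected
  lifetime: it satisfies \<open>F\<^sub>b\<^sub>b / 2 = (lam + s) * F - 1\<close> below \<open>s\<close> and \<open>F\<^sub>s = 0\<close> at \<open>b = s\<close>.
\<close>

definition excursion_value :: "real \<Rightarrow> real \<times> real \<Rightarrow> real" where
  "excursion_value lam = (\<lambda>(s, b). 1 / (lam + s) - laplace_defect (lam + s) * exp (- (sqrt (2 * (lam + s)) * (s - b))))"

lemma excursion_value_bounds:
  assumes "lam + s \<ge> 1" "b \<le> s"
  shows "0 \<le> excursion_value lam (s, b)" "excursion_value lam (s, b) \<le> 1 / (lam + s)"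
proof -
  have n: "laplace_defect (lam + s) \<ge> 0" "laplace_defect (lam + s) \<le> 1 / (lam + s)"
    using laplace_defect_nonneg laplace_defect_le assms by auto
  have "laplace_defect (lam + s) * exp (- (sqrt (2 * (lam + s)) * (s - b))) \<le> 1 / (lam + s) * 1"
    using n assms by (intro mult_mono) auto
  then show "0 \<le> excursion_value lam (s, b)" by (simp add: excursion_value_def)
  show "excursion_value lam (s, b) \<le> 1 / (lam + s)" using n by (simp add: excursion_value_def)
qed

text \<open>The coefficient mu * F - 1 of z^2 is half of F_bb by the differential equation. Below
  the maximum the remainder is cubic; beyond it only first derivatives match, which leaves a square
  of the overshoot z - (s - b).\<close>

lemma excursion_value_taylor:
  fixes lam s b z :: real
  defines "\<mu> \<equiv> lam + s"
  assumes m: "\<mu> \<ge> 1" and b: "b \<le> s"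
  shows "\<bar>excursion_value lam (max s (b + z), b + z) - excursion_value lam (s, b)
      + sqrt (2 * \<mu>) * laplace_defect \<mu> * exp (- (sqrt (2 * \<mu>) * (s - b))) * z
      - (\<mu> * excursion_value lam (s, b) - 1) * z\<^sup>2\<bar> \<le> 8 * (\<bar>z\<bar> ^ 3 + (max 0 (z - (s - b)))\<^sup>2)"
proof -
  define a where "a = sqrt (2 * \<mu>)"
  define d where "d = laplace_defect \<mu>"
  define y where "y = s - b"
  define e where "e = exp (- (a * y))"
  have a: "a > 0" "a\<^sup>2 = 2 * \<mu>" using m by (auto simp: a_def)
  have d: "d \<ge> 0" "d * a ^ 3 \<le> 2" "d * a\<^sup>2 \<le> 2"
    using laplace_defect_power[OF m] laplace_defect_nonneg[of \<mu>] m by (auto simp: d_def a_def)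
  have y: "y \<ge> 0" using b by (simp add: y_def)
  have e: "e > 0" "e * exp (a * y) = 1" by (simp_all add: e_def flip: exp_add)
  have F: "excursion_value lam (s, b) = 1 / \<mu> - d * e"
    by (simp add: excursion_value_def \<mu>_def d_def e_def a_def y_def)
  have c2: "(\<mu> * excursion_value lam (s, b) - 1) = - (d * e * a\<^sup>2 / 2)"
    using m a by (simp add: F algebra_simps)
  define rem where "rem = excursion_value lam (max s (b + z), b + z) - (1 / \<mu> - d * e * (1 + a * z + (a * z)\<^sup>2 / 2))"
  have "\<bar>rem\<bar> \<le> 8 * (\<bar>z\<bar> ^ 3 + (max 0 (z - y))\<^sup>2)"
  proof (cases "z \<le> y")
    case True
    have "excursion_value lam (max s (b + z), b + z) = 1 / \<mu> - d * exp (- (a * (y - z)))"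
      using True by (simp add: excursion_value_def y_def \<mu>_def d_def a_def max_def algebra_simps)
    also have "exp (- (a * (y - z))) = e * exp (a * z)"
      by (simp add: e_def algebra_simps flip: exp_add)
    finally have "rem = - (d * e * (exp (a * z) - 1 - a * z - (a * z)\<^sup>2 / 2))"
      by (simp add: rem_def algebra_simps)
    then have "\<bar>rem\<bar> = d * e * \<bar>exp (a * z) - 1 - a * z - (a * z)\<^sup>2 / 2\<bar>"
      using d e by (simp only: abs_minus abs_mult abs_of_nonneg less_imp_le)
    also have "\<dots> \<le> d * e * (4 * \<bar>a * z\<bar> ^ 3 * max 1 (exp (a * z)))"
      using d e by (intro mult_left_mono exp_taylor3) auto
    also have "\<dots> = 4 * (d * a ^ 3) * \<bar>z\<bar> ^ 3 * (e * max 1 (exp (a * z)))"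
      using a by (simp add: abs_mult power_mult_distrib)
    also have "\<dots> \<le> 4 * 2 * \<bar>z\<bar> ^ 3 * 1"
    proof (intro mult_mono)
      have "max 1 (exp (a * z)) \<le> exp (a * y)" using True a y by simp
      then have "e * max 1 (exp (a * z)) \<le> e * exp (a * y)" using e by (intro mult_left_mono) auto
      then show "e * max 1 (exp (a * z)) \<le> 1" using e by simp
    qed (use d e a in \<open>auto intro!: mult_nonneg_nonneg\<close>)
    finally show ?thesis by (simp add: add_increasing2)
  next
    case False
    \<comment> \<open>The step is split into y, which reaches the old maximum, and x, which pushes
      the maximum up.\<close>
    define x where "x = z - y"
    have x: "x > 0" "z = y + x" using False by (auto simp: x_def)
    have G: "excursion_value lam (max s (b + z), b + z) = laplace_value (\<mu> + x)"
    proof -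
      have "max s (b + z) = b + z" "lam + (b + z) = \<mu> + x" using False by (auto simp: y_def x_def \<mu>_def)
      then show ?thesis by (simp add: excursion_value_def laplace_defect_def)
    qed
    define r1 where "r1 = laplace_value (\<mu> + x) - laplace_value \<mu> + a * d * x"
    have r1: "\<bar>r1\<bar> \<le> 5 * x\<^sup>2"
      unfolding r1_def a_def d_def using m x by (intro laplace_value_taylor) auto
    have lv: "laplace_value \<mu> = 1 / \<mu> - d" by (simp add: d_def laplace_defect_def)
    have ay: "a * y \<ge> 0" using a y by simp
    \<comment> \<open>Errors of the second- and first-order polynomials of exp (a * y), discounted
      by e. The first-order one is always multiplied by x, so together they are again of third
      order.\<close>
    define r2 where "r2 = e * (exp (a * y) - 1 - a * y - (a * y)\<^sup>2 / 2)"
    define r3 where "r3 = e * (exp (a * y) - 1 - a * y)"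
    have r2: "\<bar>r2\<bar> \<le> 4 * (a * y) ^ 3"
    proof -
      have "\<bar>r2\<bar> = e * \<bar>exp (a * y) - 1 - a * y - (a * y)\<^sup>2 / 2\<bar>"
        using e by (simp add: r2_def abs_mult)
      also have "\<dots> \<le> e * (4 * \<bar>a * y\<bar> ^ 3 * max 1 (exp (a * y)))"
        using e by (intro mult_left_mono exp_taylor3) auto
      also have "\<dots> = 4 * (a * y) ^ 3 * (e * exp (a * y))"
        using ay by (simp add: max_absorb2)
      finally show ?thesis using e by simp
    qed
    have r3: "\<bar>r3\<bar> \<le> (a * y)\<^sup>2"
    proof -
      have "\<bar>r3\<bar> = e * \<bar>exp (a * y) - 1 - a * y\<bar>"
        using e by (simp add: r3_def abs_mult)
      also have "\<dots> \<le> e * ((a * y)\<^sup>2 * exp \<bar>a * y\<bar>)"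
        using e by (intro mult_left_mono abs_exp_remainder_le) auto
      also have "\<dots> = (a * y)\<^sup>2 * (e * exp (a * y))"
        using ay by simp
      finally show ?thesis using e by simp
    qed
    have e2: "e * (1 + a * y + (a * y)\<^sup>2 / 2) = 1 - r2" and e3: "e * (1 + a * y) = 1 - r3"
      using e(2) by (simp_all add: r2_def r3_def algebra_simps)
    have "rem = r1 - d * r2 - d * a * x * r3 + d * e * a\<^sup>2 * x\<^sup>2 / 2"
    proof -
      have "d * e * (1 + a * z + (a * z)\<^sup>2 / 2) = d * (e * (1 + a * y + (a * y)\<^sup>2 / 2)) + d * a * x * (e * (1 + a * y)) + d * e * a\<^sup>2 * x\<^sup>2 / 2"
        by (simp add: x algebra_simps power2_eq_square)
      also have "\<dots> = d * (1 - r2) + d * a * x * (1 - r3) + d * e * a\<^sup>2 * x\<^sup>2 / 2"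
        unfolding e2 e3 ..
      finally show ?thesis
        by (simp add: rem_def G r1_def lv algebra_simps)
    qed
    then have "\<bar>rem\<bar> \<le> \<bar>r1\<bar> + \<bar>d * r2\<bar> + \<bar>d * a * x * r3\<bar> + \<bar>d * e * a\<^sup>2 * x\<^sup>2 / 2\<bar>"
      by linarith
    also have "\<bar>d * r2\<bar> \<le> 8 * y ^ 3"
    proof -
      have "\<bar>d * r2\<bar> \<le> d * (4 * (a * y) ^ 3)" unfolding abs_mult using d r2 by (simp add: mult_left_mono)
      also have "\<dots> = 4 * (d * a ^ 3) * y ^ 3" by (simp add: power_mult_distrib)
      also have "\<dots> \<le> 4 * 2 * y ^ 3" using d y a by (intro mult_mono) auto
      finally show ?thesis by simp
    qed
    also have "\<bar>d * a * x * r3\<bar> \<le> 2 * (y\<^sup>2 * x)"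
    proof -
      have "\<bar>d * a * x * r3\<bar> = d * a * x * \<bar>r3\<bar>" using d a x by (simp add: abs_mult)
      also have "\<dots> \<le> d * a * x * (a * y)\<^sup>2" using d a x r3 by (intro mult_left_mono) auto
      also have "\<dots> = (d * a ^ 3) * (y\<^sup>2 * x)" by (simp add: power_mult_distrib power2_eq_square power3_eq_cube)
      also have "\<dots> \<le> 2 * (y\<^sup>2 * x)" using d x by (intro mult_right_mono) auto
      finally show ?thesis .
    qed
    also have "\<bar>d * e * a\<^sup>2 * x\<^sup>2 / 2\<bar> \<le> x\<^sup>2"
    proof -
      have "e \<le> 1" using ay by (simp add: e_def)
      have "\<bar>d * e * a\<^sup>2 * x\<^sup>2 / 2\<bar> = (d * a\<^sup>2) * e * x\<^sup>2 / 2" using d e by (simp add: abs_mult)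
      also have "\<dots> \<le> 2 * 1 * x\<^sup>2 / 2"
        using d e \<open>e \<le> 1\<close> by (intro divide_right_mono mult_mono) auto
      finally show ?thesis by simp
    qed
    finally have "\<bar>rem\<bar> \<le> 6 * x\<^sup>2 + (8 * y ^ 3 + 2 * (y\<^sup>2 * x))" using r1 by linarith
    also have "8 * y ^ 3 + 2 * (y\<^sup>2 * x) \<le> 8 * z ^ 3"
    proof -
      have "8 * z ^ 3 - (8 * y ^ 3 + 2 * (y\<^sup>2 * x)) = 22 * (y\<^sup>2 * x) + 24 * (y * x\<^sup>2) + 8 * x ^ 3"
        by (simp add: x(2) power2_eq_square power3_eq_cube algebra_simps)
      moreover have "\<dots> \<ge> 0" using x y by (intro add_nonneg_nonneg mult_nonneg_nonneg) auto
      ultimately show ?thesis by linarith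
    qed
    finally have "\<bar>rem\<bar> \<le> 6 * x\<^sup>2 + 8 * z ^ 3" by simp
    moreover have "max 0 (z - y) = x" "\<bar>z\<bar> = z" using x y by auto
    ultimately show ?thesis using zero_le_power2[of x] by (simp only: distrib_left)
  qed
  moreover have "excursion_value lam (max s (b + z), b + z) - excursion_value lam (s, b)
      + sqrt (2 * \<mu>) * laplace_defect \<mu> * exp (- (sqrt (2 * \<mu>) * (s - b))) * z
      - (\<mu> * excursion_value lam (s, b) - 1) * z\<^sup>2 = rem"
    unfolding c2 unfolding F rem_def a_def[symmetric] d_def[symmetric] y_def[symmetric] e_def[symmetric]
    by (simp add: algebra_simps power2_eq_square)
  ultimately show ?thesis by (simp add: y_def)
qed

section \<open>Moments of a Gaussian step\<close>

lemma integrable_normal_power: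
  assumes "\<sigma> > 0"
  shows "integrable lborel (\<lambda>z. normal_density 0 \<sigma> z * z ^ k)"
  using integrable_normal_moment[OF assms, of 0 k] by simp

lemma integrable_normal_abs_cube:
  assumes "\<sigma> > 0"
  shows "integrable lborel (\<lambda>z. normal_density 0 \<sigma> z * \<bar>z\<bar> ^ 3)"
  using normal_moment_abs_odd[OF assms, of 0 1] by (simp add: has_bochner_integral_iff)

lemma normal_abs_cube_le:
  assumes s: "\<sigma> > 0"
  shows "(LINT z|lborel. normal_density 0 \<sigma> z * \<bar>z\<bar> ^ 3) \<le> 2 * \<sigma> ^ 3"
proof -
  have "sqrt (2 / pi) \<le> 1" using pi_gt3 by simp
  then have "2 * \<sigma> ^ 3 * sqrt (2 / pi) \<le> 2 * \<sigma> ^ 3 * 1" using s by (intro mult_left_mono) auto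
  then show ?thesis
    using integral_normal_moment_abs_odd[OF s, of 0 1] by (simp add: numeral_3_eq_3)
qed

lemma integrable_normal_bounded:
  assumes "\<sigma> > 0" "f \<in> borel_measurable borel" "\<And>z. \<bar>f z\<bar> \<le> (C::real)"
  shows "integrable lborel (\<lambda>z. normal_density 0 \<sigma> z * f z)"
proof (rule integrable_of_bound)
  show "integrable lborel (\<lambda>z. normal_density 0 \<sigma> z * C)"
    using integrable_normal_density[OF assms(1)] by (rule integrable_mult_left)
  show "\<bar>normal_density 0 \<sigma> z * f z\<bar> \<le> normal_density 0 \<sigma> z * C" for z
    using assms(3)[of z] by (simp add: abs_mult mult_left_mono)
qed (use assms(2) in measurable)

lemma integrable_normal_overshoot:
  assumes s: "\<sigma> > 0"
  shows "integrable lborel (\<lambda>z. normal_density 0 \<sigma> z * max 0 (z - y))"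
proof (rule integrable_of_bound)
  show "integrable lborel (\<lambda>z. normal_density 0 \<sigma> z * (1 + \<bar>y\<bar>) + normal_density 0 \<sigma> z * z ^ 2)"
    using integrable_normal_density[OF s] integrable_normal_power[OF s, of 2] by auto
  fix z :: real
  have "\<bar>z\<bar> \<le> 1 + z ^ 2" using sum_squares_bound[of "\<bar>z\<bar>" 1] by simp
  then have "max 0 (z - y) \<le> 1 + \<bar>y\<bar> + z ^ 2" by auto
  then have "normal_density 0 \<sigma> z * max 0 (z - y) \<le> normal_density 0 \<sigma> z * (1 + \<bar>y\<bar> + z ^ 2)"
    by (intro mult_left_mono) auto
  then show "\<bar>normal_density 0 \<sigma> z * max 0 (z - y)\<bar> \<le> normal_density 0 \<sigma> z * (1 + \<bar>y\<bar>) + normal_density 0 \<sigma> z * z ^ 2"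
    by (simp add: algebra_simps)
qed measurable

lemma normal_exp_moment:
  assumes s: "\<sigma> > 0"
  shows "has_bochner_integral lborel (\<lambda>z. normal_density 0 \<sigma> z * exp z) (exp (\<sigma>\<^sup>2 / 2))"
proof -
  have "has_bochner_integral lborel (\<lambda>z. exp (\<sigma>\<^sup>2 / 2) * normal_density (\<sigma>\<^sup>2) \<sigma> z) (exp (\<sigma>\<^sup>2 / 2) * 1)"
    using integrable_normal_density[OF s] integral_normal_density[OF s]
    by (intro has_bochner_integral_mult_right) (auto simp: has_bochner_integral_iff)
  moreover have "exp (\<sigma>\<^sup>2 / 2) * normal_density (\<sigma>\<^sup>2) \<sigma> z = normal_density 0 \<sigma> z * exp z" for z
  proof -
    have "\<sigma>\<^sup>2 / 2 + - (z - \<sigma>\<^sup>2)\<^sup>2 / (2 * \<sigma>\<^sup>2) = - (z - 0)\<^sup>2 / (2 * \<sigma>\<^sup>2) + z"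
      using s by (simp add: field_simps power2_eq_square)
    then have "exp (\<sigma>\<^sup>2 / 2) * exp (- (z - \<sigma>\<^sup>2)\<^sup>2 / (2 * \<sigma>\<^sup>2)) = exp (- (z - 0)\<^sup>2 / (2 * \<sigma>\<^sup>2)) * exp z"
      by (simp only: exp_add[symmetric])
    then show ?thesis by (simp add: normal_density_def)
  qed
  ultimately show ?thesis by simp
qed

section \<open>The walk operator and its comparison principle\<close>

text \<open>Arguments of \<open>v\<close> are pairs (running maximum, position), so only \<open>0 \<le> s\<close> and \<open>b \<le> s\<close> matter.\<close>

definition walk_step :: "real \<Rightarrow> real \<Rightarrow> (real \<times> real \<Rightarrow> real) \<Rightarrow> real \<times> real \<Rightarrow> real" where
  "walk_step h lam v = (\<lambda>p. exp (- (h * (lam + fst p))) *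
     (LINT z|lborel. normal_density 0 (sqrt h) z * v (max (fst p) (snd p + z), snd p + z)))"

definition admissible :: "(real \<times> real \<Rightarrow> real) \<Rightarrow> bool" where
  "admissible v \<longleftrightarrow> v \<in> borel_measurable (borel \<Otimes>\<^sub>M borel) \<and>
     (\<exists>C. \<forall>s b. 0 \<le> s \<longrightarrow> b \<le> s \<longrightarrow> \<bar>v (s, b)\<bar> \<le> C)"

lemma admissible_integrable:
  assumes v: "admissible v" and h: "h > 0" and s: "s \<ge> 0"
  shows "integrable lborel (\<lambda>z. normal_density 0 (sqrt h) z * v (max s (b + z), b + z))"
proof -
  have m: "v \<in> borel_measurable (borel \<Otimes>\<^sub>M borel)" using v by (simp add: admissible_def)
  obtain C where C: "\<And>s b. 0 \<le> s \<Longrightarrow> b \<le> s \<Longrightarrow> \<bar>v (s, b)\<bar> \<le> C"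
    using v by (auto simp: admissible_def)
  show ?thesis
  proof (rule integrable_normal_bounded)
    show "(\<lambda>z. v (max s (b + z), b + z)) \<in> borel_measurable borel"
      by (rule measurable_compose[OF _ m]) measurable
    show "\<bar>v (max s (b + z), b + z)\<bar> \<le> C" for z
      using s by (intro C) auto
  qed (use h in auto)
qed

lemma walk_step_bound:
  assumes v: "v \<in> borel_measurable (borel \<Otimes>\<^sub>M borel)" "\<And>s b. 0 \<le> s \<Longrightarrow> b \<le> s \<Longrightarrow> \<bar>v (s, b)\<bar> \<le> C"
    and h: "h > 0" and lam: "lam \<ge> 0" and s: "0 \<le> s" "b \<le> s"
  shows "\<bar>walk_step h lam v (s, b)\<bar> \<le> exp (- (h * lam)) * C"
proof -
  have a: "admissible v" using v by (auto simp: admissible_def)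
  have C: "C \<ge> 0" using v(2)[of 0 0] by simp
  have sh: "sqrt h > 0" using h by simp
  have "\<bar>LINT z|lborel. normal_density 0 (sqrt h) z * v (max s (b + z), b + z)\<bar>
      \<le> (LINT z|lborel. normal_density 0 (sqrt h) z * C)"
  proof (rule order_trans[OF integral_abs_bound integral_mono])
    show "\<bar>normal_density 0 (sqrt h) z * v (max s (b + z), b + z)\<bar> \<le> normal_density 0 (sqrt h) z * C" for z
      using s v(2)[of "max s (b + z)" "b + z"] by (auto simp: abs_mult intro!: mult_left_mono)
  qed (use admissible_integrable[OF a h s(1)] integrable_normal_density[OF sh] in auto)
  also have "\<dots> = C" using integral_normal_density[OF sh] by simp
  finally have 1: "\<bar>LINT z|lborel. normal_density 0 (sqrt h) z * v (max s (b + z), b + z)\<bar> \<le> C" .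
  have "\<bar>walk_step h lam v (s, b)\<bar> = exp (- (h * (lam + s))) * \<bar>LINT z|lborel. normal_density 0 (sqrt h) z * v (max s (b + z), b + z)\<bar>"
    by (simp add: walk_step_def abs_mult)
  also have "\<dots> \<le> exp (- (h * lam)) * C"
    using 1 C h s lam by (intro mult_mono) auto
  finally show ?thesis .
qed

lemma admissible_walk_step:
  assumes v: "admissible v" and h: "h > 0" and lam: "lam \<ge> 0"
  shows "admissible (walk_step h lam v)"
proof -
  have m[measurable]: "v \<in> borel_measurable (borel \<Otimes>\<^sub>M borel)" using v by (simp add: admissible_def)
  obtain C where C: "\<And>s b. 0 \<le> s \<Longrightarrow> b \<le> s \<Longrightarrow> \<bar>v (s, b)\<bar> \<le> C"
    using v by (auto simp: admissible_def)
  have "walk_step h lam v \<in> borel_measurable (borel \<Otimes>\<^sub>M borel)"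
    unfolding walk_step_def by measurable
  moreover have "\<bar>walk_step h lam v (s, b)\<bar> \<le> exp (- (h * lam)) * C" if "0 \<le> s" "b \<le> s" for s b
    by (rule walk_step_bound[OF m C h lam that])
  ultimately show ?thesis unfolding admissible_def by blast
qed

lemma admissible_const: "admissible (\<lambda>_. c)"
  by (auto simp: admissible_def)

lemma admissible_add: "admissible v \<Longrightarrow> admissible w \<Longrightarrow> admissible (\<lambda>p. v p + w p)"
  unfolding admissible_def
proof (elim conjE exE, intro conjI)
  fix C D assume "\<forall>s b. 0 \<le> s \<longrightarrow> b \<le> s \<longrightarrow> \<bar>v (s, b)\<bar> \<le> C" "\<forall>s b. 0 \<le> s \<longrightarrow> b \<le> s \<longrightarrow> \<bar>w (s, b)\<bar> \<le> D"
  then have "\<forall>s b. 0 \<le> s \<longrightarrow> b \<le> s \<longrightarrow> \<bar>v (s, b) + w (s, b)\<bar> \<le> C + D"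
    by (metis abs_triangle_ineq add_mono order_trans)
  then show "\<exists>C. \<forall>s b. 0 \<le> s \<longrightarrow> b \<le> s \<longrightarrow> \<bar>v (s, b) + w (s, b)\<bar> \<le> C" by blast
qed auto

lemma admissible_cmult: "admissible v \<Longrightarrow> admissible (\<lambda>p. c * v p)"
  unfolding admissible_def
proof (elim conjE exE, intro conjI)
  fix C assume "\<forall>s b. 0 \<le> s \<longrightarrow> b \<le> s \<longrightarrow> \<bar>v (s, b)\<bar> \<le> C"
  then have "\<forall>s b. 0 \<le> s \<longrightarrow> b \<le> s \<longrightarrow> \<bar>c * v (s, b)\<bar> \<le> \<bar>c\<bar> * C"
    by (simp add: abs_mult mult_left_mono)
  then show "\<exists>C. \<forall>s b. 0 \<le> s \<longrightarrow> b \<le> s \<longrightarrow> \<bar>c * v (s, b)\<bar> \<le> C" by blast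
qed auto

lemma walk_step_linear:
  assumes "admissible v" "admissible w" "h > 0" "s \<ge> 0"
  shows "walk_step h lam (\<lambda>p. v p + c * w p) (s, b) = walk_step h lam v (s, b) + c * walk_step h lam w (s, b)"
  using admissible_integrable[OF assms(1,3,4), of b] admissible_integrable[OF assms(2,3,4), of b]
  by (simp add: walk_step_def distrib_left mult.left_commute[of _ c])

lemma walk_step_mono:
  assumes v: "admissible v" and w: "admissible w" and h: "h > 0" and s: "s \<ge> 0"
    and le: "\<And>s b. 0 \<le> s \<Longrightarrow> b \<le> s \<Longrightarrow> v (s, b) \<le> w (s, b)"
  shows "walk_step h lam v (s, b) \<le> walk_step h lam w (s, b)"
proof -
  have "(LINT z|lborel. normal_density 0 (sqrt h) z * v (max s (b + z), b + z))
      \<le> (LINT z|lborel. normal_density 0 (sqrt h) z * w (max s (b + z), b + z))"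
    using s by (intro integral_mono admissible_integrable[OF v h s] admissible_integrable[OF w h s] mult_left_mono le) auto
  then show ?thesis by (simp add: walk_step_def)
qed

lemma admissible_funpow:
  assumes "admissible v" "h > 0" "lam \<ge> 0"
  shows "admissible ((walk_step h lam ^^ n) v)"
  by (induction n) (auto intro: assms admissible_walk_step)

lemma admissible_sum: "(\<And>i. i \<in> A \<Longrightarrow> admissible (f i)) \<Longrightarrow> admissible (\<lambda>p. \<Sum>i\<in>A. f i p)"
  by (induction A rule: infinite_finite_induct) (auto intro: admissible_const admissible_add)

lemma walk_step_sum:
  assumes "\<And>i. i < n \<Longrightarrow> admissible (f i)" "h > 0" "s \<ge> 0"
  shows "walk_step h lam (\<lambda>p. \<Sum>i<n. f i p) (s, b) = (\<Sum>i<(n::nat). walk_step h lam (f i) (s, b))"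
  using assms(1)
proof (induction n)
  case 0
  then show ?case by (simp add: walk_step_def)
next
  case (Suc n)
  have "walk_step h lam (\<lambda>p. (\<Sum>i<n. f i p) + 1 * f n p) (s, b)
     = walk_step h lam (\<lambda>p. \<Sum>i<n. f i p) (s, b) + 1 * walk_step h lam (f n) (s, b)"
    using Suc.prems assms by (intro walk_step_linear admissible_sum) auto
  then show ?case using Suc by simp
qed

text \<open>A discrete maximum principle, by induction from monotonicity and linearity of
  \<open>walk_step\<close>. The sum is the expected discounted number of steps. A negative
  \<open>a\<close> is possible, and applied to - F this gives the lower bound in
  \<open>walk_resolvent\<close>.\<close>

lemma walk_supersolution:
  assumes V: "admissible V" and h: "h > 0" and lam: "lam \<ge> 0"
    and super: "\<And>s b. 0 \<le> s \<Longrightarrow> b \<le> s \<Longrightarrow> walk_step h lam V (s, b) + a \<le> V (s, b)"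
    and s: "0 \<le> s" "b \<le> s"
  shows "(walk_step h lam ^^ n) V (s, b) + a * (\<Sum>k<n. (walk_step h lam ^^ k) (\<lambda>_. 1) (s, b)) \<le> V (s, b)"
  using s
proof (induction n arbitrary: s b)
  case (Suc n)
  define T where "T = walk_step h lam"
  define S where "S = (\<lambda>p. \<Sum>k<n. (T ^^ k) (\<lambda>_. 1) p)"
  have aV: "admissible ((T ^^ n) V)" and aS: "admissible S"
    unfolding T_def S_def using V h lam by (auto intro!: admissible_sum admissible_funpow admissible_const)
  have "T (\<lambda>p. (T ^^ n) V p + a * S p) (s, b) \<le> T V (s, b)"
    unfolding T_def
  proof (rule walk_step_mono)
    show "admissible (\<lambda>p. (walk_step h lam ^^ n) V p + a * S p)"
      using aV aS unfolding T_def by (intro admissible_add admissible_cmult)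
    show "(walk_step h lam ^^ n) V (s, b) + a * S (s, b) \<le> V (s, b)" if "0 \<le> s" "b \<le> s" for s b
      using Suc.IH[OF that] by (simp add: S_def T_def)
  qed (use V h Suc.prems in auto)
  also have "T (\<lambda>p. (T ^^ n) V p + a * S p) (s, b) = (T ^^ Suc n) V (s, b) + a * T S (s, b)"
    using walk_step_linear[OF aV aS h Suc.prems(1)] by (simp add: T_def)
  also have "T S (s, b) = (\<Sum>k<n. (T ^^ Suc k) (\<lambda>_. 1) (s, b))"
    unfolding S_def T_def using h lam Suc.prems
    by (subst walk_step_sum) (auto intro!: admissible_funpow admissible_const)
  finally have "(T ^^ Suc n) V (s, b) + a * (\<Sum>k<n. (T ^^ Suc k) (\<lambda>_. 1) (s, b)) + a \<le> V (s, b)"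
    using super[OF Suc.prems] unfolding T_def by linarith
  then show ?case
    unfolding sum.lessThan_Suc_shift by (simp add: T_def algebra_simps)
qed auto

lemma walk_funpow_bound:
  assumes v: "v \<in> borel_measurable (borel \<Otimes>\<^sub>M borel)" "\<And>s b. 0 \<le> s \<Longrightarrow> b \<le> s \<Longrightarrow> \<bar>v (s, b)\<bar> \<le> C"
    and h: "h > 0" and lam: "lam \<ge> 0" and s: "0 \<le> s" "b \<le> s"
  shows "\<bar>(walk_step h lam ^^ n) v (s, b)\<bar> \<le> exp (- (h * lam)) ^ n * C"
  using s
proof (induction n arbitrary: s b)
  case (Suc n)
  have a: "admissible v" using v by (auto simp: admissible_def)
  then have "(walk_step h lam ^^ n) v \<in> borel_measurable (borel \<Otimes>\<^sub>M borel)"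
    using admissible_funpow[OF a h lam, of n] by (simp add: admissible_def)
  from walk_step_bound[OF this Suc.IH h lam Suc.prems] show ?case by (simp add: mult.assoc)
qed (use v in auto)

text \<open>The constant part of the killing rate factors out of every step, so summing over the
  number of steps is a discrete Laplace transform in lam of the walk killed at the rate of its
  maximum alone.\<close>

lemma walk_funpow_discount:
  assumes "h > 0"
  shows "(walk_step h lam ^^ n) v p = exp (- (h * lam)) ^ n * (walk_step h 0 ^^ n) v p"
proof (induction n arbitrary: p)
  case (Suc n)
  have "(walk_step h lam ^^ Suc n) v p = walk_step h lam (\<lambda>p. exp (- (h * lam)) ^ n * (walk_step h 0 ^^ n) v p) p"
    by (simp add: Suc[abs_def])
  also have "\<dots> = exp (- (h * lam)) ^ n * walk_step h lam ((walk_step h 0 ^^ n) v) p"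
    by (simp add: walk_step_def mult.left_commute[of _ "exp (- (h * lam)) ^ n"])
  also have "walk_step h lam ((walk_step h 0 ^^ n) v) p = exp (- (h * lam)) * walk_step h 0 ((walk_step h 0 ^^ n) v) p"
  proof -
    have "exp (- (h * (lam + fst p))) = exp (- (h * lam)) * exp (- (h * (0 + fst p)))"
      by (simp add: distrib_left flip: exp_add)
    then show ?thesis by (simp only: walk_step_def mult.assoc)
  qed
  finally show ?case by simp
qed simp

lemma excursion_value_measurable: "excursion_value lam \<in> borel_measurable (borel \<Otimes>\<^sub>M borel)"
proof -
  have "continuous_on UNIV (\<lambda>x::real. ode_sol (sqrt x) :: real)"
    by (rule continuous_on_compose2[OF continuous_on_ode_sol[of UNIV]]) (auto intro!: continuous_intros)
  then have [measurable]: "laplace_value \<in> borel_measurable borel"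
    unfolding laplace_value_def [abs_def] by (rule borel_measurable_continuous_onI)
  have [measurable]: "laplace_defect \<in> borel_measurable borel"
    unfolding laplace_defect_def [abs_def] by measurable
  show ?thesis unfolding excursion_value_def by measurable
qed

lemma excursion_value_abs_le:
  assumes "lam \<ge> 1" "s \<ge> 0" "b \<le> s"
  shows "\<bar>excursion_value lam (s, b)\<bar> \<le> 1"
proof -
  have "1 / (lam + s) \<le> 1" using assms by simp
  moreover have "lam + s \<ge> 1" using assms by simp
  ultimately show ?thesis using excursion_value_bounds[of lam s b] assms(3) by linarith
qed

lemma admissible_excursion_value: "lam \<ge> 1 \<Longrightarrow> admissible (excursion_value lam)"
  unfolding admissible_def using excursion_value_measurable excursion_value_abs_le by blast

section \<open>One-step estimates and the barrier\<close>

text \<open>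
  A Gaussian step of variance \<open>\<delta> ^ 4\<close> that passes the running maximum causes an error quadratic in
  the overshoot. Splitting at the scale \<open>\<delta>\<close> leaves a linear overshoot, which \<open>barrier\<close> absorbs,
  and a cubic moment, which is \<open>o(\<delta> ^ 4)\<close>.
\<close>

lemma overshoot_square_le:
  fixes x z \<delta> :: real
  assumes "\<delta> > 0" "y \<ge> 0"
  shows "(max 0 (z - y))\<^sup>2 \<le> \<delta> * max 0 (z - y) + \<bar>z\<bar> ^ 3 / \<delta>"
proof -
  define x where "x = max 0 (z - y)"
  have x: "0 \<le> x" "x \<le> \<bar>z\<bar>" using assms by (auto simp: x_def)
  have "x\<^sup>2 \<le> \<delta> * x + \<bar>z\<bar> ^ 3 / \<delta>"
  proof (cases "x \<le> \<delta>")
    case True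
    then have "x\<^sup>2 \<le> \<delta> * x" using x by (simp add: power2_eq_square mult_right_mono)
    then show ?thesis using assms by (simp add: add_increasing2)
  next
    case False
    then have "x\<^sup>2 * \<delta> \<le> x\<^sup>2 * x" by (intro mult_left_mono) auto
    also have "\<dots> = x ^ 3" by (simp add: power2_eq_square power3_eq_cube)
    also have "\<dots> \<le> \<bar>z\<bar> ^ 3" using x by (intro power_mono) auto
    finally have "x\<^sup>2 \<le> \<bar>z\<bar> ^ 3 / \<delta>" using assms by (simp add: pos_le_divide_eq)
    then show ?thesis using assms x by (simp add: add_increasing)
  qed
  then show ?thesis by (simp add: x_def)
qed

text \<open>With x = h * mu both bounds rest on (1 - x) <= exp (- x) <= 1 / (1 + x). The error h *
  (1 - kappa) is kept in this form because mu contains the unbounded running maximum, so x need not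
  be small; the constant part of \<open>barrier\<close> offsets exactly this term.\<close>

lemma discount_bounds:
  fixes x F \<mu> h :: real
  assumes h: "h > 0" and m: "\<mu> > 0" and F: "0 \<le> F" "F \<le> 1 / \<mu>"
  defines "\<kappa> \<equiv> exp (- (h * \<mu>))"
  shows "\<kappa> * (F + (\<mu> * F - 1) * h) \<le> F - h + h * (1 - \<kappa>)"
    and "\<kappa> * (F + (\<mu> * F - 1) * h) \<ge> F - h"
proof -
  define x where "x = h * \<mu>"
  have x: "x > 0" using h m by (simp add: x_def)
  have k: "0 < \<kappa>" "\<kappa> \<le> 1" using h m by (auto simp: \<kappa>_def)
  have e: "\<kappa> * exp x = 1" by (simp add: \<kappa>_def x_def flip: exp_add)
  have "1 + x \<le> exp x" by (rule exp_ge_add_one_self)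
  then have "\<kappa> * (1 + x) \<le> \<kappa> * exp x" using k by (intro mult_left_mono) auto
  then have k1: "\<kappa> * (1 + x) \<le> 1" using e by simp
  have k2: "1 - \<kappa> \<le> x" using exp_ge_add_one_self[of "- x"] by (simp add: \<kappa>_def x_def)
  have eq: "\<kappa> * (F + (\<mu> * F - 1) * h) = F * (\<kappa> * (1 + x)) - h * \<kappa>"
    by (simp add: x_def algebra_simps)
  have "F * (\<kappa> * (1 + x)) \<le> F * 1" using k1 F by (intro mult_left_mono) auto
  then show "\<kappa> * (F + (\<mu> * F - 1) * h) \<le> F - h + h * (1 - \<kappa>)"
    unfolding eq by (simp add: algebra_simps)
  have "F * (1 - \<kappa> * (1 + x)) \<le> (1 / \<mu>) * (1 - \<kappa> * (1 + x))"
    using F k1 by (intro mult_right_mono) auto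
  also have "\<dots> \<le> (1 / \<mu>) * (x * (1 - \<kappa>))"
    using m k2 by (intro mult_left_mono) (auto simp: algebra_simps)
  also have "\<dots> = h * (1 - \<kappa>)" using m by (simp add: x_def)
  finally show "\<kappa> * (F + (\<mu> * F - 1) * h) \<ge> F - h"
    unfolding eq by (simp add: algebra_simps)
qed

definition overshoot :: "real \<Rightarrow> real \<Rightarrow> real" where
  "overshoot \<sigma> y = (LINT z|lborel. normal_density 0 \<sigma> z * max 0 (z - y))"

text \<open>Integration of \<open>excursion_value_taylor\<close> over the step: the linear term
  vanishes by symmetry, the quadratic one contributes the variance h, and the discount then yields
  the decrement h of elapsed time.\<close>

lemma excursion_value_step:
  assumes d: "0 < \<delta>" "\<delta> \<le> 1" and lam: "lam \<ge> 1" and s: "0 \<le> s" "b \<le> s"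
  defines "h \<equiv> \<delta> ^ 4" and "\<kappa> \<equiv> exp (- (\<delta> ^ 4 * (lam + s)))"
  shows "walk_step h lam (excursion_value lam) (s, b) \<le> excursion_value lam (s, b) - h + h * (1 - \<kappa>)
      + \<kappa> * (32 * \<delta> ^ 5 + 8 * \<delta> * overshoot (\<delta>\<^sup>2) (s - b))"
    and "walk_step h lam (excursion_value lam) (s, b) \<ge> excursion_value lam (s, b) - h
      - \<kappa> * (32 * \<delta> ^ 5 + 8 * \<delta> * overshoot (\<delta>\<^sup>2) (s - b))"
proof -
  define F where "F = excursion_value lam (s, b)"
  define \<mu> where "\<mu> = lam + s"
  define \<sigma> where "\<sigma> = \<delta>\<^sup>2"
  define A where "A = sqrt (2 * \<mu>) * laplace_defect \<mu> * exp (- (sqrt (2 * \<mu>) * (s - b)))"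
  define \<psi> where "\<psi> = (\<lambda>z. excursion_value lam (max s (b + z), b + z))"
  have h0: "h > 0" and sg: "\<sigma> > 0" "sqrt h = \<sigma>" "\<sigma>\<^sup>2 = h"
    using d by (auto simp: h_def \<sigma>_def real_sqrt_eq_iff power_mult[symmetric] intro: real_sqrt_unique)
  have m: "\<mu> \<ge> 1" using lam s by (simp add: \<mu>_def)
  let ?n = "normal_density 0 \<sigma>"
  have i\<psi>: "integrable lborel (\<lambda>z. ?n z * \<psi> z)"
    using admissible_integrable[OF admissible_excursion_value[OF lam] h0 s(1), of b] by (simp add: sg \<psi>_def)
  note i0 = integrable_normal_density[OF sg(1)] 
  have i1: "integrable lborel (\<lambda>z. ?n z * z)" using integrable_normal_power[OF sg(1), of 1] by simp
  note i2 = integrable_normal_power[OF sg(1), of 2] and i3 = integrable_normal_abs_cube[OF sg(1)]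
    and io = integrable_normal_overshoot[OF sg(1), of "s - b"]
  have v0: "(LINT z|lborel. ?n z) = 1" using integral_normal_density[OF sg(1)] .
  have v1: "(LINT z|lborel. ?n z * z) = 0" using integral_normal_moment_nz_1[OF sg(1), of 0] .
  have v2: "(LINT z|lborel. ?n z * z ^ 2) = h"
    using integral_normal_moment_even[OF sg(1), of 0 1] sg by simp
  define rem where "rem = (\<lambda>z. ?n z * (\<psi> z - F + A * z - (\<mu> * F - 1) * z\<^sup>2))"
  have rem_eq: "rem = (\<lambda>z. ?n z * \<psi> z - ?n z * F + A * (?n z * z) - (\<mu> * F - 1) * (?n z * z ^ 2))"
    by (simp add: rem_def algebra_simps fun_eq_iff)
  have irem: "integrable lborel rem"
    unfolding rem_eq using i\<psi> i0 i1 i2 by auto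
  have vrem: "(LINT z|lborel. rem z) = (LINT z|lborel. ?n z * \<psi> z) - (F + (\<mu> * F - 1) * h)"
    unfolding rem_eq using i\<psi> i0 i1 i2 v0 v1 v2 by simp
  have "\<bar>LINT z|lborel. rem z\<bar> \<le> (LINT z|lborel. \<bar>rem z\<bar>)" by (rule integral_abs_bound)
  also have "\<dots> \<le> (LINT z|lborel. (8 + 8 / \<delta>) * (?n z * \<bar>z\<bar> ^ 3) + 8 * \<delta> * (?n z * max 0 (z - (s - b))))"
  proof (rule integral_mono)
    show "integrable lborel (\<lambda>z. \<bar>rem z\<bar>)" using irem by (rule integrable_abs)
    show "integrable lborel (\<lambda>z. (8 + 8 / \<delta>) * (?n z * \<bar>z\<bar> ^ 3) + 8 * \<delta> * (?n z * max 0 (z - (s - b))))"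
      using i3 io by auto
    fix z :: real
    have "\<bar>\<psi> z - F + A * z - (\<mu> * F - 1) * z\<^sup>2\<bar> \<le> 8 * (\<bar>z\<bar> ^ 3 + (max 0 (z - (s - b)))\<^sup>2)"
      using excursion_value_taylor[of lam s b z] m s by (simp add: \<psi>_def F_def A_def \<mu>_def)
    also have "\<dots> \<le> 8 * (\<bar>z\<bar> ^ 3 + (\<delta> * max 0 (z - (s - b)) + \<bar>z\<bar> ^ 3 / \<delta>))"
      using overshoot_square_le[of \<delta> "s - b" z] d s by simp
    finally have "\<bar>\<psi> z - F + A * z - (\<mu> * F - 1) * z\<^sup>2\<bar> \<le> (8 + 8 / \<delta>) * \<bar>z\<bar> ^ 3 + 8 * \<delta> * max 0 (z - (s - b))"
      by (simp add: algebra_simps)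
    then have "?n z * \<bar>\<psi> z - F + A * z - (\<mu> * F - 1) * z\<^sup>2\<bar> \<le> ?n z * ((8 + 8 / \<delta>) * \<bar>z\<bar> ^ 3 + 8 * \<delta> * max 0 (z - (s - b)))"
      by (intro mult_left_mono) auto
    moreover have "\<bar>rem z\<bar> = ?n z * \<bar>\<psi> z - F + A * z - (\<mu> * F - 1) * z\<^sup>2\<bar>"
      by (simp add: rem_def abs_mult)
    ultimately show "\<bar>rem z\<bar> \<le> (8 + 8 / \<delta>) * (?n z * \<bar>z\<bar> ^ 3) + 8 * \<delta> * (?n z * max 0 (z - (s - b)))"
      by (simp only: distrib_left mult_ac)
  qed
  also have "\<dots> = (8 + 8 / \<delta>) * (LINT z|lborel. ?n z * \<bar>z\<bar> ^ 3) + 8 * \<delta> * overshoot \<sigma> (s - b)"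
    using i3 io by (simp add: overshoot_def)
  \<comment> \<open>For delta <= 1 the cubic coefficient is at most 16 / delta, and the third
    absolute moment is at most 2 * delta^6. This gives 32 * delta^5, which is small compared with h
    = delta^4.\<close>
  also have "\<dots> \<le> (16 / \<delta>) * (2 * \<sigma> ^ 3) + 8 * \<delta> * overshoot \<sigma> (s - b)"
  proof (intro add_right_mono mult_mono normal_abs_cube_le sg(1))
    show "8 + 8 / \<delta> \<le> 16 / \<delta>" using d by (simp add: field_simps)
    show "0 \<le> (LINT z|lborel. ?n z * \<bar>z\<bar> ^ 3)" by (intro integral_nonneg_AE) auto
  qed (use d in auto)
  also have "(16 / \<delta>) * (2 * \<sigma> ^ 3) = 32 * \<delta> ^ 5"
    using d by (simp add: \<sigma>_def field_simps eval_nat_numeral)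
  finally have R: "\<bar>(LINT z|lborel. ?n z * \<psi> z) - (F + (\<mu> * F - 1) * h)\<bar> \<le> 32 * \<delta> ^ 5 + 8 * \<delta> * overshoot \<sigma> (s - b)"
    unfolding vrem .
  have k: "\<kappa> > 0" "\<kappa> = exp (- (h * \<mu>))" by (simp_all add: \<kappa>_def h_def \<mu>_def)
  have step: "walk_step h lam (excursion_value lam) (s, b) = \<kappa> * (LINT z|lborel. ?n z * \<psi> z)"
    by (simp add: walk_step_def k sg \<psi>_def \<mu>_def)
  have FB: "0 \<le> F" "F \<le> 1 / \<mu>"
    using excursion_value_bounds[of lam s b] m s by (auto simp: F_def \<mu>_def)
  have m0: "\<mu> > 0" using m by simp
  note db = discount_bounds[OF h0 m0 FB, folded k(2)]
  define err where "err = 32 * \<delta> ^ 5 + 8 * \<delta> * overshoot \<sigma> (s - b)"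
  have "\<kappa> * (LINT z|lborel. ?n z * \<psi> z) \<le> \<kappa> * ((F + (\<mu> * F - 1) * h) + err)"
    using R k by (intro mult_left_mono) (auto simp: err_def abs_le_iff)
  then show "walk_step h lam (excursion_value lam) (s, b) \<le> excursion_value lam (s, b) - h + h * (1 - \<kappa>)
      + \<kappa> * (32 * \<delta> ^ 5 + 8 * \<delta> * overshoot (\<delta>\<^sup>2) (s - b))"
    using db(1) unfolding step F_def[symmetric] \<sigma>_def[symmetric] err_def[symmetric] distrib_left[of \<kappa> _ err] by linarith
  have "\<kappa> * ((F + (\<mu> * F - 1) * h) - err) \<le> \<kappa> * (LINT z|lborel. ?n z * \<psi> z)"
    using R k by (intro mult_left_mono) (auto simp: err_def abs_le_iff)
  then show "walk_step h lam (excursion_value lam) (s, b) \<ge> excursion_value lam (s, b) - h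
      - \<kappa> * (32 * \<delta> ^ 5 + 8 * \<delta> * overshoot (\<delta>\<^sup>2) (s - b))"
    using db(2) unfolding step F_def[symmetric] \<sigma>_def[symmetric] err_def[symmetric] right_diff_distrib[of \<kappa> _ err] by linarith
qed

text \<open>
  Reflection at the running maximum makes \<open>exp (b - s)\<close> lose the expected overshoot in every step;
  the killing makes the constant \<open>\<delta> ^ 4\<close> lose the error of replacing \<open>1 - h * \<mu>\<close> by \<open>exp (- h * \<mu>)\<close>.
\<close>

definition barrier :: "real \<Rightarrow> real \<times> real \<Rightarrow> real" where
  "barrier \<delta> = (\<lambda>p. 8 * \<delta> * exp (snd p - fst p) + \<delta> ^ 4)"

lemma barrier_bounds:
  assumes "0 < \<delta>" "b \<le> s"
  shows "0 \<le> barrier \<delta> (s, b)" "barrier \<delta> (s, b) \<le> 8 * \<delta> + \<delta> ^ 4"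
proof -
  have "8 * \<delta> * exp (b - s) \<le> 8 * \<delta> * 1" using assms by (intro mult_left_mono) auto
  then show "barrier \<delta> (s, b) \<le> 8 * \<delta> + \<delta> ^ 4" by (simp add: barrier_def)
  show "0 \<le> barrier \<delta> (s, b)" using assms by (simp add: barrier_def)
qed

lemma barrier_measurable: "barrier \<delta> \<in> borel_measurable (borel \<Otimes>\<^sub>M borel)"
  unfolding barrier_def by measurable

lemma admissible_barrier: "0 < \<delta> \<Longrightarrow> admissible (barrier \<delta>)"
  unfolding admissible_def using barrier_measurable barrier_bounds by (metis abs_of_nonneg)

lemma barrier_step:
  assumes d: "0 < \<delta>" "\<delta> \<le> 1" and lam: "lam \<ge> 1" and s: "0 \<le> s" "b \<le> s"
  defines "h \<equiv> \<delta> ^ 4" and "\<kappa> \<equiv> exp (- (\<delta> ^ 4 * (lam + s)))"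
  shows "walk_step h lam (barrier \<delta>) (s, b) \<le> barrier \<delta> (s, b) - h * (1 - \<kappa>) - \<kappa> * (8 * \<delta> * overshoot (\<delta>\<^sup>2) (s - b))"
proof -
  define \<sigma> where "\<sigma> = \<delta>\<^sup>2"
  have h0: "h > 0" and sg: "\<sigma> > 0" "sqrt h = \<sigma>" "\<sigma>\<^sup>2 = h"
    using d by (auto simp: h_def \<sigma>_def real_sqrt_eq_iff power_mult[symmetric] intro: real_sqrt_unique)
  let ?n = "normal_density 0 \<sigma>"
  have ib: "integrable lborel (\<lambda>z. ?n z * barrier \<delta> (max s (b + z), b + z))"
    using admissible_integrable[OF admissible_barrier h0 s(1), of \<delta> b] d by (simp add: sg)
  note i0 = integrable_normal_density[OF sg(1), of 0]
  note io = integrable_normal_overshoot[OF sg(1), of "s - b"]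
  note ie = normal_exp_moment[OF sg(1)]
  have k: "\<kappa> > 0" by (simp add: \<kappa>_def)
  have "(LINT z|lborel. ?n z * barrier \<delta> (max s (b + z), b + z))
      \<le> (LINT z|lborel. 8 * \<delta> * exp (b - s) * (?n z * exp z) - 8 * \<delta> * (?n z * max 0 (z - (s - b))) + ?n z * \<delta> ^ 4)"
  proof (rule integral_mono[OF ib])
    show "integrable lborel (\<lambda>z. 8 * \<delta> * exp (b - s) * (?n z * exp z) - 8 * \<delta> * (?n z * max 0 (z - (s - b))) + ?n z * \<delta> ^ 4)"
      using i0 io ie by (auto simp: has_bochner_integral_iff)
    fix z
    define u where "u = z - (s - b)"
    \<comment> \<open>Reflection replaces exp u by 1 when u > 0. Since exp u >= 1 + u, the loss is
      at least the overshoot u.\<close>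
    have "exp ((b + z) - max s (b + z)) \<le> exp u - max 0 u"
    proof (cases "u \<le> 0")
      case True
      then show ?thesis by (simp add: u_def max_def)
    next
      case False
      then have "exp ((b + z) - max s (b + z)) = 1" by (simp add: u_def max_def)
      moreover have "max 0 u = u" using False by simp
      ultimately show ?thesis using exp_ge_add_one_self[of u] by linarith
    qed
    also have "exp u = exp (b - s) * exp z" by (simp add: u_def algebra_simps flip: exp_add)
    finally have "?n z * (8 * \<delta> * exp ((b + z) - max s (b + z)) + \<delta> ^ 4) \<le> ?n z * (8 * \<delta> * (exp (b - s) * exp z - max 0 u) + \<delta> ^ 4)"
      using d by (intro mult_left_mono add_right_mono) auto
    then show "?n z * barrier \<delta> (max s (b + z), b + z) \<le> 8 * \<delta> * exp (b - s) * (?n z * exp z) - 8 * \<delta> * (?n z * max 0 (z - (s - b))) + ?n z * \<delta> ^ 4"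
      by (simp add: barrier_def u_def algebra_simps)
  qed
  also have "\<dots> = 8 * \<delta> * exp (b - s) * exp (h / 2) - 8 * \<delta> * overshoot \<sigma> (s - b) + \<delta> ^ 4"
    using i0 io ie integral_normal_density[OF sg(1)] by (simp add: has_bochner_integral_iff overshoot_def sg)
  finally have le: "(LINT z|lborel. ?n z * barrier \<delta> (max s (b + z), b + z))
      \<le> 8 * \<delta> * exp (b - s) * exp (h / 2) - 8 * \<delta> * overshoot \<sigma> (s - b) + \<delta> ^ 4" .
  have "walk_step h lam (barrier \<delta>) (s, b) = \<kappa> * (LINT z|lborel. ?n z * barrier \<delta> (max s (b + z), b + z))"
    by (simp add: walk_step_def sg \<kappa>_def flip: h_def)
  also have "\<dots> \<le> \<kappa> * (8 * \<delta> * exp (b - s) * exp (h / 2) - 8 * \<delta> * overshoot \<sigma> (s - b) + \<delta> ^ 4)"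
    using k le by (intro mult_left_mono) auto
  also have "\<dots> = 8 * \<delta> * exp (b - s) * (\<kappa> * exp (h / 2)) - \<kappa> * (8 * \<delta> * overshoot \<sigma> (s - b)) + \<kappa> * h"
    by (simp add: h_def algebra_simps)
  also have "\<dots> \<le> 8 * \<delta> * exp (b - s) * 1 - \<kappa> * (8 * \<delta> * overshoot \<sigma> (s - b)) + \<kappa> * h"
  proof (intro add_right_mono diff_right_mono mult_left_mono)
    \<comment> \<open>The factor exp (h/2) is the exponential moment of the step; killing at rate at
      least 1 outweighs it.\<close>
    have "h * 1 \<le> h * (lam + s)" using h0 lam s by (intro mult_left_mono) auto
    then have "- (\<delta> ^ 4 * (lam + s)) + h / 2 \<le> 0" using h0 by (simp add: h_def)
    then show "\<kappa> * exp (h / 2) \<le> 1" unfolding \<kappa>_def exp_add[symmetric] by simp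
  qed (use d in auto)
  also have "\<dots> = barrier \<delta> (s, b) - h * (1 - \<kappa>) - \<kappa> * (8 * \<delta> * overshoot \<sigma> (s - b))"
    by (simp add: barrier_def h_def algebra_simps)
  finally show ?thesis by (simp add: \<sigma>_def)
qed

text \<open>Both F + barrier and - F + barrier are supersolutions, with increments h and - h up to
  32 * delta^5. Evaluated at (0, 0), where F is \<open>laplace_value lam\<close>, they enclose h
  times the discounted sum.\<close>

lemma walk_resolvent:
  assumes d: "0 < \<delta>" "\<delta> \<le> 1" and lam: "lam \<ge> 1"
  shows "\<bar>\<delta> ^ 4 * (\<Sum>k. exp (- (\<delta> ^ 4 * lam)) ^ k * (walk_step (\<delta> ^ 4) 0 ^^ k) (\<lambda>_. 1) (0, 0)) - laplace_value lam\<bar>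
    \<le> 9 * \<delta> + 32 * \<delta> * (\<delta> ^ 4 * (\<Sum>k. exp (- (\<delta> ^ 4 * lam)) ^ k))"
proof -
  define h where "h = \<delta> ^ 4"
  have h: "h > 0" "h \<le> \<delta>" "h = \<delta> ^ 4" using d power_decreasing[of 1 4 \<delta>] by (auto simp: h_def)
  define q where "q = exp (- (h * lam))"
  have q: "0 < q" "q < 1" using h lam by (auto simp: q_def)
  define T where "T = walk_step h lam"
  define c where "c = (\<lambda>k. (T ^^ k) (\<lambda>_. 1) (0, 0))"
  have l0: "lam \<ge> 0" using lam by simp
  have c_eq: "c k = q ^ k * (walk_step h 0 ^^ k) (\<lambda>_. 1) (0, 0)" for k
    unfolding c_def T_def q_def by (rule walk_funpow_discount[OF h(1)])
  have c_le: "\<bar>c k\<bar> \<le> q ^ k" for k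
    using walk_funpow_bound[of "\<lambda>_. 1" 1 h lam 0 0 k] h l0 by (simp add: c_def T_def q_def)
  have sq: "summable (\<lambda>k. q ^ k)" using q by (intro summable_geometric) auto
  have sc: "summable c"
    by (rule summable_comparison_test'[OF sq]) (use c_le in auto)
  let ?F = "excursion_value lam" and ?W = "barrier \<delta>"
  note aF = admissible_excursion_value[OF lam] and aW = admissible_barrier[OF d(1)]
  have F0: "?F (0, 0) = laplace_value lam"
    by (simp add: excursion_value_def laplace_defect_def)
  have W0: "\<bar>?W (0, 0)\<bar> \<le> 9 * \<delta>" 
  proof -
    have "?W (0, 0) = 8 * \<delta> + h" by (simp add: barrier_def h_def)
    then show ?thesis using h d by linarith
  qed
  have key: "a * suminf c \<le> V (0, 0)"
    if V: "admissible V" "\<And>s b. 0 \<le> s \<Longrightarrow> b \<le> s \<Longrightarrow> T V (s, b) + a \<le> V (s, b)" for V a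
  proof -
    obtain C where C: "\<And>s b. 0 \<le> s \<Longrightarrow> b \<le> s \<Longrightarrow> \<bar>V (s, b)\<bar> \<le> C"
      using V(1) by (auto simp: admissible_def)
    have mV: "V \<in> borel_measurable (borel \<Otimes>\<^sub>M borel)" using V(1) by (simp add: admissible_def)
    \<comment> \<open>The term left over after n steps is discounted by q^n and disappears in the
      limit.\<close>
    have "- (q ^ n * C) + a * (\<Sum>k<n. c k) \<le> V (0, 0)" for n
    proof -
      have "(T ^^ n) V (0, 0) + a * (\<Sum>k<n. c k) \<le> V (0, 0)"
        using walk_supersolution[OF V(1) h(1) l0, of a 0 0 n] V(2) by (simp add: T_def c_def)
      moreover have "\<bar>(T ^^ n) V (0, 0)\<bar> \<le> q ^ n * C"
        using walk_funpow_bound[OF mV C h(1) l0, of 0 0 n] by (simp add: T_def q_def)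
      ultimately show ?thesis by linarith
    qed
    moreover have "(\<lambda>n. - (q ^ n * C) + a * (\<Sum>k<n. c k)) \<longlonglongrightarrow> - (0 * C) + a * suminf c"
      using q sc by (intro tendsto_intros summable_LIMSEQ LIMSEQ_power_zero) auto
    ultimately show ?thesis
      by (intro LIMSEQ_le_const2[where X = "\<lambda>n. - (q ^ n * C) + a * (\<Sum>k<n. c k)"]) auto
  qed
  have up: "(h - 32 * \<delta> ^ 5) * suminf c \<le> ?F (0, 0) + 1 * ?W (0, 0)"
  proof (rule key)
    show "admissible (\<lambda>p. ?F p + 1 * ?W p)" by (intro admissible_add admissible_cmult aF aW)
    fix s b :: real assume s: "0 \<le> s" "b \<le> s"
    have "T (\<lambda>p. ?F p + 1 * ?W p) (s, b) = T ?F (s, b) + 1 * T ?W (s, b)"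
      unfolding T_def by (rule walk_step_linear[OF aF aW h(1) s(1)])
    moreover have "exp (- (\<delta> ^ 4 * (lam + s))) * (32 * \<delta> ^ 5) \<le> 1 * (32 * \<delta> ^ 5)"
      using d lam s by (intro mult_right_mono) auto
    ultimately show "T (\<lambda>p. ?F p + 1 * ?W p) (s, b) + (h - 32 * \<delta> ^ 5) \<le> ?F (s, b) + 1 * ?W (s, b)"
      using excursion_value_step(1)[OF d lam s] barrier_step[OF d lam s]
      unfolding T_def h_def distrib_left[of _ "32 * \<delta> ^ 5"] by linarith
  qed
  have low: "(- h - 32 * \<delta> ^ 5) * suminf c \<le> -1 * ?F (0, 0) + 1 * ?W (0, 0)"
  proof (rule key)
    show "admissible (\<lambda>p. -1 * ?F p + 1 * ?W p)" by (intro admissible_add admissible_cmult aF aW)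
    fix s b :: real assume s: "0 \<le> s" "b \<le> s"
    have "T (\<lambda>p. -1 * ?F p + 1 * ?W p) (s, b) = T (\<lambda>p. -1 * ?F p) (s, b) + 1 * T ?W (s, b)"
      unfolding T_def by (rule walk_step_linear[OF admissible_cmult[OF aF] aW h(1) s(1)])
    moreover have "T (\<lambda>p. -1 * ?F p) (s, b) = - T ?F (s, b)"
      by (simp add: T_def walk_step_def)
    moreover have "exp (- (\<delta> ^ 4 * (lam + s))) * (32 * \<delta> ^ 5) \<le> 1 * (32 * \<delta> ^ 5)"
      using d lam s by (intro mult_right_mono) auto
    moreover have "0 \<le> h * (1 - exp (- (\<delta> ^ 4 * (lam + s))))"
      using h d lam s by (intro mult_nonneg_nonneg) auto
    ultimately show "T (\<lambda>p. -1 * ?F p + 1 * ?W p) (s, b) + (- h - 32 * \<delta> ^ 5) \<le> -1 * ?F (s, b) + 1 * ?W (s, b)"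
      using excursion_value_step(2)[OF d lam s] barrier_step[OF d lam s]
      unfolding T_def h_def distrib_left[of _ "32 * \<delta> ^ 5"] by linarith
  qed
  have cq: "\<bar>suminf c\<bar> \<le> (\<Sum>k. q ^ k)"
    using norm_suminf_le[of c "\<lambda>k. q ^ k"] c_le sq by auto
  have "32 * \<delta> ^ 5 * suminf c \<le> 32 * \<delta> ^ 5 * (\<Sum>k. q ^ k)"
    using cq d by (intro mult_left_mono) auto
  moreover have "32 * \<delta> ^ 5 * (\<Sum>k. q ^ k) = 32 * \<delta> * (h * (\<Sum>k. q ^ k))"
    by (simp add: h_def eval_nat_numeral)
  ultimately have "\<bar>h * suminf c - laplace_value lam\<bar> \<le> 9 * \<delta> + 32 * \<delta> * (h * (\<Sum>k. q ^ k))"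
    using up low W0 unfolding F0 left_diff_distrib by (simp add: abs_le_iff)
  then show ?thesis
    by (simp add: c_eq[abs_def] h_def q_def)
qed

section \<open>Discretization of the Brownian path\<close>

definition walk_pos :: "(nat \<Rightarrow> real) \<Rightarrow> nat \<Rightarrow> real" where
  "walk_pos \<omega> k = (\<Sum>i<k. \<omega> i)"

definition walk_max :: "(nat \<Rightarrow> real) \<Rightarrow> nat \<Rightarrow> real" where
  "walk_max \<omega> k = Max (walk_pos \<omega> ` {..k})"

text \<open>Left endpoints, so that each step is weighted by the maximum before it, as in
  \<open>walk_step\<close>.\<close>

definition walk_area :: "(nat \<Rightarrow> real) \<Rightarrow> nat \<Rightarrow> real" where
  "walk_area \<omega> k = (\<Sum>j<k. walk_max \<omega> j)"

lemma walk_pos_Suc [simp]: "walk_pos \<omega> (Suc k) = walk_pos \<omega> k + \<omega> k"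
  and walk_area_Suc [simp]: "walk_area \<omega> (Suc k) = walk_area \<omega> k + walk_max \<omega> k"
  and walk_pos_0 [simp]: "walk_pos \<omega> 0 = 0" and walk_area_0 [simp]: "walk_area \<omega> 0 = 0"
  and walk_max_0 [simp]: "walk_max \<omega> 0 = 0"
  by (simp_all add: walk_pos_def walk_area_def walk_max_def)

lemma walk_max_Suc [simp]: "walk_max \<omega> (Suc k) = max (walk_max \<omega> k) (walk_pos \<omega> k + \<omega> k)"
  unfolding walk_max_def atMost_Suc image_insert by (subst Max_insert) (auto simp: max.commute)

lemma walk_cong:
  assumes "\<And>i. i < k \<Longrightarrow> \<omega> i = \<omega>' i"
  shows "walk_pos \<omega> k = walk_pos \<omega>' k \<and> walk_max \<omega> k = walk_max \<omega>' k \<and> walk_area \<omega> k = walk_area \<omega>' k"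
  using assms by (induction k) auto

lemma walk_nonneg: "0 \<le> walk_max \<omega> k \<and> walk_pos \<omega> k \<le> walk_max \<omega> k \<and> 0 \<le> walk_area \<omega> k"
  by (induction k) auto

lemma walk_measurable:
  assumes "\<And>i. i < k \<Longrightarrow> (\<lambda>\<omega>. \<xi> \<omega> i) \<in> borel_measurable Q"
  shows "(\<lambda>\<omega>. walk_pos (\<xi> \<omega>) k) \<in> borel_measurable Q \<and> (\<lambda>\<omega>. walk_max (\<xi> \<omega>) k) \<in> borel_measurable Q
    \<and> (\<lambda>\<omega>. walk_area (\<xi> \<omega>) k) \<in> borel_measurable Q"
  using assms by (induction k) auto

text \<open>The induction varies v: integrating out the last coordinate replaces v by
  \<open>walk_step h 0 v\<close>, after which one coordinate fewer remains.\<close>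

lemma gaussian_walk_expectation:
  fixes h :: real
  defines "N \<equiv> density lborel (normal_density 0 (sqrt h))"
  assumes h: "h > 0" and v: "admissible v"
  shows "(LINT \<omega>|Pi\<^sub>M {..<k} (\<lambda>_. N). exp (- (h * walk_area \<omega> k)) * v (walk_max \<omega> k, walk_pos \<omega> k))
    = (walk_step h 0 ^^ k) v (0, 0)"
  using v
proof (induction k arbitrary: v)
  case 0
  show ?case by (simp add: PiM_empty)
next
  case (Suc k)
  have "prob_space N" unfolding N_def using h by (intro prob_space_normal_density) auto
  then interpret N: prob_space N .
  interpret product_prob_space "\<lambda>_. N" UNIV ..
  have sN: "sets N = sets borel" by (simp add: N_def)
  note v = Suc.prems
  have mv: "v \<in> borel_measurable (borel \<Otimes>\<^sub>M borel)" using v by (simp add: admissible_def)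
  obtain C where C: "\<And>s b. 0 \<le> s \<Longrightarrow> b \<le> s \<Longrightarrow> \<bar>v (s, b)\<bar> \<le> C"
    using v by (auto simp: admissible_def)
  define f where "f = (\<lambda>\<omega>. exp (- (h * walk_area \<omega> (Suc k))) * v (walk_max \<omega> (Suc k), walk_pos \<omega> (Suc k)))"
  have comp: "(\<lambda>\<omega>. \<omega> i) \<in> borel_measurable (Pi\<^sub>M {..<Suc k} (\<lambda>_. N))" if "i < Suc k" for i
    using measurable_component_singleton[of i "{..<Suc k}" "\<lambda>_. N"] that by (simp add: measurable_cong_sets[OF refl sN])
  have mf: "f \<in> borel_measurable (Pi\<^sub>M {..<Suc k} (\<lambda>_. N))"
  proof -
    note m = walk_measurable[of "Suc k" "\<lambda>\<omega>. \<omega>", OF comp]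
    have [measurable]: "(\<lambda>\<omega>. walk_area \<omega> (Suc k)) \<in> borel_measurable (Pi\<^sub>M {..<Suc k} (\<lambda>_. N))"
      using m by blast
    have [measurable]: "(\<lambda>\<omega>. v (walk_max \<omega> (Suc k), walk_pos \<omega> (Suc k))) \<in> borel_measurable (Pi\<^sub>M {..<Suc k} (\<lambda>_. N))"
      using m by (intro measurable_compose[OF _ mv] measurable_Pair) blast+
    show ?thesis unfolding f_def by measurable
  qed
  interpret PI: prob_space "Pi\<^sub>M {..<Suc k} (\<lambda>_. N)" by (rule prob_space_PiM) (rule N.prob_space_axioms)
  have if': "integrable (Pi\<^sub>M {..<Suc k} (\<lambda>_. N)) f"
  proof (rule PI.integrable_const_bound[where B = C])
    show "AE \<omega> in Pi\<^sub>M {..<Suc k} (\<lambda>_. N). norm (f \<omega>) \<le> C"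
    proof (rule AE_I2)
      fix \<omega> :: "nat \<Rightarrow> real"
      have w: "0 \<le> walk_max \<omega> (Suc k)" "walk_pos \<omega> (Suc k) \<le> walk_max \<omega> (Suc k)" "0 \<le> walk_area \<omega> (Suc k)"
        using walk_nonneg by blast+
      have "norm (f \<omega>) \<le> 1 * C"
        unfolding f_def norm_mult using C[OF w(1,2)] w(3) h by (intro mult_mono) auto
      then show "norm (f \<omega>) \<le> C" by simp
    qed
  qed (rule mf)
  have fup: "f (fun_upd \<omega> k z) = exp (- (h * walk_area \<omega> k)) * (exp (- (h * walk_max \<omega> k)) * v (max (walk_max \<omega> k) (walk_pos \<omega> k + z), walk_pos \<omega> k + z))" for \<omega> z
  proof -
    have "walk_pos (fun_upd \<omega> k z) k = walk_pos \<omega> k \<and> walk_max (fun_upd \<omega> k z) k = walk_max \<omega> k \<and> walk_area (fun_upd \<omega> k z) k = walk_area \<omega> k"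
      by (rule walk_cong) auto
    then show ?thesis by (simp add: f_def distrib_left exp_diff exp_minus field_simps exp_add)
  qed
  have inner: "(LINT z|N. f (fun_upd \<omega> k z)) = exp (- (h * walk_area \<omega> k)) * walk_step h 0 v (walk_max \<omega> k, walk_pos \<omega> k)" for \<omega>
  proof -
    have mz: "(\<lambda>z. v (max (walk_max \<omega> k) (walk_pos \<omega> k + z), walk_pos \<omega> k + z)) \<in> borel_measurable lborel"
      by (rule measurable_compose[OF _ mv]) measurable
    have "(LINT z|N. v (max (walk_max \<omega> k) (walk_pos \<omega> k + z), walk_pos \<omega> k + z))
       = (LINT z|lborel. normal_density 0 (sqrt h) z * v (max (walk_max \<omega> k) (walk_pos \<omega> k + z), walk_pos \<omega> k + z))"
      unfolding N_def by (subst integral_density[OF mz]) auto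
    then show ?thesis unfolding fup by (simp add: walk_step_def)
  qed
  have "(LINT \<omega>|Pi\<^sub>M {..<Suc k} (\<lambda>_. N). f \<omega>) = (LINT \<omega>|Pi\<^sub>M {..<k} (\<lambda>_. N). LINT z|N. f (fun_upd \<omega> k z))"
    using product_integral_insert[of "{..<k}" k f] if' by (simp add: lessThan_Suc)
  also have "\<dots> = (walk_step h 0 ^^ k) (walk_step h 0 v) (0, 0)"
    unfolding inner by (rule Suc.IH) (rule admissible_walk_step[OF v h order_refl])
  finally show ?case by (simp add: f_def funpow_swap1)
qed

text \<open>It serves twice: the grid area becomes an integral over time, and the discounted sum
  over walk lengths becomes a Laplace integral.\<close>

lemma step_function_integral:
  fixes g :: "nat \<Rightarrow> real"
  assumes w: "w > 0"
  shows "has_bochner_integral lborel (\<lambda>t. indicator {0..<real n * w} t * g (nat \<lfloor>t / w\<rfloor>)) (w * (\<Sum>k<n. g k))"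
proof (induction n)
  case (Suc n)
  have m: "measure lborel {real n * w..<real (Suc n) * w} = w"
    by (subst measure_lborel_Ico) (use w in \<open>auto simp: algebra_simps\<close>)
  have "has_bochner_integral lborel (\<lambda>t. indicator {real n * w..<real (Suc n) * w} t *\<^sub>R g n) (w *\<^sub>R g n)"
    using has_bochner_integral_indicator[of "{real n * w..<real (Suc n) * w}" lborel "g n"] w
    unfolding m by (auto simp: emeasure_lborel_Ico)
  from has_bochner_integral_add[OF Suc this]
  have "has_bochner_integral lborel (\<lambda>t. indicator {0..<real n * w} t * g (nat \<lfloor>t / w\<rfloor>)
      + indicator {real n * w..<real (Suc n) * w} t *\<^sub>R g n) (w * (\<Sum>k<n. g k) + w * g n)"
    by simp
  moreover have "indicator {0..<real n * w} t * g (nat \<lfloor>t / w\<rfloor>) + indicator {real n * w..<real (Suc n) * w} t *\<^sub>R g n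
      = indicator {0..<real (Suc n) * w} t * g (nat \<lfloor>t / w\<rfloor>)" for t
  proof (cases "t \<in> {real n * w..<real (Suc n) * w}")
    case True
    then have "real n \<le> t / w" "t / w < real (Suc n)" using w by (auto simp: field_simps)
    then have "\<lfloor>t / w\<rfloor> = int n" by (auto simp: floor_eq_iff)
    moreover have "t \<ge> 0" using True w by (auto intro: order_trans[of 0 "real n * w"])
    ultimately show ?thesis using True by (auto simp: indicator_def)
  next
    case False
    have "real n * w \<le> real (Suc n) * w" using w by simp
    with False show ?thesis by (auto simp: indicator_def)
  qed
  ultimately show ?case by (simp add: algebra_simps)
qed auto

text \<open>
  Since \<open>B 0\<close> vanishes only almost surely, it is subtracted: then the grid areas converge on the whole
  space, which gives the measurability of \<open>max_area\<close>.
\<close>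

definition grid_max :: "(real \<Rightarrow> 'a \<Rightarrow> real) \<Rightarrow> nat \<Rightarrow> 'a \<Rightarrow> nat \<Rightarrow> real" where
  "grid_max B n \<omega> k = Max ((\<lambda>j. B (real j / real n) \<omega> - B 0 \<omega>) ` {..k})"

definition grid_area :: "(real \<Rightarrow> 'a \<Rightarrow> real) \<Rightarrow> nat \<Rightarrow> 'a \<Rightarrow> real" where
  "grid_area B n \<omega> = (\<Sum>k<n. grid_max B n \<omega> k) / real n"

lemma grid_max_nonneg: "grid_max B n \<omega> k \<ge> 0"
  unfolding grid_max_def by (rule Max_ge) (auto intro!: image_eqI[of _ _ 0])

lemma grid_area_nonneg: "grid_area B n \<omega> \<ge> 0"
  unfolding grid_area_def by (intro divide_nonneg_nonneg sum_nonneg grid_max_nonneg) auto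

context standard_brownian_motion
begin

lemma grid_area_measurable: "grid_area B n \<in> borel_measurable M"
proof -
  have "(\<lambda>\<omega>. grid_max B n \<omega> k) \<in> borel_measurable M" for k
    unfolding grid_max_def by (intro borel_measurable_Max borel_measurable_diff measurable_B) auto
  then show ?thesis unfolding grid_area_def [abs_def] by (intro borel_measurable_divide borel_measurable_sum) auto
qed

text \<open>Increments over 1/n have variance 1/n; multiplied by sqrt c they form the walk with step
  variance c/n. In the discount exponent the variance gives a factor c and the positions a factor
  sqrt c, which is the power 3/2.\<close>

lemma expectation_grid_area:
  assumes n: "n > 0" and c: "c > 0"
  shows "(LINT \<omega>|M. exp (- (c powr (3/2) * grid_area B n \<omega>))) = (walk_step (c / n) 0 ^^ n) (\<lambda>_. 1) (0, 0)"
proof -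
  define h where "h = c / n"
  have h: "h > 0" using n c by (simp add: h_def)
  define N where "N = density lborel (normal_density 0 (sqrt h))"
  define \<xi> where "\<xi> = (\<lambda>i \<omega>. sqrt c * (B (real (Suc i) / n) \<omega> - B (real i / n) \<omega>))"
  have m\<xi>: "\<xi> i \<in> borel_measurable M" for i
    unfolding \<xi>_def using measurable_B by (intro borel_measurable_times borel_measurable_diff) auto
  have iv: "indep_vars (\<lambda>_. borel) \<xi> {..<n}"
  proof -
    have "indep_vars (\<lambda>_. borel) (\<lambda>i \<omega>. B (real (Suc i) / n) \<omega> - B (real i / n) \<omega>) {..<n}"
      using indep_increments[of "\<lambda>i. real i / n" n] by (simp add: divide_right_mono)
    from indep_vars_compose2[OF this, of "\<lambda>_ x. sqrt c * x" "\<lambda>_. borel"] show ?thesis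
      by (simp add: \<xi>_def)
  qed
  have d\<xi>: "distr M borel (\<xi> i) = N" for i
  proof -
    have "distributed M lborel (\<lambda>\<omega>. B (real (Suc i) / n) \<omega> - B (real i / n) \<omega>) (normal_density 0 (sqrt (real (Suc i) / n - real i / n)))"
      using n by (intro gaussian_increments) (auto simp: divide_strict_right_mono)
    moreover have "real (Suc i) / n - real i / n = 1 / n"
      by (simp add: diff_divide_distrib[symmetric])
    ultimately have "distributed M lborel (\<lambda>\<omega>. B (real (Suc i) / n) \<omega> - B (real i / n) \<omega>) (normal_density 0 (sqrt (1 / n)))"
      by simp
    from normal_density_affine[OF this, of "sqrt c" 0]
    have "distributed M lborel (\<xi> i) (normal_density 0 (sqrt c * sqrt (1 / n)))"
      using n c by (simp add: \<xi>_def)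
    also have "sqrt c * sqrt (1 / n) = sqrt h" by (simp add: h_def flip: real_sqrt_mult)
    finally have "distr M lborel (\<xi> i) = N" by (simp add: distributed_def N_def)
    moreover have "distr M borel (\<xi> i) = distr M lborel (\<xi> i)" by (rule distr_cong) auto
    ultimately show ?thesis by simp
  qed
  \<comment> \<open>Independence and equal laws identify the joint law of the scaled increments with
    the product measure of the walk.\<close>
  have PiM: "distr M (Pi\<^sub>M {..<n} (\<lambda>_. borel)) (\<lambda>\<omega>. \<lambda>i\<in>{..<n}. \<xi> i \<omega>) = Pi\<^sub>M {..<n} (\<lambda>_. N)"
    using indep_vars_iff_distr_eq_PiM[where I = "{..<n}" and M' = "\<lambda>_. borel" and X = \<xi>] iv m\<xi> n by (auto simp: d\<xi>)
  define g where "g = (\<lambda>\<omega>::nat \<Rightarrow> real. exp (- (h * walk_area \<omega> n)) * (1::real))"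
  have mg: "g \<in> borel_measurable (Pi\<^sub>M {..<n} (\<lambda>_. borel))"
  proof -
    have "(\<lambda>\<omega>. \<omega> i) \<in> borel_measurable (Pi\<^sub>M {..<n} (\<lambda>_. borel :: real measure))" if "i < n" for i
      using measurable_component_singleton[of i "{..<n}" "\<lambda>_. borel :: real measure"] that by simp
    from walk_measurable[of n "\<lambda>\<omega>. \<omega>", OF this]
    have [measurable]: "(\<lambda>\<omega>. walk_area \<omega> n) \<in> borel_measurable (Pi\<^sub>M {..<n} (\<lambda>_. borel :: real measure))" by blast
    show ?thesis unfolding g_def by measurable
  qed
  have "(walk_step h 0 ^^ n) (\<lambda>_. 1) (0, 0) = (LINT \<omega>|Pi\<^sub>M {..<n} (\<lambda>_. N). g \<omega>)"
    using gaussian_walk_expectation[OF h admissible_const[of 1], of n] by (simp add: g_def N_def)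
  also have "\<dots> = (LINT \<omega>|M. g (\<lambda>i\<in>{..<n}. \<xi> i \<omega>))"
    unfolding PiM[symmetric] by (rule integral_distr[OF _ mg]) (use m\<xi> in measurable)
  also have "\<dots> = (LINT \<omega>|M. exp (- (c powr (3/2) * grid_area B n \<omega>)))"
  proof (rule Bochner_Integration.integral_cong[OF refl])
    fix \<omega>
    define x where "x = (\<lambda>i\<in>{..<n}. \<xi> i \<omega>)"
    have x: "x i = \<xi> i \<omega>" if "i < n" for i using that by (simp add: x_def)
    have pos: "walk_pos x k = sqrt c * (B (real k / n) \<omega> - B 0 \<omega>)" if "k \<le> n" for k
    proof -
      have "walk_pos x k = (\<Sum>i<k. \<xi> i \<omega>)" using that by (simp add: walk_pos_def x)
      also have "\<dots> = sqrt c * (\<Sum>i<k. B (real (Suc i) / n) \<omega> - B (real i / n) \<omega>)"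
        by (simp add: \<xi>_def sum_distrib_left)
      also have "(\<Sum>i<k. B (real (Suc i) / n) \<omega> - B (real i / n) \<omega>) = B (real k / n) \<omega> - B 0 \<omega>"
        using sum_lessThan_telescope[of "\<lambda>i. B (real i / n) \<omega>" k] by simp
      finally show ?thesis .
    qed
    have max: "walk_max x k = sqrt c * grid_max B n \<omega> k" if "k < n" for k
    proof -
      have "walk_max x k = Max ((\<lambda>x. sqrt c * x) ` (\<lambda>j. B (real j / real n) \<omega> - B 0 \<omega>) ` {..k})"
        unfolding walk_max_def image_image using that by (intro arg_cong[of _ _ Max] image_cong pos) auto
      also have "\<dots> = sqrt c * grid_max B n \<omega> k"
        unfolding grid_max_def using c by (intro mono_Max_commute[symmetric]) (auto intro!: monoI mult_left_mono)
      finally show ?thesis .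
    qed
    have "h * walk_area x n = c / n * (sqrt c * (\<Sum>k<n. grid_max B n \<omega> k))"
      by (simp add: h_def walk_area_def max sum_distrib_left)
    also have "\<dots> = (c * sqrt c) * grid_area B n \<omega>" by (simp add: grid_area_def)
    also have "c * sqrt c = c powr (3/2)"
      using c powr_add[of c 1 "1/2"] by (simp add: powr_half_sqrt)
    finally show "g (\<lambda>i\<in>{..<n}. \<xi> i \<omega>) = exp (- (c powr (3/2) * grid_area B n \<omega>))"
      by (simp only: g_def x_def mult_1_right)
  qed
  finally show ?thesis by (simp add: h_def)
qed

text \<open>For fixed t the grid maximum converges because the continuous path attains its maximum
  on {0..t}; bounded convergence over {0..<1} then passes to the area.\<close>

lemma grid_area_tendsto:
  assumes \<omega>: "\<omega> \<in> space M"
  shows "(\<lambda>n. grid_area B n \<omega>) \<longlonglongrightarrow> max_area B \<omega> - B 0 \<omega>"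
proof -
  define f where "f = (\<lambda>t. B t \<omega>)"
  define S where "S = (\<lambda>t. SUP u\<in>{0..t}. f u)"
  have cont: "continuous_on {0..t} f" for t
    using continuous_paths[OF \<omega>] unfolding f_def by (rule continuous_on_subset) auto
  have attained: "\<exists>u\<in>{0..t}. f u = S t \<and> (\<forall>v\<in>{0..t}. f v \<le> f u)" if t: "t \<ge> 0" for t
  proof -
    obtain u where u: "u \<in> {0..t}" "\<forall>v\<in>{0..t}. f v \<le> f u"
      using continuous_attains_sup[OF compact_Icc _ cont, of t] t by auto
    then have "S t = f u" unfolding S_def by (intro cSup_eq_maximum) auto
    with u show ?thesis by auto
  qed
  have S_ge: "f v \<le> S t" if "0 \<le> v" "v \<le> t" for v t
    using attained[of t] that by (metis atLeastAtMost_iff order_trans)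
  obtain K where K: "\<And>v. v \<in> {0..1} \<Longrightarrow> \<bar>f v\<bar> \<le> K"
    using compact_imp_bounded[OF compact_continuous_image[OF cont[of 1] compact_Icc]] by (force simp: bounded_iff)
  have S_abs: "\<bar>S t\<bar> \<le> K" if "0 \<le> t" "t \<le> 1" for t
    using attained[of t] K that by force
  define G where "G = (\<lambda>n t. grid_max B n \<omega> (nat \<lfloor>t * real n\<rfloor>))"
  have floor_le: "real (nat \<lfloor>t * real n\<rfloor>) / real n \<le> t" if "t \<ge> 0" "n > 0" for t n
    using that by (simp add: pos_divide_le_eq)
  have G_le: "G n t \<le> S t - f 0" if "t \<ge> 0" "n > 0" for n t
    unfolding G_def grid_max_def
  proof (rule Max.boundedI)
    fix x assume "x \<in> (\<lambda>j. B (real j / real n) \<omega> - B 0 \<omega>) ` {..nat \<lfloor>t * real n\<rfloor>}"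
    then obtain j where j: "j \<le> nat \<lfloor>t * real n\<rfloor>" "x = f (real j / real n) - f 0" by (auto simp: f_def)
    have "real j / real n \<le> real (nat \<lfloor>t * real n\<rfloor>) / real n" using j by (intro divide_right_mono) auto
    also note floor_le[OF that]
    finally show "x \<le> S t - f 0" using S_ge[of "real j / real n" t] j by simp
  qed auto
  have G_lim: "(\<lambda>n. G n t) \<longlonglongrightarrow> S t - f 0" if t: "t \<ge> 0" for t
  proof -
    \<comment> \<open>The maximizer is approached by grid points from the left. These also precede
      t, so they take part in the grid maximum, which gives the lower half of the sandwich.\<close>
    obtain u where u: "u \<in> {0..t}" "f u = S t" using attained[OF t] by auto
    have fl: "(\<lambda>n. real (nat \<lfloor>u * real n\<rfloor>) / real n) \<longlonglongrightarrow> u"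
    proof (rule tendsto_sandwich)
      show "eventually (\<lambda>n. real (nat \<lfloor>u * real n\<rfloor>) / real n \<le> u) sequentially"
        using eventually_gt_at_top[of 0] by eventually_elim (use u floor_le in auto)
      show "eventually (\<lambda>n. u - 1 / real n \<le> real (nat \<lfloor>u * real n\<rfloor>) / real n) sequentially"
        using eventually_gt_at_top[of 0]
      proof eventually_elim
        case (elim n)
        have "u * real n - 1 \<le> real (nat \<lfloor>u * real n\<rfloor>)" using u by linarith
        then have "(u * real n - 1) / real n \<le> real (nat \<lfloor>u * real n\<rfloor>) / real n"
          by (rule divide_right_mono) auto
        then show ?case using elim by (simp add: diff_divide_distrib)
      qed
      show "(\<lambda>n. u - 1 / real n) \<longlonglongrightarrow> u" by real_asymp
    qed auto
    have "(\<lambda>n. f (real (nat \<lfloor>u * real n\<rfloor>) / real n)) \<longlonglongrightarrow> f u"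
    proof (rule continuous_on_tendsto_compose[OF cont[of "u + 1"] fl])
      show "eventually (\<lambda>n. real (nat \<lfloor>u * real n\<rfloor>) / real n \<in> {0..u + 1}) sequentially"
        using eventually_gt_at_top[of 0]
      proof eventually_elim
        case (elim n)
        then show ?case using floor_le[of u n] u by auto
      qed
    qed (use u in auto)
    then have low: "(\<lambda>n. f (real (nat \<lfloor>u * real n\<rfloor>) / real n) - f 0) \<longlonglongrightarrow> S t - f 0"
      using u by (intro tendsto_diff) auto
    show ?thesis
    proof (rule tendsto_sandwich[OF _ _ low tendsto_const])
      show "eventually (\<lambda>n. G n t \<le> S t - f 0) sequentially"
        using eventually_gt_at_top[of 0] by eventually_elim (use t G_le in auto)
      show "eventually (\<lambda>n. f (real (nat \<lfloor>u * real n\<rfloor>) / real n) - f 0 \<le> G n t) sequentially"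
      proof (rule always_eventually, rule allI)
        fix n
        have "nat \<lfloor>u * real n\<rfloor> \<le> nat \<lfloor>t * real n\<rfloor>"
          using u by (intro nat_mono floor_mono mult_right_mono) auto
        then show "f (real (nat \<lfloor>u * real n\<rfloor>) / real n) - f 0 \<le> G n t"
          unfolding G_def grid_max_def f_def by (intro Max_ge) auto
      qed
    qed
  qed
  have area: "grid_area B n \<omega> = (LINT t|lborel. indicator {0..<1} t * G n t)"
    and mG: "(\<lambda>t. indicator {0..<1} t * G n t) \<in> borel_measurable lborel" if "n > 0" for n
    using step_function_integral[of "1 / real n" n "grid_max B n \<omega>"] that
    by (auto simp: has_bochner_integral_iff G_def grid_area_def)
  have K0: "K \<ge> 0" using K[of 0] by simp
  have mS: "(\<lambda>t. indicator {0..<1} t * (S t - f 0)) \<in> borel_measurable lborel"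
  proof (rule borel_measurable_LIMSEQ_real)
    show "(\<lambda>n. indicator {0..<1} t * G (Suc n) t) \<longlonglongrightarrow> indicator {0..<1} t * (S t - f 0)" for t
      using LIMSEQ_Suc[OF G_lim[of t]] by (cases "t \<ge> 0") (auto intro!: tendsto_mult)
  qed (rule mG, simp)
  \<comment> \<open>The shift to \<open>Suc n\<close> avoids the degenerate grid n = 0.\<close>
  have "(\<lambda>n. LINT t|lborel. indicator {0..<1} t * G (Suc n) t) \<longlonglongrightarrow> (LINT t|lborel. indicator {0..<1} t * (S t - f 0))"
  proof (rule integral_dominated_convergence[where w = "\<lambda>t. indicator {0..<1} t * (2 * K)"])
    show "integrable lborel (\<lambda>t::real. indicator {0..<1} t * (2 * K))"
      by (intro integrable_mult_left integrable_real_indicator) auto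
    show "AE t in lborel. (\<lambda>n. indicator {0..<1} t * G (Suc n) t) \<longlonglongrightarrow> indicator {0..<1} t * (S t - f 0)"
      using LIMSEQ_Suc[OF G_lim] by (intro AE_I2) (auto simp: indicator_def)
    show "AE t in lborel. norm (indicator {0..<1} t * G (Suc n) t) \<le> indicator {0..<1} t * (2 * K)" for n
    proof (rule AE_I2)
      fix t :: real
      have "\<bar>G (Suc n) t\<bar> \<le> 2 * K" if "0 \<le> t" "t < 1"
        using G_le[of t "Suc n"] grid_max_nonneg[of B "Suc n" \<omega>] S_abs[of t] K[of 0] that by (auto simp: G_def abs_le_iff)
      then show "norm (indicator {0..<1} t * G (Suc n) t) \<le> indicator {0..<1} t * (2 * K)"
        by (auto simp: indicator_def)
    qed
  qed (use mS mG in auto)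
  then have "(\<lambda>n. grid_area B (Suc n) \<omega>) \<longlonglongrightarrow> (LINT t|lborel. indicator {0..<1} t * (S t - f 0))"
    by (simp add: area)
  moreover have "(LINT t|lborel. indicator {0..<1} t * (S t - f 0)) = max_area B \<omega> - B 0 \<omega>"
  proof -
    have mS': "(\<lambda>t. indicator {0..<1} t * S t) \<in> borel_measurable lborel"
    proof -
      have "(\<lambda>t. indicator {0..<1} t * (S t - f 0) + indicator {0..<1} t * f 0) \<in> borel_measurable lborel"
        using mS by (intro borel_measurable_add) auto
      then show ?thesis by (simp add: algebra_simps)
    qed
    have iS: "integrable lborel (\<lambda>t. indicator {0..<1} t * S t)"
    proof (rule integrable_of_bound)
      show "integrable lborel (\<lambda>t::real. indicator {0..<1} t * K)"
        by (intro integrable_mult_left integrable_real_indicator) auto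
      show "\<bar>indicator {0..<1} t * S t\<bar> \<le> indicator {0..<1} t * K" for t
        using S_abs by (auto simp: indicator_def)
    qed (rule mS')
    have "(LINT t|lborel. indicator {0..<1} t * (S t - f 0)) = (LINT t|lborel. indicator {0..<1} t * S t - indicator {0..<1} t * f 0)"
      by (simp add: right_diff_distrib)
    also have "\<dots> = (LINT t|lborel. indicator {0..<1} t * S t) - (LINT t|lborel. indicator {0..<1::real} t * f 0)"
      by (intro Bochner_Integration.integral_diff iS integrable_mult_left integrable_real_indicator) auto
    also have "(LINT t|lborel. indicator {0..<1::real} t * f 0) = f 0" by simp
    also have "(LINT t|lborel. indicator {0..<1} t * S t) = max_area B \<omega>"
    proof -
      have ae: "AE t in lborel. indicator {0..<1} t * S t = indicator {0..1} t * S t"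
        using AE_lborel_singleton[of "1::real"] by eventually_elim (auto simp: indicator_def)
      have m1: "(\<lambda>t. indicator {0..1} t * S t) \<in> borel_measurable lborel"
      proof -
        have "(\<lambda>t. indicator {0..<1} t * S t + indicator {1} t * S 1) \<in> borel_measurable lborel"
          using mS' by (intro borel_measurable_add) auto
        then show ?thesis by (rule measurable_cong[THEN iffD1, rotated]) (auto simp: indicator_def)
      qed
      have "(LINT t|lborel. indicator {0..<1} t * S t) = (LINT t|lborel. indicator {0..1} t * S t)"
        using mS' m1 ae by (rule integral_cong_AE)
      then show ?thesis
        by (simp add: max_area_def set_lebesgue_integral_def running_max_def S_def f_def)
    qed
    finally show ?thesis by (simp add: f_def)
  qed
  ultimately show ?thesis by (simp add: LIMSEQ_imp_Suc)
qed

end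

text \<open>The geometric sum is at most 1 / lam + h. It shows that the error in
  \<open>walk_resolvent\<close> is of order delta.\<close>

lemma geometric_discount_le:
  fixes h lam :: real
  assumes h: "0 < h" "h \<le> 1" and lam: "lam \<ge> 1"
  shows "h * (\<Sum>k. exp (- (h * lam)) ^ k) \<le> 2"
proof -
  define x where "x = h * lam"
  have x: "x > 0" using h lam by (simp add: x_def)
  have "1 + x \<le> exp x" by (rule exp_ge_add_one_self)
  then have "exp (- x) \<le> 1 / (1 + x)"
    using x by (simp add: exp_minus field_simps)
  then have "x / (1 + x) \<le> 1 - exp (- x)"
    using x by (simp add: field_simps)
  moreover have "x / (1 + x) > 0" using x by simp
  ultimately have "h / (1 - exp (- x)) \<le> h / (x / (1 + x))"
    using h x by (intro divide_left_mono mult_pos_pos) auto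
  also have "\<dots> = 1 / lam + h"
    using h lam x by (simp add: x_def field_simps)
  also have "\<dots> \<le> 1 + 1" using h lam by (intro add_mono) auto
  finally have "h / (1 - exp (- x)) \<le> 2" by simp
  moreover have "(\<Sum>k. exp (- (h * lam)) ^ k) = 1 / (1 - exp (- x))"
    using x by (simp add: suminf_geometric x_def)
  ultimately show ?thesis by simp
qed

section \<open>The Laplace transform of the area functional\<close>

context standard_brownian_motion
begin

definition area_transform :: "real \<Rightarrow> real" where
  "area_transform t = (LINT \<omega>|M. exp (- (t powr (3/2) * max_area B \<omega>)))"

lemma max_area_measurable: "max_area B \<in> borel_measurable M"
proof -
  have m0: "B 0 \<in> borel_measurable M" by (rule measurable_B) simp
  have "(\<lambda>\<omega>. max_area B \<omega> - B 0 \<omega>) \<in> borel_measurable M"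
    by (rule borel_measurable_LIMSEQ_real[OF grid_area_tendsto grid_area_measurable])
  then have "(\<lambda>\<omega>. (max_area B \<omega> - B 0 \<omega>) + B 0 \<omega>) \<in> borel_measurable M"
    using m0 by (rule borel_measurable_add)
  then show ?thesis by simp
qed

lemma max_area_nonneg: "AE \<omega> in M. max_area B \<omega> \<ge> 0"
  using starts_at_0 AE_space
proof eventually_elim
  case (elim \<omega>)
  have "0 \<le> max_area B \<omega> - B 0 \<omega>"
    by (rule LIMSEQ_le_const[OF grid_area_tendsto[OF elim(2)]]) (auto intro: grid_area_nonneg)
  then show ?case using elim by simp
qed

text \<open>The factor c may vary with the grid because a walk of whole steps of size h reaches only
  a multiple of h near t. The limit in c is taken inside the expectation, pathwise, together with
  the one in the grid.\<close>

lemma area_transform_tendsto: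
  assumes c: "c \<longlonglongrightarrow> t" "t > 0" and n: "filterlim n at_top sequentially"
  shows "(\<lambda>m. LINT \<omega>|M. exp (- (c m powr (3/2) * grid_area B (n m) \<omega>))) \<longlonglongrightarrow> area_transform t"
  unfolding area_transform_def
proof (rule integral_dominated_convergence[where w = "\<lambda>_. 1"])
  note [measurable] = max_area_measurable grid_area_measurable
  show "(\<lambda>\<omega>. exp (- (t powr (3/2) * max_area B \<omega>))) \<in> borel_measurable M" by measurable
  show "(\<lambda>\<omega>. exp (- (c m powr (3/2) * grid_area B (n m) \<omega>))) \<in> borel_measurable M" for m by measurable
  show "AE \<omega> in M. (\<lambda>m. exp (- (c m powr (3/2) * grid_area B (n m) \<omega>))) \<longlonglongrightarrow> exp (- (t powr (3/2) * max_area B \<omega>))"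
    using starts_at_0 AE_space
  proof eventually_elim
    case (elim \<omega>)
    have "(\<lambda>m. grid_area B (n m) \<omega>) \<longlonglongrightarrow> max_area B \<omega>"
      using filterlim_compose[OF grid_area_tendsto[OF elim(2)] n] elim(1) by simp
    then show ?case using c by (intro tendsto_intros) auto
  qed
  show "AE \<omega> in M. norm (exp (- (c m powr (3/2) * grid_area B (n m) \<omega>))) \<le> 1" for m
    using grid_area_nonneg by (intro AE_I2) (auto intro!: mult_nonneg_nonneg)
qed auto

lemma continuous_on_area_transform: "continuous_on {0<..} area_transform"
  unfolding continuous_on_sequentially
proof (intro allI ballI impI)
  fix u :: "nat \<Rightarrow> real" and t assume "t \<in> {0<..}" "(\<forall>n. u n \<in> {0<..}) \<and> u \<longlonglongrightarrow> t"
  then have t: "t > 0" and u: "u \<longlonglongrightarrow> t" by auto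
  note [measurable] = max_area_measurable
  show "(area_transform \<circ> u) \<longlonglongrightarrow> area_transform t"
    unfolding area_transform_def comp_def
  proof (rule integral_dominated_convergence[where w = "\<lambda>_. 1"])
    show "AE \<omega> in M. (\<lambda>n. exp (- (u n powr (3/2) * max_area B \<omega>))) \<longlonglongrightarrow> exp (- (t powr (3/2) * max_area B \<omega>))"
      using u t by (intro AE_I2 tendsto_intros) auto
    show "AE \<omega> in M. norm (exp (- (u n powr (3/2) * max_area B \<omega>))) \<le> 1" for n
      using max_area_nonneg by eventually_elim simp
  qed auto
qed

text \<open>The discounted sum of \<open>walk_resolvent\<close> is the integral of a step function
  in t. Its integrals tend to \<open>laplace_value lam\<close> by \<open>walk_resolvent\<close>, its
  values to the integrand here by \<open>expectation_grid_area\<close>; dominated convergence joins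
  both limits.\<close>

lemma area_transform_laplace:
  assumes lam: "lam \<ge> 1"
  shows "has_bochner_integral lborel (\<lambda>t. indicator {0<..} t * (exp (- (lam * t)) * area_transform t)) (laplace_value lam)"
proof -
  define U where "U = (\<lambda>h k. (walk_step h 0 ^^ k) (\<lambda>_. 1) (0, 0))"
  have U_le: "\<bar>U h k\<bar> \<le> 1" if "h > 0" for h k
    using walk_funpow_bound[of "\<lambda>_. 1" 1 h 0 0 0 k] that by (simp add: U_def)
  define h where "h = (\<lambda>m. 1 / real (Suc m))"
  have h: "h m > 0" "h m \<le> 1" for m by (auto simp: h_def)
  define \<Phi> where "\<Phi> = (\<lambda>m t. exp (- (h m * lam)) ^ nat \<lfloor>t / h m\<rfloor> * U (h m) (nat \<lfloor>t / h m\<rfloor>))"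
  \<comment> \<open>Rounding t down to a multiple of h <= 1 loses at most 1, which costs the factor
    exp lam in the majorant.\<close>
  define w where "w = (\<lambda>t::real. exp lam * (indicator {0..} t * exp (- (lam * t))))"
  have iw: "integrable lborel w"
    unfolding w_def using has_bochner_integral_exp_minus[of lam] lam
    by (intro integrable_mult_right) (auto simp: has_bochner_integral_iff)
  have \<Phi>_le: "\<bar>indicator {0..} t * \<Phi> m t\<bar> \<le> w t" for m t
  proof (cases "t \<ge> 0")
    case True
    have "t / h m - 1 \<le> real (nat \<lfloor>t / h m\<rfloor>)" using True h[of m] by linarith
    then have "h m * (t / h m - 1) \<le> h m * real (nat \<lfloor>t / h m\<rfloor>)"
      using h[of m] by (intro mult_left_mono) auto
    moreover have "h m * (t / h m - 1) = t - h m" using h[of m] by (simp add: right_diff_distrib)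
    ultimately have "t - 1 \<le> h m * real (nat \<lfloor>t / h m\<rfloor>)" using h[of m] by linarith
    then have "lam * (t - 1) \<le> lam * (h m * real (nat \<lfloor>t / h m\<rfloor>))"
      using lam by (intro mult_left_mono) auto
    then have "exp (- (h m * lam)) ^ nat \<lfloor>t / h m\<rfloor> \<le> exp (lam - lam * t)"
      by (simp add: algebra_simps flip: exp_of_nat_mult)
    then have "\<bar>\<Phi> m t\<bar> \<le> exp (lam - lam * t) * 1"
      unfolding \<Phi>_def abs_mult using U_le[of "h m"] h[of m] by (intro mult_mono) auto
    then show ?thesis using True by (simp add: w_def exp_diff exp_minus field_simps)
  qed (simp add: w_def)
  have m\<Phi>: "(\<lambda>t. indicator {0..} t * \<Phi> m t) \<in> borel_measurable lborel"
    and int\<Phi>: "(LINT t|lborel. indicator {0..} t * \<Phi> m t) = h m * (\<Sum>k. exp (- (h m * lam)) ^ k * U (h m) k)" for m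
  proof -
    note sf = step_function_integral[OF h(1)[of m], of _ "\<lambda>k. exp (- (h m * lam)) ^ k * U (h m) k", folded \<Phi>_def]
    have ev: "eventually (\<lambda>n. t < real n * h m) sequentially" for t
    proof -
      obtain n where "t / h m < real n" using reals_Archimedean2 by blast
      then have "t < real n * h m" using h[of m] by (simp add: pos_divide_less_eq)
      then show ?thesis
        using h[of m] by (intro eventually_sequentiallyI[of n]) (smt (verit) mult_right_mono of_nat_le_iff)
    qed
    have lim: "(\<lambda>n. indicator {0..<real n * h m} t * \<Phi> m t) \<longlonglongrightarrow> indicator {0..} t * \<Phi> m t" for t
      by (rule tendsto_eventually) (use ev[of t] in eventually_elim, auto simp: indicator_def)
    have m: "(\<lambda>t. indicator {0..<real n * h m} t * \<Phi> m t) \<in> borel_measurable lborel" for n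
      using sf[of n] by (auto simp: has_bochner_integral_iff \<Phi>_def)
    show m': "(\<lambda>t. indicator {0..} t * \<Phi> m t) \<in> borel_measurable lborel"
      by (rule borel_measurable_LIMSEQ_real[OF lim m])
    have "(\<lambda>n. LINT t|lborel. indicator {0..<real n * h m} t * \<Phi> m t) \<longlonglongrightarrow> (LINT t|lborel. indicator {0..} t * \<Phi> m t)"
    proof (rule integral_dominated_convergence[OF m' m iw])
      show "AE t in lborel. (\<lambda>n. indicator {0..<real n * h m} t * \<Phi> m t) \<longlonglongrightarrow> indicator {0..} t * \<Phi> m t"
        using lim by (intro AE_I2)
      show "AE t in lborel. norm (indicator {0..<real n * h m} t * \<Phi> m t) \<le> w t" for n
      proof (rule AE_I2)
        fix t
        have "norm (indicator {0..<real n * h m} t * \<Phi> m t) \<le> \<bar>indicator {0..} t * \<Phi> m t\<bar>"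
          by (auto simp: indicator_def)
        then show "norm (indicator {0..<real n * h m} t * \<Phi> m t) \<le> w t" using \<Phi>_le by (rule order_trans)
      qed
    qed
    moreover have "(LINT t|lborel. indicator {0..<real n * h m} t * \<Phi> m t) = h m * (\<Sum>k<n. exp (- (h m * lam)) ^ k * U (h m) k)" for n
      using sf[of n] by (auto simp: has_bochner_integral_iff \<Phi>_def)
    moreover have "(\<lambda>n. h m * (\<Sum>k<n. exp (- (h m * lam)) ^ k * U (h m) k)) \<longlonglongrightarrow> h m * (\<Sum>k. exp (- (h m * lam)) ^ k * U (h m) k)"
    proof (intro tendsto_mult tendsto_const summable_LIMSEQ)
      have "summable (\<lambda>k. exp (- (h m * lam)) ^ k)"
        using h[of m] lam by (intro summable_geometric) auto
      then show "summable (\<lambda>k. exp (- (h m * lam)) ^ k * U (h m) k)"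
      proof (rule summable_comparison_test')
        show "norm (exp (- (h m * lam)) ^ k * U (h m) k) \<le> exp (- (h m * lam)) ^ k" for k
          using U_le[of "h m" k] h[of m] by (simp add: abs_mult mult_left_le)
      qed
    qed
    ultimately show "(LINT t|lborel. indicator {0..} t * \<Phi> m t) = h m * (\<Sum>k. exp (- (h m * lam)) ^ k * U (h m) k)"
      using LIMSEQ_unique by simp
  qed
  have lim_int: "(\<lambda>m. LINT t|lborel. indicator {0..} t * \<Phi> m t) \<longlonglongrightarrow> laplace_value lam"
  proof -
    define \<delta> where "\<delta> = (\<lambda>m. h m powr (1/4))"
    have \<delta>: "\<delta> m > 0" "\<delta> m \<le> 1" "\<delta> m ^ 4 = h m" for m
      using h[of m] by (auto simp: \<delta>_def powr_le_one_le powr_powr simp flip: powr_realpow) (simp add: powr_mono_both powr_le1)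
    \<comment> \<open>The geometric factor is at most 2, so 73 = 9 + 32 * 2.\<close>
    have bound: "norm ((LINT t|lborel. indicator {0..} t * \<Phi> m t) - laplace_value lam) \<le> 73 * \<delta> m" for m
    proof -
      have "\<bar>(LINT t|lborel. indicator {0..} t * \<Phi> m t) - laplace_value lam\<bar> \<le> 9 * \<delta> m + 32 * \<delta> m * (h m * (\<Sum>k. exp (- (h m * lam)) ^ k))"
        using walk_resolvent[OF \<delta>(1,2)[of m] lam] unfolding int\<Phi> \<delta>(3) U_def .
      also have "\<dots> \<le> 9 * \<delta> m + 32 * \<delta> m * 2"
        using \<delta>[of m] h[of m] lam by (intro add_left_mono mult_left_mono geometric_discount_le) auto
      finally show ?thesis by simp
    qed
    have "(\<lambda>m. 73 * \<delta> m) \<longlonglongrightarrow> 0"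
      unfolding \<delta>_def h_def by real_asymp
    then have "(\<lambda>m. (LINT t|lborel. indicator {0..} t * \<Phi> m t) - laplace_value lam) \<longlonglongrightarrow> 0"
      by (rule Lim_null_comparison[OF always_eventually[OF allI[OF bound]]])
    then show ?thesis by (rule LIM_zero_cancel)
  qed
  have ptw: "(\<lambda>m. \<Phi> m t) \<longlonglongrightarrow> exp (- (lam * t)) * area_transform t" if t: "t > 0" for t
  proof -
    define n where "n = (\<lambda>m. nat \<lfloor>t / h m\<rfloor>)"
    have n_top: "filterlim n at_top sequentially"
      unfolding n_def h_def using t by (simp, real_asymp)
    have c: "(\<lambda>m. real (n m) * h m) \<longlonglongrightarrow> t"
    proof (rule tendsto_sandwich)
      have nb: "t / h m - 1 \<le> real (n m) \<and> real (n m) \<le> t / h m" for m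
      proof -
        have "t / h m \<ge> 0" using t h[of m] by simp
        then show ?thesis unfolding n_def by (intro conjI) linarith+
      qed
      show "eventually (\<lambda>m. t - h m \<le> real (n m) * h m) sequentially"
      proof (intro always_eventually allI)
        fix m
        have "(t / h m - 1) * h m \<le> real (n m) * h m" using nb[of m] h[of m] by (intro mult_right_mono) auto
        then show "t - h m \<le> real (n m) * h m" using h[of m] by (simp add: left_diff_distrib)
      qed
      show "eventually (\<lambda>m. real (n m) * h m \<le> t) sequentially"
      proof (intro always_eventually allI)
        fix m
        have "real (n m) * h m \<le> t / h m * h m" using nb[of m] h[of m] by (intro mult_right_mono) auto
        then show "real (n m) * h m \<le> t" using h[of m] by simp
      qed
      show "(\<lambda>m. t - h m) \<longlonglongrightarrow> t" unfolding h_def by real_asymp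
    qed auto
    have "(\<lambda>m. exp (- (lam * (real (n m) * h m))) * (LINT \<omega>|M. exp (- ((real (n m) * h m) powr (3/2) * grid_area B (n m) \<omega>))))
        \<longlonglongrightarrow> exp (- (lam * t)) * area_transform t"
      using c by (intro tendsto_mult tendsto_exp tendsto_minus tendsto_const area_transform_tendsto[OF c t n_top])
    moreover have "eventually (\<lambda>m. exp (- (lam * (real (n m) * h m))) * (LINT \<omega>|M. exp (- ((real (n m) * h m) powr (3/2) * grid_area B (n m) \<omega>))) = \<Phi> m t) sequentially"
      using filterlim_at_top[THEN iffD1, OF n_top, rule_format, of 1]
    proof eventually_elim
      case (elim m)
      then have elim: "n m > 0" by simp
      have "(LINT \<omega>|M. exp (- ((real (n m) * h m) powr (3/2) * grid_area B (n m) \<omega>))) = U (h m) (n m)"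
        using expectation_grid_area[OF elim, of "real (n m) * h m"] elim h[of m] by (simp add: U_def)
      moreover have "exp (- (lam * (real (n m) * h m))) = exp (- (h m * lam)) ^ n m"
        by (simp add: mult_ac flip: exp_of_nat_mult)
      ultimately show ?case by (simp add: \<Phi>_def n_def)
    qed
    ultimately show ?thesis by (rule Lim_transform_eventually)
  qed
  define F where "F = (\<lambda>t. indicator {0<..} t * (exp (- (lam * t)) * area_transform t))"
  have mF: "F \<in> borel_measurable lborel"
  proof -
    have "(\<lambda>t. indicator {0<..} t *\<^sub>R (exp (- (lam * t)) * area_transform t)) \<in> borel_measurable borel"
      by (intro borel_measurable_continuous_on_indicator continuous_intros continuous_on_area_transform) auto
    then show ?thesis by (simp add: F_def)
  qed
  have ae: "AE t in lborel. (\<lambda>m. indicator {0..} t * \<Phi> m t) \<longlonglongrightarrow> F t"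
    using AE_lborel_singleton[of "0::real"]
  proof eventually_elim
    case (elim t)
    then show ?case using ptw[of t] by (auto simp: F_def indicator_def)
  qed
  have w: "AE t in lborel. norm (indicator {0..} t * \<Phi> m t) \<le> w t" for m
    using \<Phi>_le by (intro AE_I2) simp
  have "integrable lborel F" by (rule integrable_dominated_convergence[OF mF m\<Phi> iw ae w])
  moreover have "(LINT t|lborel. F t) = laplace_value lam"
    by (rule LIMSEQ_unique[OF integral_dominated_convergence[OF mF m\<Phi> iw ae w] lim_int])
  ultimately show ?thesis by (simp add: has_bochner_integral_iff F_def)
qed

text \<open>Only differences of Laplace transforms are known on the spectral side, so uniqueness is
  applied to the difference of the two functions times exp (- t) - exp (- 2 * t), a weight that is
  nonzero for t > 0.\<close>

lemma area_transform_eq: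
  assumes t: "t > 0"
  shows "area_transform t = spectral_moment 1 t"
proof -
  define w where "w = (\<lambda>t. (exp (- (1 * t)) - exp (- (2 * t))) * (area_transform t - spectral_moment 1 t))"
  have key: "has_bochner_integral lborel (\<lambda>t. indicator {0<..} t *\<^sub>R (exp (- (real n * t)) * w t)) 0" for n
  proof -
    \<comment> \<open>With l = n + 1 and m = n + 2 the weight splits off and exp (- n * t) remains,
      the exponential that \<open>laplace_transform_unique\<close> requires.\<close>
    define l m where "l = real (n + 1)" and "m = real (n + 2)"
    have lm: "1 \<le> l" "l < m" "1 \<le> m" by (auto simp: l_def m_def)
    have "has_bochner_integral lborel (\<lambda>t. indicator {0<..} t * (exp (- (l * t)) * area_transform t)
        - indicator {0<..} t * (exp (- (m * t)) * area_transform t)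
        - indicator {0..} t * ((exp (- (l * t)) - exp (- (m * t))) * spectral_moment 1 t))
       (laplace_value l - laplace_value m - (ode_sol (sqrt l) - ode_sol (sqrt m)))"
      by (intro has_bochner_integral_diff area_transform_laplace spectral_moment_laplace lm)
    moreover have "indicator {0<..} t * (exp (- (l * t)) * area_transform t)
        - indicator {0<..} t * (exp (- (m * t)) * area_transform t)
        - indicator {0..} t * ((exp (- (l * t)) - exp (- (m * t))) * spectral_moment 1 t)
      = indicator {0<..} t *\<^sub>R (exp (- (real n * t)) * w t)" for t :: real
    proof -
      have "exp (- (l * t)) = exp (- (real n * t)) * exp (- (1 * t))" "exp (- (m * t)) = exp (- (real n * t)) * exp (- (2 * t))"
        by (simp_all add: l_def m_def algebra_simps flip: exp_add)
      then show ?thesis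
        by (cases "t = 0") (auto simp: w_def indicator_def algebra_simps)
    qed
    ultimately show ?thesis by (simp add: laplace_value_def)
  qed
  have "w t = 0"
  proof (rule laplace_transform_unique[OF _ _ _ t])
    show "set_integrable lborel {0<..} w"
      using key[of 0] by (simp add: set_integrable_def has_bochner_integral_iff)
    show "(LINT t:{0<..}|lborel. exp (- (real n * t)) * w t) = 0" for n
      using key[of n] by (simp add: set_lebesgue_integral_def has_bochner_integral_iff)
    have "continuous_on {0<..} (spectral_moment 1)"
      by (intro continuous_at_imp_continuous_on ballI) (auto intro: DERIV_isCont DERIV_spectral_moment)
    then show "continuous_on {0<..} w"
      unfolding w_def by (intro continuous_intros continuous_on_area_transform)
  qed
  then show ?thesis using t by (simp add: w_def)
qed

end

section \<open>The density and its expansion\<close>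

text \<open>Integrals of f over {a..y} are differences of tail probabilities, hence of
  \<open>spectral_moment 1\<close>. Continuity of f allows differentiation at the given point, not
  merely almost everywhere.\<close>

lemma (in standard_brownian_motion) density_eq_spectral_moment:
  assumes N: "prob_space N" and X: "X \<in> borel_measurable N"
    and tail: "\<And>x. 0 < x \<Longrightarrow> measure N {\<omega> \<in> space N. x < X \<omega>}
           = (LINT \<omega>|M. exp (- (x powr (3/2) * max_area B \<omega>)))"
    and f_nonneg: "\<And>x. 0 \<le> f x" and f: "distributed N lborel X (\<lambda>x. ennreal (f x))"
    and cont: "continuous_on {0<..} f" and x: "x > 0"
  shows "f x = spectral_moment 3 x"
proof -
  interpret N: prob_space N by (rule N)
  have tail': "measure N {\<omega> \<in> space N. x < X \<omega>} = spectral_moment 1 x" if "x > 0" for x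
    using tail[OF that] area_transform_eq[OF that] by (simp add: area_transform_def)
  have int: "integral {a..y} f = spectral_moment 1 a - spectral_moment 1 y" if a: "0 < a" "a \<le> y" for a y
  proof -
    have c: "continuous_on {a..y} f" using cont by (rule continuous_on_subset) (use a in auto)
    have si: "set_integrable lborel {a..y} f" using c by (rule borel_integrable_atLeastAtMost')
    have si': "set_integrable lborel {a<..y} f" using si by (rule set_integrable_subset) auto
    have "emeasure N (X -` {a<..y} \<inter> space N) = (\<integral>\<^sup>+ t. ennreal (f t) * indicator {a<..y} t \<partial>lborel)"
      using distributed_emeasure[OF f, of "{a<..y}"] by simp
    also have "\<dots> = (\<integral>\<^sup>+ t. ennreal (indicator {a<..y} t *\<^sub>R f t) \<partial>lborel)"
      by (intro nn_integral_cong) (auto simp: indicator_def)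
    also have "\<dots> = ennreal (LINT t:{a<..y}|lborel. f t)"
      using si' f_nonneg unfolding set_integrable_def set_lebesgue_integral_def
      by (intro nn_integral_eq_integral) auto
    finally have "measure N (X -` {a<..y} \<inter> space N) = (LINT t:{a<..y}|lborel. f t)"
      using f_nonneg by (simp add: measure_def set_lebesgue_integral_def integral_nonneg_AE)
    also have "(LINT t:{a<..y}|lborel. f t) = (LINT t:{a..y}|lborel. f t)"
      unfolding set_lebesgue_integral_def
    proof (rule integral_cong_AE)
      show "AE t in lborel. indicator {a<..y} t *\<^sub>R f t = indicator {a..y} t *\<^sub>R f t"
        using AE_lborel_singleton[of a] by eventually_elim (auto simp: indicator_def)
    qed (use si si' in \<open>auto simp: set_integrable_def\<close>)
    also have "\<dots> = integral {a..y} f" by (rule set_borel_integral_eq_integral(2)[OF si])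
    finally have 1: "measure N (X -` {a<..y} \<inter> space N) = integral {a..y} f" .
    have "X -` {a<..y} \<inter> space N = {\<omega> \<in> space N. a < X \<omega>} - {\<omega> \<in> space N. y < X \<omega>}" by auto
    moreover have "measure N ({\<omega> \<in> space N. a < X \<omega>} - {\<omega> \<in> space N. y < X \<omega>})
        = measure N {\<omega> \<in> space N. a < X \<omega>} - measure N {\<omega> \<in> space N. y < X \<omega>}"
      using X a by (intro N.finite_measure_Diff) auto
    ultimately show ?thesis using 1 tail'[of a] tail'[of y] a by simp
  qed
  define a b where "a = x / 2" and "b = 2 * x"
  have ab: "0 < a" "a < x" "x < b" using x by (auto simp: a_def b_def)
  have "((\<lambda>y. integral {a..y} f) has_real_derivative f x) (at x within {a..b})"
    by (rule integral_has_real_derivative) (use ab in \<open>auto intro: continuous_on_subset[OF cont]\<close>)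
  then have "((\<lambda>y. spectral_moment 1 a - spectral_moment 1 y) has_real_derivative f x) (at x within {a..b})"
    by (rule has_field_derivative_transform_within[where d = 1]) (use ab int in auto)
  then have "((\<lambda>y. spectral_moment 1 a - spectral_moment 1 y) has_real_derivative f x) (at x)"
    using ab by (simp add: at_within_Icc_at)
  moreover have "((\<lambda>y. spectral_moment 1 a - spectral_moment 1 y) has_real_derivative spectral_moment 3 x) (at x)"
    using DERIV_diff[OF DERIV_const DERIV_spectral_moment[OF x, of 1], of "spectral_moment 1 a"] by (simp add: numeral_3_eq_3)
  ultimately show ?thesis by (rule DERIV_unique)
qed

text \<open>This is Gamma (e + 1/2) / t^(e + 1/2), with the Gamma value in closed form.\<close>

definition gaussian_moment :: "nat \<Rightarrow> real \<Rightarrow> real" where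
  "gaussian_moment e t = sqrt pi * fact (2 * e) / (4 ^ e * fact e) / (t ^ e * sqrt t)"

lemma gaussian_moment_eq:
  assumes "t > 0" "p = 2 * e"
  shows "2 * (LINT r|lborel. indicator {0..} r * (exp (- (r\<^sup>2 * t)) * r ^ p)) = gaussian_moment e t"
  using has_bochner_integral_gaussian_moment[OF assms(1), of e] unfolding assms(2)
  by (simp add: has_bochner_integral_iff gaussian_moment_def power_mult)

lemma gaussian_moment_Suc:
  assumes "t > 0"
  shows "gaussian_moment (Suc e) t = gaussian_moment e t * (real e + 1/2) / t"
proof -
  have "fact (2 * Suc e) = (2 * real e + 2) * (2 * real e + 1) * (fact (2 * e) :: real)" by (simp add: algebra_simps)
  moreover have "fact (Suc e) = (real e + 1) * (fact e :: real)" by (simp add: algebra_simps)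
  ultimately show ?thesis
    using assms unfolding gaussian_moment_def by (simp add: divide_simps add_nonneg_eq_0_iff) (simp add: algebra_simps)
qed

text \<open>One step within either series raises the exponent of r by 6, hence e by 3.\<close>

lemma gaussian_moment_add3:
  assumes "t > 0"
  shows "gaussian_moment (e + 3) t = gaussian_moment e t * ((real e + 1/2) * (real e + 3/2) * (real e + 5/2)) / t ^ 3"
  using assms by (simp add: eval_nat_numeral gaussian_moment_Suc add_ac mult_ac)

lemma spectral_coeff_even_Suc:
  "spectral_coeff (2 * Suc n) = spectral_coeff (2 * n) * (- 8 / ((6 * real n + 4) * (6 * real n + 7)))"
proof -
  have "rate * rate = 8" using rate_sq by (simp add: power2_eq_square)
  then have "ode_coeff (2 * Suc n) = ode_coeff (2 * n) * (8 / ((6 * real n + 4) * (6 * real n + 7)))"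
    by (simp add: mult.assoc algebra_simps)
  then show ?thesis unfolding spectral_coeff_def by simp
qed

lemma spectral_coeff_odd_Suc:
  "spectral_coeff (2 * Suc n + 1) = spectral_coeff (2 * n + 1) * (- (8 / 9) / ((2 * real n + 3) * (2 * real n + 2)))"
proof -
  have "(rate / 3) ^ (2 * Suc n + 1) = (rate / 3) ^ (2 * n + 1) * (rate / 3)\<^sup>2"
    by (simp add: power2_eq_square)
  also have "(rate / 3)\<^sup>2 = 8 / 9" by (simp add: power_divide rate_sq)
  finally have 1: "(rate / 3) ^ (2 * Suc n + 1) = (rate / 3) ^ (2 * n + 1) * (8 / 9)" .
  have 2: "fact (2 * Suc n + 1) = (fact (2 * n + 1) :: real) * ((2 * real n + 3) * (2 * real n + 2))"
    by (simp add: algebra_simps)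
  have "odd (2 * Suc n + 1)" "odd (2 * n + 1)" "(2 * Suc n + 1) div 2 = Suc n" "(2 * n + 1) div 2 = n" by auto
  then show ?thesis unfolding spectral_coeff_def 1 2 by (simp only: if_False power_Suc) (simp add: field_simps)
qed

text \<open>The upper parameter 1 cancels the factorial, which leaves two factors over one.\<close>

lemma hypergeo_term_Suc_3F1:
  "hypergeo_term [3/2, 5/6, 1] [2/3] z (Suc n)
    = hypergeo_term [3/2, 5/6, 1] [2/3] z n * ((real n + 3/2) * (real n + 5/6) / (real n + 2/3) * z)"
proof -
  have fact: "fact (Suc n) = (1 + real n) * fact n" by (simp add: algebra_simps)
  have cancel: "A * a * (B * b) * (C * c) / (P * p * (c * F)) * (y * w) = A * B * C / (P * F) * w * (a * b / p * y)"
    if "c \<noteq> 0" for A a B b C c P p F y w :: real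
    using that by (simp add: divide_simps)
  have "hypergeo_term [3/2, 5/6, 1] [2/3] z (Suc n) = pochhammer (3/2) n * (3/2 + real n) * (pochhammer (5/6) n * (5/6 + real n))
      * (pochhammer 1 n * (1 + real n)) / (pochhammer (2/3) n * (2/3 + real n) * ((1 + real n) * fact n)) * (z * z ^ n)"
    by (simp add: hypergeo_term_def pochhammer_Suc fact del: fact_Suc)
  also have "\<dots> = pochhammer (3/2) n * pochhammer (5/6) n * pochhammer 1 n / (pochhammer (2/3) n * fact n) * z ^ n
      * ((3/2 + real n) * (5/6 + real n) / (2/3 + real n) * z)"
    by (rule cancel) auto
  finally show ?thesis by (simp add: hypergeo_term_def add.commute)
qed

lemma hypergeo_term_Suc_2F0:
  "hypergeo_term [11/6, 7/6] [] z (Suc n)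
    = hypergeo_term [11/6, 7/6] [] z n * ((real n + 11/6) * (real n + 7/6) / (real n + 1) * z)"
proof -
  have fact: "fact (Suc n) = (1 + real n) * fact n" by (simp add: algebra_simps)
  have cancel: "A * a * (B * b) / (c * F) * (y * w) = A * B / F * w * (a * b / c * y)" for A a B b c F y w :: real
    by (simp add: divide_simps)
  have "hypergeo_term [11/6, 7/6] [] z (Suc n) = pochhammer (11/6) n * (11/6 + real n) * (pochhammer (7/6) n * (7/6 + real n))
      / ((1 + real n) * fact n) * (z * z ^ n)"
    by (simp add: hypergeo_term_def pochhammer_Suc fact del: fact_Suc)
  also have "\<dots> = pochhammer (11/6) n * pochhammer (7/6) n / fact n * z ^ n * ((11/6 + real n) * (7/6 + real n) / (1 + real n) * z)"
    by (rule cancel)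
  finally show ?thesis by (simp add: hypergeo_term_def add.commute)
qed

lemma hypergeo_term_0 [simp]: "hypergeo_term as bs z 0 = 1"
proof -
  have "foldl (\<lambda>r a. r * pochhammer a 0) c as = c" for c :: real and as
    by (induction as arbitrary: c) auto
  then show ?thesis by (simp add: hypergeo_term_def fps_hypergeo_def)
qed

text \<open>Both sides agree at n = 0 and have the same ratio of consecutive terms: the moment
  factor 3n + 7/2 cancels 6n + 7, and the constants combine to - 8 * 27 / 36 = - 6.\<close>

lemma first_series_term:
  assumes x: "x > 0"
  shows "3 / sqrt (2 * pi) * x powr (-5/2) * hypergeo_term [3/2, 5/6, 1] [2/3] (- 6 / x ^ 3) n
    = spectral_coeff (2 * n) * gaussian_moment (3 * n + 2) x"
proof (induction n)
  case 0
  have pw: "x powr (-5/2) = 1 / (x ^ 2 * sqrt x)"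
  proof -
    have "x powr (-5/2) = 1 / x powr (5/2)" using powr_minus_divide[of x "5/2"] by simp
    also have "x powr (5/2) = x powr 2 * x powr (1/2)" by (simp flip: powr_add)
    also have "x powr 2 = x ^ 2" using x by (simp add: powr_numeral)
    also have "x powr (1/2) = sqrt x" using x by (simp add: powr_half_sqrt)
    finally show ?thesis .
  qed
  have const: "2 * a / (b * b) * (b * (3/4)) = 3 / (a * b)" if "a * a = 2" "a \<noteq> 0" "b \<noteq> 0" for a b :: real
  proof -
    have "3 / (a * b) = 3 * a / ((a * a) * b)" using that(2,3) by simp
    then show ?thesis unfolding that(1) using that(3) by (simp add: field_simps)
  qed
  have "spectral_coeff (2 * 0) * gaussian_moment (3 * 0 + 2) x = rate / pi * (sqrt pi * (3/4)) * (1 / (x ^ 2 * sqrt x))"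
    by (simp add: spectral_coeff_def gaussian_moment_def fact_numeral power2_eq_square mult_ac)
  also have "rate / pi * (sqrt pi * (3/4)) = 3 / sqrt (2 * pi)"
    using const[of "sqrt 2" "sqrt pi"] by (simp add: rate_def real_sqrt_mult)
  also note pw[symmetric]
  finally show ?case by (simp only: hypergeo_term_0 mult_1_right)
next
  case (Suc n)
  have cancel: "a * b / p * (- 6 / y) = (- 8 / ((6 * p) * (6 * s))) * ((3 * b) * (3 * s) * (3 * a)) / y"
    if "p \<noteq> 0" "s \<noteq> 0" "y \<noteq> 0" for a b p s y :: real
    using that by (simp add: field_simps)
  have f: "6 * real n + 4 = 6 * (real n + 2/3)" "6 * real n + 7 = 6 * (real n + 7/6)"
    "real (3 * n + 2) + 1/2 = 3 * (real n + 5/6)" "real (3 * n + 2) + 3/2 = 3 * (real n + 7/6)"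
    "real (3 * n + 2) + 5/2 = 3 * (real n + 3/2)"
    by simp_all
  have n: "real n + 2/3 \<noteq> 0" "real n + 7/6 \<noteq> 0" "x ^ 3 \<noteq> 0" using x by (auto simp: add_nonneg_eq_0_iff)
  define C where "C = - 8 / ((6 * real n + 4) * (6 * real n + 7))"
  define Q where "Q = ((real (3 * n + 2) + 1/2) * (real (3 * n + 2) + 3/2) * (real (3 * n + 2) + 5/2))"
  have r: "(real n + 3/2) * (real n + 5/6) / (real n + 2/3) * (- 6 / x ^ 3) = C * Q / x ^ 3"
    unfolding C_def Q_def f by (rule cancel[OF n])
  have g: "gaussian_moment (3 * Suc n + 2) x = gaussian_moment (3 * n + 2) x * Q / x ^ 3"
    using gaussian_moment_add3[OF x, of "3 * n + 2"] by (simp add: Q_def algebra_simps)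
  have "3 / sqrt (2 * pi) * x powr (-5/2) * hypergeo_term [3/2, 5/6, 1] [2/3] (- 6 / x ^ 3) (Suc n)
      = 3 / sqrt (2 * pi) * x powr (-5/2) * hypergeo_term [3/2, 5/6, 1] [2/3] (- 6 / x ^ 3) n * (C * Q / x ^ 3)"
    unfolding hypergeo_term_Suc_3F1 r by (rule mult.assoc[symmetric])
  also have "\<dots> = (spectral_coeff (2 * n) * C) * (gaussian_moment (3 * n + 2) x * Q / x ^ 3)"
    unfolding Suc.IH by simp
  also have "\<dots> = spectral_coeff (2 * Suc n) * gaussian_moment (3 * Suc n + 2) x"
    unfolding g spectral_coeff_even_Suc C_def ..
  finally show ?case .
qed

text \<open>The same comparison of ratios: here 3n + 9/2 cancels 2n + 3, and the constants combine
  to - (8/9) * 27 / 4 = - 6.\<close>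

lemma second_series_term:
  assumes x: "x > 0"
  shows "5 * Gamma (1/3) / (2 powr (1/2) * 3 powr (2/3) * pi powr (1/2)) * x powr (-7/2) * hypergeo_term [11/6, 7/6] [] (- 6 / x ^ 3) n
    = spectral_coeff (2 * n + 1) * gaussian_moment (3 * n + 3) x"
proof (induction n)
  case 0
  have 1: "x powr (-7/2) = 1 / (x ^ 3 * sqrt x)"
  proof -
    have "x powr (-7/2) = 1 / x powr (7/2)" using powr_minus_divide[of x "7/2"] by simp
    also have "x powr (7/2) = x powr 3 * x powr (1/2)" by (simp flip: powr_add)
    also have "x powr 3 = x ^ 3" using x by (simp add: powr_numeral)
    also have "x powr (1/2) = sqrt x" using x by (simp add: powr_half_sqrt)
    finally show ?thesis .
  qed
  have 2: "3 powr (1/3) * 3 powr (2/3) = (3::real)" by (simp flip: powr_add)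
  have const: "(2 / 3 * u * G) * (2 * a / 3) / (b * b) * (b * (15 / 8)) = 5 * G / (a * v * b)"
    if "a * a = 2" "u * v = 3" "a \<noteq> 0" "b \<noteq> 0" "u \<noteq> 0" for a b u v G :: real
  proof -
    have "5 * G / (a * v * b) = 5 * G * (a * u) / ((a * a) * (u * v) * b)" using that(3,5) by simp
    then show ?thesis unfolding that(1,2) using that(4) by (simp add: field_simps)
  qed
  have "spectral_coeff (2 * 0 + 1) * gaussian_moment (3 * 0 + 3) x = connect * (rate / 3) / pi * (sqrt pi * (15 / 8)) * (1 / (x ^ 3 * sqrt x))"
    by (simp add: spectral_coeff_def gaussian_moment_def fact_numeral)
  also have "connect * (rate / 3) / pi * (sqrt pi * (15 / 8)) = 5 * Gamma (1/3) / (sqrt 2 * 3 powr (2/3) * sqrt pi)"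
    using const[of "sqrt 2" "3 powr (1/3)" "3 powr (2/3)" "sqrt pi" "Gamma (1/3)"] 2 by (simp add: connect_def rate_def)
  also have "sqrt 2 = 2 powr (1/2)" by (simp add: powr_half_sqrt)
  also have "sqrt pi = pi powr (1/2)" by (simp add: powr_half_sqrt)
  also note 1[symmetric]
  finally show ?case by (simp only: hypergeo_term_0 mult_1_right)
next
  case (Suc n)
  have cancel: "a * b / p * (- 6 / y) = (- (8 / 9) / ((2 * s) * (2 * p))) * ((3 * b) * (3 * s) * (3 * a)) / y"
    if "p \<noteq> 0" "s \<noteq> 0" "y \<noteq> 0" for a b p s y :: real
    using that by (simp add: field_simps)
  have f: "2 * real n + 3 = 2 * (real n + 3/2)" "2 * real n + 2 = 2 * (real n + 1)"
    "real (3 * n + 3) + 1/2 = 3 * (real n + 7/6)" "real (3 * n + 3) + 3/2 = 3 * (real n + 3/2)"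
    "real (3 * n + 3) + 5/2 = 3 * (real n + 11/6)"
    by simp_all
  have n: "real n + 1 \<noteq> 0" "real n + 3/2 \<noteq> 0" "x ^ 3 \<noteq> 0" using x by (auto simp: add_nonneg_eq_0_iff)
  define C where "C = - (8 / 9) / ((2 * real n + 3) * (2 * real n + 2))"
  define Q where "Q = ((real (3 * n + 3) + 1/2) * (real (3 * n + 3) + 3/2) * (real (3 * n + 3) + 5/2))"
  have r: "(real n + 11/6) * (real n + 7/6) / (real n + 1) * (- 6 / x ^ 3) = C * Q / x ^ 3"
    unfolding C_def Q_def f by (rule cancel[OF n])
  have g: "gaussian_moment (3 * Suc n + 3) x = gaussian_moment (3 * n + 3) x * Q / x ^ 3"
    using gaussian_moment_add3[OF x, of "3 * n + 3"] by (simp add: Q_def algebra_simps)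
  have "5 * Gamma (1/3) / (2 powr (1/2) * 3 powr (2/3) * pi powr (1/2)) * x powr (-7/2) * hypergeo_term [11/6, 7/6] [] (- 6 / x ^ 3) (Suc n)
      = 5 * Gamma (1/3) / (2 powr (1/2) * 3 powr (2/3) * pi powr (1/2)) * x powr (-7/2) * hypergeo_term [11/6, 7/6] [] (- 6 / x ^ 3) n * (C * Q / x ^ 3)"
    unfolding hypergeo_term_Suc_2F0 r by (rule mult.assoc[symmetric])
  also have "\<dots> = (spectral_coeff (2 * n + 1) * C) * (gaussian_moment (3 * n + 3) x * Q / x ^ 3)"
    unfolding Suc.IH by simp
  also have "\<dots> = spectral_coeff (2 * Suc n + 1) * gaussian_moment (3 * Suc n + 3) x"
    unfolding g spectral_coeff_odd_Suc C_def ..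
  finally show ?case .
qed

text \<open>The remainder is bounded by a multiple of a Gaussian moment. A nonzero coefficient turns
  this into a multiple of the first omitted term.\<close>

lemma spectral_coeff_nonzero: "spectral_coeff k \<noteq> 0"
  using rate_pos connect_pos ode_coeff_pos[of k] by (simp add: spectral_coeff_def)

theorem theorem1p14:
  fixes M :: "'a measure" and B :: "real \<Rightarrow> 'a \<Rightarrow> real"
    and N :: "'b measure" and X :: "'b \<Rightarrow> real" and f :: "real \<Rightarrow> real"
  assumes "standard_brownian_motion M B"
    and "prob_space N"
    and "X \<in> borel_measurable N"
    and "AE \<omega> in N. 0 < X \<omega>"
    and "\<And>x. 0 < x \<Longrightarrow> measure N {\<omega> \<in> space N. x < X \<omega>}
           = (LINT \<omega>|M. exp (- (x powr (3/2) * max_area B \<omega>)))"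
    and "\<And>x. 0 \<le> f x"
    and "distributed N lborel X (\<lambda>x. ennreal (f x))"
    and "continuous_on {0<..} f"
  shows "(\<lambda>x. f x - 3 / sqrt (2 * pi) * x powr (-5/2)) \<in> O[at_top](\<lambda>x. x powr (-7/2))
    \<and> has_asymp_expansion f (interleave
        (\<lambda>n x. 3 / sqrt (2 * pi) * x powr (-5/2)
            * hypergeo_term [3/2, 5/6, 1] [2/3] (- 6 / x ^ 3) n)
        (\<lambda>n x. 5 * Gamma (1/3) / (2 powr (1/2) * 3 powr (2/3) * pi powr (1/2)) * x powr (-7/2)
            * hypergeo_term [11/6, 7/6] [] (- 6 / x ^ 3) n))"
proof -
  define \<phi> where "\<phi> = interleave
        (\<lambda>n x. 3 / sqrt (2 * pi) * x powr (-5/2)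
            * hypergeo_term [3/2, 5/6, 1] [2/3] (- 6 / x ^ 3) n)
        (\<lambda>n x. 5 * Gamma (1/3) / (2 powr (1/2) * 3 powr (2/3) * pi powr (1/2)) * x powr (-7/2)
            * hypergeo_term [11/6, 7/6] [] (- 6 / x ^ 3) n)"
  let ?m = "\<lambda>k x. LINT r|lborel. indicator {0..} r * (exp (- (r\<^sup>2 * x)) * r ^ (spectral_exponent k + 3)) :: real"
  have \<phi>_eq: "\<phi> k x = spectral_coeff k * (2 * ?m k x)" if x: "x > 0" for k x
  proof (cases "even k")
    case True
    then obtain n where n: "k = 2 * n" by blast
    have "2 * ?m k x = gaussian_moment (3 * n + 2) x"
      using x by (intro gaussian_moment_eq) (auto simp: spectral_exponent_def n)
    then show ?thesis using first_series_term[OF x, of n] by (simp add: \<phi>_def interleave_def n)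
  next
    case False
    then obtain n where n: "k = 2 * n + 1" by (auto elim: oddE)
    have "2 * ?m k x = gaussian_moment (3 * n + 3) x"
      using x by (intro gaussian_moment_eq) (auto simp: spectral_exponent_def n)
    then show ?thesis using second_series_term[OF x, of n] by (simp add: \<phi>_def interleave_def n)
  qed
  have f_eq: "f x = spectral_moment 3 x" if "x > 0" for x
    using standard_brownian_motion.density_eq_spectral_moment[OF assms(1,2,3,5,6,7,8) that] .
  have expansion: "(\<lambda>x. f x - (\<Sum>k<n. \<phi> k x)) \<in> O[at_top](\<phi> n)" for n
  proof -
    obtain K where K: "\<And>t. t > 0 \<Longrightarrow> \<bar>spectral_moment 3 t - (\<Sum>k<n. spectral_coeff k * (2 * ?m k t))\<bar> \<le> K * ?m n t"
      using spectral_moment_asymp[of 3 n] by auto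
    have cancel: "k * m = k / (2 * c) * (c * (2 * m))" if "c \<noteq> 0" for k m c :: real
      using that by simp
    show ?thesis
    proof (rule bigoI[where c = "\<bar>K\<bar> / (2 * \<bar>spectral_coeff n\<bar>)"])
      show "eventually (\<lambda>x. norm (f x - (\<Sum>k<n. \<phi> k x)) \<le> \<bar>K\<bar> / (2 * \<bar>spectral_coeff n\<bar>) * norm (\<phi> n x)) at_top"
        using eventually_gt_at_top[of 0]
      proof eventually_elim
        case (elim x)
        have "norm (f x - (\<Sum>k<n. \<phi> k x)) \<le> K * ?m n x"
          unfolding real_norm_def f_eq[OF elim] \<phi>_eq[OF elim] by (rule K[OF elim])
        also have "\<dots> \<le> \<bar>K\<bar> * \<bar>?m n x\<bar>" using abs_ge_self[of "K * ?m n x"] unfolding abs_mult .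
        also have "\<dots> = \<bar>K\<bar> / (2 * \<bar>spectral_coeff n\<bar>) * (\<bar>spectral_coeff n\<bar> * (2 * \<bar>?m n x\<bar>))"
          using spectral_coeff_nonzero[of n] by (intro cancel) simp
        also have "\<bar>spectral_coeff n\<bar> * (2 * \<bar>?m n x\<bar>) = norm (\<phi> n x)"
          unfolding \<phi>_eq[OF elim] real_norm_def abs_mult by (simp only: abs_numeral)
        finally show ?case .
      qed
    qed
  qed
  \<comment> \<open>Truncation after one term: the first omitted term is the leading term of the
    second series, of order x^(-7/2).\<close>
  have "(\<lambda>x. f x - (\<Sum>k<1. \<phi> k x)) \<in> O[at_top](\<phi> 1)" by (rule expansion)
  also have "\<phi> 1 \<in> O[at_top](\<lambda>x. x powr (-7/2))"
    by (simp add: \<phi>_def interleave_def)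
  finally have "(\<lambda>x. f x - 3 / sqrt (2 * pi) * x powr (-5/2)) \<in> O[at_top](\<lambda>x. x powr (-7/2))"
    by (simp add: \<phi>_def interleave_def)
  moreover have "has_asymp_expansion f \<phi>"
    unfolding has_asymp_expansion_def using expansion by blast
  ultimately show ?thesis unfolding \<phi>_def by blast
qed

end
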